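(* Let $n\ge 3$. If $K,L\subset\mathbb{R}^n$ are convex bodies, then $$V(\Pi^*(K+L))^{-\frac{1}{n(n-1)}}\ge V(\Pi^*K)^{-\frac{1}{n(n-1)}}+V(\Pi^*L)^{-\frac{1}{n(n-1)}},$$ with equality if and only if $K$ and $L$ are homothetic.
   Context: A convex body is a compact convex set with nonempty interior in $\mathbb{R}^n$; $V$ is volume and $K+L$ the Minkowski sum. $K,L$ are homothetic if $K=\lambda L+x$ for some $\lambda>0$, $x\in\mathbb{R}^n$. The projection body $\Pi K$ of a convex body $K$ is the convex body with support function $h(\Pi K,u)=\max\{u\cdot x:x\in\Pi K\}=\mathrm{vol}_{n-1}(K|u^\perp)$ for $u\in S^{n-1}$, where $K|u^\perp$ is the orthogonal projection of $K$ onto the hyperplane through the origin orthogonal to $u$. $\Pi^*K=\{x\in\mathbb{R}^n:x\cdot y\le 1\text{ for all }y\in\Pi K\}$ is the polar body of $\Pi K$. *)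

theory Defs
  imports "HOL-Analysis.Analysis"
begin

definition convex_body :: "'a::euclidean_space set \<Rightarrow> bool"
  where "convex_body K \<longleftrightarrow> compact K \<and> convex K \<and> interior K \<noteq> {}"

definition homothetic :: "'a::euclidean_space set \<Rightarrow> 'a set \<Rightarrow> bool"
  where "homothetic K L \<longleftrightarrow> (\<exists>c>0. \<exists>x. K = (\<lambda>y. c *\<^sub>R y + x) ` L)"

(* For compact nonempty K the supremum is attained, so this is the maximum. *)
definition support_function :: "'a::euclidean_space set \<Rightarrow> 'a \<Rightarrow> real"
  where "support_function K u = (SUP x\<in>K. u \<bullet> x)"

definition orthonormal_basis_of :: "'a::euclidean_space set \<Rightarrow> 'a set \<Rightarrow> bool"
  where "orthonormal_basis_of S B \<longleftrightarrow>
    pairwise orthogonal B \<and> (\<forall>b\<in>B. norm b = 1) \<and> span B = S"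

(* Lebesgue measure on a linear subspace S, of dimension dim S: the product measure of
   coordinates in an orthonormal basis of S, as in the characterisation lborel_eq of lborel.
   By rotation invariance it does not depend on the basis chosen. *)
definition subspace_lborel :: "'a::euclidean_space set \<Rightarrow> 'a measure"
  where "subspace_lborel S =
    (let B = (SOME B. orthonormal_basis_of S B)
     in distr (\<Pi>\<^sub>M b\<in>B. lborel) borel (\<lambda>f. \<Sum>b\<in>B. f b *\<^sub>R b))"

definition orth_hyperplane :: "'a::euclidean_space \<Rightarrow> 'a set"
  where "orth_hyperplane u = {x. u \<bullet> x = 0}"

(* The formula is the orthogonal projection onto orth_hyperplane u only for norm u = 1. *)
definition hyperplane_projection :: "'a::euclidean_space \<Rightarrow> 'a set \<Rightarrow> 'a set"
  where "hyperplane_projection u K = (\<lambda>x. x - (u \<bullet> x) *\<^sub>R u) ` K"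

(* A convex body is determined by the values of its support function on the unit sphere,
   and for a convex body K the required body exists (Cauchy, Minkowski). *)
definition projection_body :: "'a::euclidean_space set \<Rightarrow> 'a set"
  where "projection_body K =
    (THE P. convex_body P \<and>
       (\<forall>u. norm u = 1 \<longrightarrow>
          support_function P u =
            measure (subspace_lborel (orth_hyperplane u)) (hyperplane_projection u K)))"

definition polar_body :: "'a::euclidean_space set \<Rightarrow> 'a set"
  where "polar_body P = {x. \<forall>y\<in>P. x \<bullet> y \<le> 1}"

end

theory Submission
  imports Defs
begin

text \<open>
  For a unit vector \<open>u\<close>, the support function of \<open>\<Pi> K\<close> at \<open>u\<close> is \<open>V(K + [0, u]) - V(K)\<close>. This
  expression makes sense for every vector, and comparing the volume of \<open>K + [0, e x] + [0, e y]\<close>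
  computed in two ways shows that it is sublinear. Hence \<open>\<Pi> K\<close> exists and its polar is the unit
  sublevel set of this function \<open>b\<^sub>K\<close>.

  The Brunn--Minkowski inequality for projections gives
  \<open>b\<^bsub>K+L\<^esub>\<^bsup>1/(n-1)\<^esup> \<ge> b\<^sub>K\<^bsup>1/(n-1)\<^esup> + b\<^sub>L\<^bsup>1/(n-1)\<^esup>\<close>, and the volume of \<open>{b \<le> 1}\<close> is a weighted integral
  of \<open>b\<^bsup>-n\<^esup>\<close>, so the claim is Minkowski's inequality with the negative exponent \<open>-n(n-1)\<close>.
  Equality forces \<open>b\<^sub>K\<close> to be a multiple of \<open>b\<^sub>L\<close> and, after rescaling, equality in the
  Brunn--Minkowski inequality for all pairs of projections, which are therefore translates of each
  other. Thus the difference of the support functions is linear on every hyperplane, and since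
  \<open>n \<ge> 3\<close> it is linear.

  The Brunn--Minkowski inequality itself is proved by the Hadwiger--Ohmann argument; its version
  for subsets of a hyperplane follows by passing to cylinders over them, and the equality case is
  obtained by matching parallel hyperplanes that cut off equal volumes (Kneser--Suess).
\<close>


text \<open>The exponent is dictated by homogeneity: \<open>b_K\<close> has degree n - 1 in K, the
  volume of \<open>{b \<le> 1}\<close> has degree -n in b, so the power -1/(n(n-1)) makes every term
  of the inequality of degree 1 in K. Equivalently, the term for K is the norm of
  \<open>b_K^(1/(n-1))\<close> with the negative exponent -n(n-1). The delicate point of the
  equality case is the rescaling. Equality gives information on K + L with
  \<open>b_K = c^(n-1) b_L\<close>, whereas the Brunn--Minkowski equality theorem below compares
  sets of equal volume, so the brightness of K/c + L has to be known. It is squeezed: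
  Brunn--Minkowski bounds it from below, and writing K + L as a sum with a multiple of K/c + L as
  one summand bounds it from above. Hyperplanes are never treated as spaces of lower dimension in
  their own right. Cylinders over their subsets are full-dimensional, and volume, scaling,
  Brunn--Minkowski and its equality case are all transferred through them. The translation vectors
  found for the projections along different u are unrelated at first; only their effect on support
  functions inside the hyperplane of u is used.\<close>

abbreviation volume :: "'a::euclidean_space set \<Rightarrow> real"
  where "volume \<equiv> measure lborel"


section \<open>Lebesgue measure on hyperplanes\<close>

text \<open>Uniqueness of Haar measure by Fubini: the integral of
  \<open>indicator A (x + y) * indicator ?B y\<close> over the product of \<open>lborel\<close> and
  \<open>M\<close> equals \<open>lborel A * M ?B\<close> by invariance of \<open>lborel\<close>, and
  \<open>M A * lborel ?B\<close> by invariance of \<open>M\<close>. The unit ball serves as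
  \<open>?B\<close> because its measure is finite, positive and computable in orthonormal
  coordinates.\<close>

lemma translation_invariant_eq_lborel:
  fixes M :: "'a::euclidean_space measure"
  assumes sets [measurable_cong]: "sets M = sets borel"
    and sf: "sigma_finite_measure M"
    and inv: "\<And>v. distr M borel ((+) v) = M"
    and ball: "emeasure M (cball 0 1) = emeasure lborel (cball (0::'a) 1)"
  shows "M = lborel"
proof (rule measure_eqI)
  show "sets M = sets lborel" using sets by simp
  fix A assume "A \<in> sets M"
  then have A [measurable]: "A \<in> sets borel" using sets by simp
  interpret M: sigma_finite_measure M by fact
  interpret P: pair_sigma_finite lborel M ..
  let ?B = "cball (0::'a) 1"
  have [measurable]: "?B \<in> sets borel" by simp
  let ?c = "emeasure lborel ?B"
  have 1: "(\<integral>\<^sup>+y. \<integral>\<^sup>+x. indicator A (x + y) * indicator ?B y \<partial>lborel \<partial>M) = emeasure lborel A * ?c"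
  proof -
    have "(\<integral>\<^sup>+x. indicator A (x + y) \<partial>lborel) = emeasure lborel A" for y
    proof -
      have "emeasure lborel A = (\<integral>\<^sup>+x. indicator A x \<partial>distr lborel borel ((+) y))"
        by (simp add: lborel_distr_plus)
      also have "\<dots> = (\<integral>\<^sup>+x. indicator A (x + y) \<partial>lborel)"
        by (subst nn_integral_distr) (auto simp: add.commute)
      finally show ?thesis ..
    qed
    then have "(\<integral>\<^sup>+x. indicator A (x + y) * indicator ?B y \<partial>lborel) = emeasure lborel A * indicator ?B y" for y
      by (subst nn_integral_multc) auto
    then show ?thesis
      by (simp add: nn_integral_cmult_indicator sets ball)
  qed
  have "(\<integral>\<^sup>+y. \<integral>\<^sup>+x. indicator A (x + y) * indicator ?B y \<partial>lborel \<partial>M)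
      = (\<integral>\<^sup>+x. \<integral>\<^sup>+y. indicator A (x + y) * indicator ?B y \<partial>M \<partial>lborel)"
    by (rule P.Fubini') measurable
  \<comment> \<open>Shift y by -x, using the invariance of \<open>M\<close>; now only the ball
    depends on x.\<close>
  also have "\<dots> = (\<integral>\<^sup>+x. \<integral>\<^sup>+y. indicator A y * indicator ?B (y - x) \<partial>M \<partial>lborel)"
  proof (rule nn_integral_cong)
    fix x
    have "(\<integral>\<^sup>+y. indicator A y * indicator ?B (y - x) \<partial>M)
        = (\<integral>\<^sup>+y. indicator A y * indicator ?B (y - x) \<partial>distr M borel ((+) x))"
      by (simp only: inv)
    also have "\<dots> = (\<integral>\<^sup>+y. indicator A (x + y) * indicator ?B y \<partial>M)"
      by (subst nn_integral_distr) auto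
    finally show "(\<integral>\<^sup>+y. indicator A (x + y) * indicator ?B y \<partial>M)
        = (\<integral>\<^sup>+y. indicator A y * indicator ?B (y - x) \<partial>M)" ..
  qed
  also have "\<dots> = (\<integral>\<^sup>+y. \<integral>\<^sup>+x. indicator A y * indicator ?B (y - x) \<partial>lborel \<partial>M)"
    by (rule P.Fubini'[symmetric]) measurable
  also have "\<dots> = (\<integral>\<^sup>+y. indicator A y * ?c \<partial>M)"
  proof (rule nn_integral_cong)
    fix y
    have "(\<integral>\<^sup>+x. indicator ?B (y - x) \<partial>lborel) = (\<integral>\<^sup>+x. indicator (cball y 1) x \<partial>lborel)"
      by (intro nn_integral_cong) (auto simp: indicator_def dist_norm norm_minus_commute)
    also have "\<dots> = ?c" by (simp add: emeasure_cball)
    finally show "(\<integral>\<^sup>+x. indicator A y * indicator ?B (y - x) \<partial>lborel) = indicator A y * ?c"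
      by (subst nn_integral_cmult) auto
  qed
  also have "\<dots> = emeasure M A * ?c"
    by (subst nn_integral_multc) (auto simp: sets)
  finally have "emeasure M A * ?c = emeasure lborel A * ?c" using 1 by simp
  moreover have "?c \<noteq> 0" "?c \<noteq> top"
    using less_imp_neq[OF unit_ball_vol_pos[of "real DIM('a)"]] by (simp_all add: emeasure_cball)
  ultimately show "emeasure M A = emeasure lborel A"
    by (metis ennreal_mult_cancel_left mult.commute)
qed

lemma PiM_lborel_translate:
  fixes w :: "'i \<Rightarrow> real"
  assumes "finite I"
  shows "distr (\<Pi>\<^sub>M i\<in>I. lborel) (\<Pi>\<^sub>M i\<in>I. lborel) (\<lambda>f. \<lambda>i\<in>I. w i + f i) = (\<Pi>\<^sub>M i\<in>I. lborel)"
proof -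
  let ?M = "\<Pi>\<^sub>M i\<in>I. lborel"
  let ?D = "distr ?M ?M (\<lambda>f. \<lambda>i\<in>I. w i + f i)"
  interpret product_sigma_finite "\<lambda>_::'i. lborel :: real measure" ..
  show ?thesis
  proof (rule PiM_eqI)
    fix A :: "'i \<Rightarrow> real set" assume A: "\<And>i. i \<in> I \<Longrightarrow> A i \<in> sets lborel"
    then have AA: "Pi\<^sub>E I A \<in> sets ?M"
      using assms by (intro sets_PiM_I_finite) auto
    have mA: "(+) (w i) -` A i \<in> sets lborel" if "i \<in> I" for i
      using measurable_sets_borel[of "(+) (w i)" borel "A i"] A[OF that] by simp
    have "(\<lambda>f. \<lambda>i\<in>I. w i + f i) -` (Pi\<^sub>E I A) \<inter> space ?M
        = (\<Pi>\<^sub>E i\<in>I. (+) (w i) -` A i)"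
      by (auto simp: space_PiM PiE_iff)
    then have "emeasure (?D) (Pi\<^sub>E I A)
        = emeasure ?M (\<Pi>\<^sub>E i\<in>I. (+) (w i) -` A i)"
      using AA by (subst emeasure_distr) auto
    also have "\<dots> = (\<Prod>i\<in>I. emeasure lborel ((+) (w i) -` A i))"
      using assms mA by (intro emeasure_PiM) auto
    also have "\<dots> = (\<Prod>i\<in>I. emeasure lborel (A i))"
    proof (intro prod.cong refl)
      fix i assume "i \<in> I"
      have "emeasure lborel (A i) = emeasure (distr lborel borel ((+) (w i))) (A i)"
        by (simp add: lborel_distr_plus)
      also have "\<dots> = emeasure lborel ((+) (w i) -` A i)"
        using A[OF \<open>i \<in> I\<close>] by (subst emeasure_distr) auto
      finally show "emeasure lborel ((+) (w i) -` A i) = emeasure lborel (A i)" ..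
    qed
    finally show "emeasure (?D) (Pi\<^sub>E I A)
        = (\<Prod>i\<in>I. emeasure lborel (A i))" .
  qed (use assms in simp_all)
qed

lemma norm_sum_orthonormal:
  fixes B :: "'a::euclidean_space set"
  assumes "finite B" "pairwise orthogonal B" "\<And>b. b \<in> B \<Longrightarrow> norm b = 1"
  shows "norm (\<Sum>b\<in>B. f b *\<^sub>R b) = sqrt (\<Sum>b\<in>B. (f b)\<^sup>2)"
proof -
  have "(norm (\<Sum>b\<in>B. f b *\<^sub>R b))\<^sup>2 = (\<Sum>b\<in>B. (norm (f b *\<^sub>R b))\<^sup>2)"
    by (rule norm_sum_Pythagorean) (use assms in \<open>auto simp: pairwise_def orthogonal_def\<close>)
  also have "\<dots> = (\<Sum>b\<in>B. (f b)\<^sup>2)"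
    by (intro sum.cong) (auto simp: assms)
  finally show ?thesis
    by (metis norm_ge_zero real_sqrt_unique)
qed

text \<open>Independence of the basis without determinants: a translation shifts each coordinate,
  and in orthonormal coordinates the unit ball is the Euclidean ball of the product space, so the
  uniqueness lemma applies.\<close>

lemma lborel_eq_orthonormal:
  fixes B :: "'a::euclidean_space set"
  assumes "orthonormal_basis_of UNIV B"
  shows "lborel = distr (\<Pi>\<^sub>M b\<in>B. lborel) borel (\<lambda>f. \<Sum>b\<in>B. f b *\<^sub>R b)" (is "_ = ?M")
proof -
  have orth: "pairwise orthogonal B" and n1: "\<And>b. b \<in> B \<Longrightarrow> norm b = 1" and sp: "span B = UNIV"
    using assms by (auto simp: orthonormal_basis_of_def)
  have ind: "independent B"
    using orth by (intro pairwise_orthogonal_independent) (auto dest!: n1)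
  then have fin: "finite B" by (rule independent_imp_finite)
  have card: "card B = DIM('a)"
    using ind sp by (metis dim_UNIV dim_span_eq_card_independent)
  interpret product_sigma_finite "\<lambda>_::'a. lborel :: real measure" ..
  let ?T = "\<lambda>f. \<Sum>b\<in>B. f b *\<^sub>R b"
  have T [measurable]: "?T \<in> borel_measurable (\<Pi>\<^sub>M b\<in>B. lborel)"
    by measurable
  have ball: "emeasure ?M (cball 0 r) = emeasure lborel (cball (0::'a) r)" if "r > 0" for r
  proof -
    have "?T -` cball 0 r \<inter> space (\<Pi>\<^sub>M b\<in>B. lborel)
       = {f. sqrt (\<Sum>i\<in>B. (f i)\<^sup>2) \<le> r} \<inter> space (\<Pi>\<^sub>M b\<in>B. lborel)"
      using norm_sum_orthonormal[OF fin orth n1] by auto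
    then show ?thesis
      using emeasure_cball_aux[OF fin that] that
      by (subst emeasure_distr) (auto simp: emeasure_cball card)
  qed
  have sf: "sigma_finite_measure ?M"
  proof
    show "\<exists>A. countable A \<and> A \<subseteq> sets ?M \<and> \<Union> A = space ?M \<and> (\<forall>a\<in>A. emeasure ?M a \<noteq> \<infinity>)"
    proof (intro exI conjI)
      let ?A = "range (\<lambda>n. cball (0::'a) (Suc n))"
      show "countable ?A" by simp
      show "?A \<subseteq> sets ?M" by auto
      have "\<exists>n. norm x \<le> Suc n" for x :: 'a
        using real_arch_simple[of "norm x"] by (metis of_nat_Suc add_increasing2 zero_le_one add.commute)
      then show "\<Union> ?A = space ?M" by auto
      show "\<forall>a\<in>?A. emeasure ?M a \<noteq> \<infinity>"
      proof
        fix a assume "a \<in> ?A"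
        then obtain n where "a = cball (0::'a) (Suc n)" by auto
        then show "emeasure ?M a \<noteq> \<infinity>"
          using ball[of "Suc n"] by (simp add: emeasure_cball)
      qed
    qed
  qed
  have inv: "distr ?M borel ((+) v) = ?M" for v
  proof -
    obtain w where w: "v = ?T w"
      using span_finite[OF fin] sp by (metis (no_types, lifting) UNIV_I rangeE)
    let ?s = "\<lambda>f. \<lambda>i\<in>B. w i + f i"
    have s [measurable]: "?s \<in> measurable (\<Pi>\<^sub>M b\<in>B. lborel) (\<Pi>\<^sub>M b\<in>B. lborel)" by measurable
    have "distr ?M borel ((+) v) = distr (\<Pi>\<^sub>M b\<in>B. lborel) borel (\<lambda>f. v + ?T f)"
      by (subst distr_distr) (auto simp: comp_def)
    also have "\<dots> = distr (\<Pi>\<^sub>M b\<in>B. lborel) borel (\<lambda>f. ?T (?s f))"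
      by (intro distr_cong) (auto simp: w scaleR_add_left sum.distrib)
    also have "\<dots> = distr (distr (\<Pi>\<^sub>M b\<in>B. lborel) (\<Pi>\<^sub>M b\<in>B. lborel) ?s) borel ?T"
      by (subst distr_distr[OF T s]) (simp add: comp_def)
    also have "\<dots> = ?M"
      by (simp only: PiM_lborel_translate[OF fin])
    finally show ?thesis .
  qed
  show ?thesis
    by (rule translation_invariant_eq_lborel[symmetric, OF _ sf inv]) (use ball[of 1] in auto)
qed

abbreviation hyperplane_lborel :: "'a::euclidean_space \<Rightarrow> 'a measure"
  where "hyperplane_lborel u \<equiv> subspace_lborel (orth_hyperplane u)"

lemma norm_one_inner: "norm u = 1 \<Longrightarrow> u \<bullet> u = 1"
  by (simp add: power2_norm_eq_inner[symmetric])

lemma subspace_orth_hyperplane [simp]: "subspace (orth_hyperplane u)"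
  by (auto simp: orth_hyperplane_def subspace_def inner_add_right)

text \<open>Adjoining \<open>u\<close> to the chosen basis of its hyperplane gives an orthonormal
  basis of the whole space, and Fubini splits off the coordinate along \<open>u\<close> in either
  order. Apart from its sigma-algebra, all that is used later about the hyperplane measure follows
  from these three facts, whichever basis was chosen.\<close>

lemma nn_integral_lborel_orth_hyperplane:
  fixes u :: "'a::euclidean_space"
  assumes u: "norm u = 1" and [measurable]: "g \<in> borel_measurable borel"
  shows "(\<integral>\<^sup>+x. g x \<partial>lborel) = (\<integral>\<^sup>+t. \<integral>\<^sup>+y. g (y + t *\<^sub>R u) \<partial>hyperplane_lborel u \<partial>lborel)"
      (is ?A)
    and "(\<integral>\<^sup>+x. g x \<partial>lborel) = (\<integral>\<^sup>+y. \<integral>\<^sup>+t. g (y + t *\<^sub>R u) \<partial>lborel \<partial>hyperplane_lborel u)"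
      (is ?B)
    and "AE y in hyperplane_lborel u. y \<in> orth_hyperplane u" (is ?C)
proof -
  define B where "B = (SOME B. orthonormal_basis_of (orth_hyperplane u) B)"
  have "\<exists>B. orthonormal_basis_of (orth_hyperplane u) B"
    using orthonormal_basis_subspace[OF subspace_orth_hyperplane[of u]]
    unfolding orthonormal_basis_of_def by metis
  then have "orthonormal_basis_of (orth_hyperplane u) B"
    unfolding B_def by (rule someI_ex)
  then have orth: "pairwise orthogonal B" and n1: "\<And>b. b \<in> B \<Longrightarrow> norm b = 1"
    and sp: "span B = orth_hyperplane u"
    by (auto simp: orthonormal_basis_of_def)
  have ub: "u \<bullet> b = 0" if "b \<in> B" for b
    using sp span_base[OF that] by (simp add: orth_hyperplane_def)
  have uB: "u \<notin> B" using ub[of u] u by auto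
  have fin: "finite B"
    using orth by (intro independent_imp_finite pairwise_orthogonal_independent) (auto dest!: n1)
  have basis: "orthonormal_basis_of UNIV (insert u B)"
    unfolding orthonormal_basis_of_def
  proof (intro conjI)
    show "pairwise orthogonal (insert u B)"
      using orth ub by (auto simp: pairwise_insert orthogonal_def inner_commute)
    have "x \<in> span (insert u B)" for x
    proof -
      have "x - (u \<bullet> x) *\<^sub>R u \<in> span B"
        by (simp add: sp orth_hyperplane_def inner_diff_right norm_one_inner[OF u])
      then show ?thesis using span_breakdown_eq by blast
    qed
    then show "span (insert u B) = UNIV" by blast
  qed (use n1 u in auto)
  have M: "hyperplane_lborel u = distr (\<Pi>\<^sub>M b\<in>B. lborel) borel (\<lambda>f. \<Sum>b\<in>B. f b *\<^sub>R b)"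
    unfolding subspace_lborel_def B_def by (simp add: Let_def)
  interpret product_sigma_finite "\<lambda>_::'a. lborel :: real measure" ..
  have upd: "(\<Sum>b\<in>insert u B. (f(u := t)) b *\<^sub>R b) = (\<Sum>b\<in>B. f b *\<^sub>R b) + t *\<^sub>R u" for f t
  proof -
    have "(\<Sum>b\<in>B. (f(u := t)) b *\<^sub>R b) = (\<Sum>b\<in>B. f b *\<^sub>R b)"
      using uB by (intro sum.cong) auto
    then show ?thesis using uB fin by simp
  qed
  have "(\<integral>\<^sup>+x. g x \<partial>lborel) = (\<integral>\<^sup>+f. g (\<Sum>b\<in>insert u B. f b *\<^sub>R b) \<partial>(\<Pi>\<^sub>M b\<in>insert u B. lborel))"
    by (subst lborel_eq_orthonormal[OF basis], subst nn_integral_distr) auto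
  note 1 = this
  have "(\<integral>\<^sup>+x. g x \<partial>lborel)
      = (\<integral>\<^sup>+t. \<integral>\<^sup>+f. g ((\<Sum>b\<in>B. f b *\<^sub>R b) + t *\<^sub>R u) \<partial>(\<Pi>\<^sub>M b\<in>B. lborel) \<partial>lborel)"
    unfolding 1 by (subst product_nn_integral_insert_rev[OF fin uB]) (auto simp only: upd, measurable)
  then show ?A
    unfolding M by (subst nn_integral_distr) auto
  have "(\<integral>\<^sup>+x. g x \<partial>lborel)
      = (\<integral>\<^sup>+f. \<integral>\<^sup>+t. g ((\<Sum>b\<in>B. f b *\<^sub>R b) + t *\<^sub>R u) \<partial>lborel \<partial>(\<Pi>\<^sub>M b\<in>B. lborel))"
    unfolding 1 by (subst product_nn_integral_insert[OF fin uB]) (auto simp only: upd, measurable)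
  then show ?B
    unfolding M by (subst nn_integral_distr) auto
  have "orth_hyperplane u \<in> sets borel"
    by (intro borel_closed closed_subspace) simp
  moreover have "(\<Sum>b\<in>B. f b *\<^sub>R b) \<in> orth_hyperplane u" for f
    unfolding sp[symmetric] by (intro span_sum span_scale span_base)
  ultimately show ?C
    unfolding M by (subst AE_distr_iff) simp_all
qed

lemma AE_subspace_lborel_mem:
  "norm u = 1 \<Longrightarrow> AE y in hyperplane_lborel u. y \<in> orth_hyperplane u"
  using nn_integral_lborel_orth_hyperplane(3)[of u "\<lambda>_. 0"] by simp

lemma sets_subspace_lborel [simp, measurable_cong]: "sets (subspace_lborel S) = sets borel"
  by (simp add: subspace_lborel_def Let_def)

lemma space_subspace_lborel [simp]: "space (subspace_lborel S) = UNIV"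
  by (simp add: subspace_lborel_def Let_def)

section \<open>Slices, cylinders and projections along a direction\<close>

definition slice :: "'a::euclidean_space \<Rightarrow> real \<Rightarrow> 'a set \<Rightarrow> 'a set"
  where "slice u t A = {y \<in> orth_hyperplane u. y + t *\<^sub>R u \<in> A}"

lemma closed_orth_hyperplane [simp]: "closed (orth_hyperplane u)"
  by (intro closed_subspace) simp

lemma borel_orth_hyperplane [measurable, simp]: "orth_hyperplane u \<in> sets borel"
  by (intro borel_closed) simp

lemma borel_slice [measurable]:
  assumes [measurable]: "A \<in> sets borel"
  shows "slice u t A \<in> sets borel"
proof -
  have "slice u t A = orth_hyperplane u \<inter> (\<lambda>y. y + t *\<^sub>R u) -` A" by (auto simp: slice_def)
  then show ?thesis
    using measurable_sets_borel[of "\<lambda>y. y + t *\<^sub>R u" borel A] by simp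
qed

lemma emeasure_lborel_slices:
  assumes u: "norm u = 1" and [measurable]: "A \<in> sets borel"
  shows "emeasure lborel A = (\<integral>\<^sup>+t. emeasure (hyperplane_lborel u) (slice u t A) \<partial>lborel)"
proof -
  have "emeasure lborel A = (\<integral>\<^sup>+x. indicator A x \<partial>lborel)" by simp
  also have "\<dots> = (\<integral>\<^sup>+t. \<integral>\<^sup>+y. indicator A (y + t *\<^sub>R u) \<partial>hyperplane_lborel u \<partial>lborel)"
    by (rule nn_integral_lborel_orth_hyperplane[OF u]) auto
  also have "\<dots> = (\<integral>\<^sup>+t. \<integral>\<^sup>+y. indicator (slice u t A) y \<partial>hyperplane_lborel u \<partial>lborel)"
  proof (rule nn_integral_cong, rule nn_integral_cong_AE)
    fix t
    show "AE y in hyperplane_lborel u. indicator A (y + t *\<^sub>R u) = (indicator (slice u t A) y :: ennreal)"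
      using AE_subspace_lborel_mem[OF u]
      by eventually_elim (auto simp: slice_def indicator_def)
  qed
  finally show ?thesis by simp
qed

text \<open>The bridge between the two measures: the volume of a cylinder is its height times the
  hyperplane measure of its base, so properties of volume pass to the hyperplane.\<close>

definition cylinder :: "'a::euclidean_space \<Rightarrow> real \<Rightarrow> 'a set \<Rightarrow> 'a set"
  where "cylinder u a S = (\<lambda>(y, t). y + t *\<^sub>R u) ` (S \<times> {0..a})"

lemma cylinder_conv:
  assumes "norm u = 1" "S \<subseteq> orth_hyperplane u"
  shows "cylinder u a S = {x. x - (u \<bullet> x) *\<^sub>R u \<in> S \<and> u \<bullet> x \<in> {0..a}}"
proof -
  note uu = norm_one_inner[OF assms(1)]
  have "x \<in> cylinder u a S" if "x - (u \<bullet> x) *\<^sub>R u \<in> S" "u \<bullet> x \<in> {0..a}" for x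
    using that unfolding cylinder_def by (intro image_eqI[of _ _ "(x - (u \<bullet> x) *\<^sub>R u, u \<bullet> x)"]) auto
  moreover have "u \<bullet> y = 0" if "y \<in> S" for y using that assms(2) by (auto simp: orth_hyperplane_def)
  ultimately show ?thesis
    using assms(2) by (auto simp: cylinder_def inner_add_right uu)
qed

lemma slice_cylinder:
  assumes "norm u = 1" "S \<subseteq> orth_hyperplane u"
  shows "slice u t (cylinder u a S) = (if t \<in> {0..a} then S else {})"
proof -
  note uu = norm_one_inner[OF assms(1)]
  have "y + t *\<^sub>R u \<in> cylinder u a S \<longleftrightarrow> y \<in> S \<and> t \<in> {0..a}" if "y \<in> orth_hyperplane u" for y
    using that unfolding cylinder_conv[OF assms] by (simp add: orth_hyperplane_def inner_add_right uu)
  then show ?thesis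
    using assms(2) unfolding slice_def by auto
qed

lemma borel_cylinder [measurable]:
  assumes "norm u = 1" "S \<subseteq> orth_hyperplane u" and [measurable]: "S \<in> sets borel"
  shows "cylinder u a S \<in> sets borel"
  unfolding cylinder_conv[OF assms(1,2)] by measurable

lemma emeasure_cylinder:
  assumes u: "norm u = 1" "S \<subseteq> orth_hyperplane u" and [measurable]: "S \<in> sets borel" and "a \<ge> 0"
  shows "emeasure lborel (cylinder u a S) = ennreal a * emeasure (hyperplane_lborel u) S"
proof -
  have "emeasure lborel (cylinder u a S)
      = (\<integral>\<^sup>+t. emeasure (hyperplane_lborel u) S * indicator {0..a} t \<partial>lborel)"
    unfolding emeasure_lborel_slices[OF u(1) borel_cylinder[OF u assms(3)]]
    by (intro nn_integral_cong) (simp add: slice_cylinder[OF u] indicator_def)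
  also have "\<dots> = ennreal a * emeasure (hyperplane_lborel u) S"
    using \<open>a \<ge> 0\<close> by (subst nn_integral_cmult_indicator) (auto simp: mult.commute)
  finally show ?thesis .
qed

lemma emeasure_subspace_lborel_bounded:
  assumes u: "norm u = 1" "S \<subseteq> orth_hyperplane u" and "S \<in> sets borel" "bounded S"
  shows "emeasure (hyperplane_lborel u) S < \<infinity>"
proof -
  have "bounded (cylinder u 1 S)"
  proof -
    obtain B where "\<And>x. x \<in> S \<Longrightarrow> norm x \<le> B" using \<open>bounded S\<close> by (auto simp: bounded_iff)
    then have "norm x \<le> B + 1" if "x \<in> cylinder u 1 S" for x
      using that u(1) by (auto simp: cylinder_def intro!: norm_triangle_mono)
    then show ?thesis by (auto simp: bounded_iff)
  qed
  then have "emeasure lborel (cylinder u 1 S) < \<infinity>" by (rule emeasure_bounded_finite)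
  then show ?thesis using emeasure_cylinder[OF u assms(3), of 1] by simp
qed

lemma measure_cylinder:
  assumes u: "norm u = 1" "S \<subseteq> orth_hyperplane u" and "S \<in> sets borel" "a \<ge> 0"
  shows "volume (cylinder u a S) = a * measure (hyperplane_lborel u) S"
  using emeasure_cylinder[OF u assms(3,4)] \<open>a \<ge> 0\<close> by (simp add: measure_def enn2real_mult)

lemma hyperplane_projection_subset:
  assumes "norm u = 1"
  shows "hyperplane_projection u K \<subseteq> orth_hyperplane u"
  by (auto simp: hyperplane_projection_def orth_hyperplane_def inner_diff_right norm_one_inner[OF assms])

lemma mem_hyperplane_projection_iff:
  assumes "norm u = 1"
  shows "y \<in> hyperplane_projection u K \<longleftrightarrow> y \<in> orth_hyperplane u \<and> (\<exists>t. y + t *\<^sub>R u \<in> K)"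
proof
  assume "y \<in> hyperplane_projection u K"
  then show "y \<in> orth_hyperplane u \<and> (\<exists>t. y + t *\<^sub>R u \<in> K)"
    using hyperplane_projection_subset[OF assms, of K]
    by (auto simp: hyperplane_projection_def) (metis diff_add_cancel)
next
  assume "y \<in> orth_hyperplane u \<and> (\<exists>t. y + t *\<^sub>R u \<in> K)"
  then obtain t where t: "u \<bullet> y = 0" "y + t *\<^sub>R u \<in> K" by (auto simp: orth_hyperplane_def)
  then have "y = (y + t *\<^sub>R u) - (u \<bullet> (y + t *\<^sub>R u)) *\<^sub>R u"
    by (simp add: inner_add_right norm_one_inner[OF assms])
  then show "y \<in> hyperplane_projection u K"
    unfolding hyperplane_projection_def using t(2) by blast
qed

lemma hyperplane_projection_linear: "linear (\<lambda>x. x - (u \<bullet> x) *\<^sub>R u)"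
  by (auto intro!: linearI simp: algebra_simps inner_add_right)

lemma compact_hyperplane_projection: "compact K \<Longrightarrow> compact (hyperplane_projection u K)"
  unfolding hyperplane_projection_def by (intro compact_continuous_image continuous_intros)

lemma convex_hyperplane_projection: "convex K \<Longrightarrow> convex (hyperplane_projection u K)"
  unfolding hyperplane_projection_def by (intro convex_linear_image hyperplane_projection_linear)

lemma linear_image_plus:
  assumes "linear f"
  shows "f ` (A + B) = f ` A + f ` B"
proof (intro subset_antisym subsetI)
  show "z \<in> f ` A + f ` B" if "z \<in> f ` (A + B)" for z
    using that by (auto simp: linear_add[OF assms] elim!: set_plus_elim intro!: set_plus_intro)
  show "z \<in> f ` (A + B)" if "z \<in> f ` A + f ` B" for z
    using that by (auto simp: linear_add[OF assms, symmetric] elim!: set_plus_elim intro!: imageI set_plus_intro)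
qed

lemma hyperplane_projection_plus:
  "hyperplane_projection u (K + L) = hyperplane_projection u K + hyperplane_projection u L"
  unfolding hyperplane_projection_def by (rule linear_image_plus[OF hyperplane_projection_linear])

lemma compact_plus:
  fixes K L :: "'a::real_normed_vector set"
  shows "compact K \<Longrightarrow> compact L \<Longrightarrow> compact (K + L)"
  unfolding set_plus_image
  by (intro compact_continuous_image compact_Times) (auto simp: case_prod_unfold intro!: continuous_intros)

text \<open>A line parallel to \<open>u\<close> meets a compact convex set in a closed interval.
  Adding the segment lengthens every nonempty such interval by \<open>e\<close> and leaves empty
  ones empty; integrate over the hyperplane.\<close>

lemma emeasure_plus_segment:
  assumes u: "norm u = 1" and K: "compact K" "convex K" and e: "e \<ge> 0"
  shows "emeasure lborel (K + closed_segment 0 (e *\<^sub>R u))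
    = emeasure lborel K + ennreal e * emeasure (hyperplane_lborel u) (hyperplane_projection u K)"
proof -
  let ?m = "hyperplane_lborel u" and ?P = "hyperplane_projection u K"
  let ?S = "closed_segment 0 (e *\<^sub>R u)"
  have seg: "x \<in> ?S \<longleftrightarrow> (\<exists>s\<in>{0..e}. x = s *\<^sub>R u)" for x
  proof (cases "e = 0")
    case False
    then have "e > 0" using e by simp
    show ?thesis
    proof
      assume "x \<in> ?S"
      then show "\<exists>s\<in>{0..e}. x = s *\<^sub>R u"
        using \<open>e > 0\<close> by (auto simp: in_segment intro!: mult_left_le_one_le)
    next
      assume "\<exists>s\<in>{0..e}. x = s *\<^sub>R u"
      then obtain s where "0 \<le> s" "s \<le> e" "x = s *\<^sub>R u" by auto
      then show "x \<in> ?S"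
        using \<open>e > 0\<close> by (auto simp: in_segment intro!: exI[of _ "s / e"])
    qed
  qed auto
  have [measurable]: "K \<in> sets borel" "K + ?S \<in> sets borel" "?P \<in> sets borel"
    by (intro borel_compact compact_plus compact_segment compact_hyperplane_projection K)+
  have line: "emeasure lborel {t. y + t *\<^sub>R u \<in> K + ?S}
      = emeasure lborel {t. y + t *\<^sub>R u \<in> K} + ennreal e * indicator ?P y"
    if y: "y \<in> orth_hyperplane u" for y
  proof (cases "y \<in> ?P")
    case True
    let ?T = "{t. y + t *\<^sub>R u \<in> K}"
    have T: "?T = (\<lambda>x. u \<bullet> x) ` (K \<inter> {x. x - (u \<bullet> x) *\<^sub>R u = y})"
    proof (intro set_eqI iffI)
      fix t assume "t \<in> ?T"
      moreover have "u \<bullet> (y + t *\<^sub>R u) = t"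
        using y by (simp add: orth_hyperplane_def inner_add_right norm_one_inner[OF u])
      ultimately show "t \<in> (\<lambda>x. u \<bullet> x) ` (K \<inter> {x. x - (u \<bullet> x) *\<^sub>R u = y})"
        by (intro image_eqI[of _ _ "y + t *\<^sub>R u"]) auto
    qed auto
    have fib: "{x. x - (u \<bullet> x) *\<^sub>R u = y} = (\<lambda>x. x - (u \<bullet> x) *\<^sub>R u) -` {y}" by auto
    have "compact ?T" unfolding T fib
      using K(1) by (intro compact_continuous_image compact_Int_closed closed_vimage continuous_intros) auto
    moreover have "convex ?T" unfolding T fib
      using K(2) bounded_linear.linear[OF bounded_linear_inner_right]
      by (intro convex_linear_image convex_Int convex_linear_vimage[OF hyperplane_projection_linear]) auto
    ultimately obtain \<alpha> \<beta> where ab: "?T = {\<alpha>..\<beta>}"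
      using connected_compact_interval_1[of ?T] by (metis convex_connected)
    have "?T \<noteq> {}" using True mem_hyperplane_projection_iff[OF u] by auto
    then have le: "\<alpha> \<le> \<beta>" using ab by auto
    have "{t. y + t *\<^sub>R u \<in> K + ?S} = {\<alpha>..\<beta> + e}"
    proof -
      have 1: "y + t *\<^sub>R u \<in> K + ?S \<longleftrightarrow> (\<exists>s\<in>{0..e}. t - s \<in> ?T)" for t
      proof -
        have "y + t *\<^sub>R u \<in> K + ?S \<longleftrightarrow> (\<exists>s\<in>{0..e}. y + t *\<^sub>R u - s *\<^sub>R u \<in> K)"
        proof
          assume "y + t *\<^sub>R u \<in> K + ?S"
          then obtain k s where ks: "y + t *\<^sub>R u = k + s *\<^sub>R u" "k \<in> K" "s \<in> {0..e}"
            using seg by (auto simp: set_plus_def)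
          then have "y + t *\<^sub>R u - s *\<^sub>R u = k" by (simp add: algebra_simps)
          then show "\<exists>s\<in>{0..e}. y + t *\<^sub>R u - s *\<^sub>R u \<in> K" using ks(2,3) by blast
        next
          assume "\<exists>s\<in>{0..e}. y + t *\<^sub>R u - s *\<^sub>R u \<in> K"
          then obtain s where "s \<in> {0..e}" "y + t *\<^sub>R u - s *\<^sub>R u \<in> K" by auto
          then show "y + t *\<^sub>R u \<in> K + ?S"
            unfolding set_plus_def using seg[of "s *\<^sub>R u"]
            by (intro CollectI bexI[of _ "y + t *\<^sub>R u - s *\<^sub>R u"] bexI[of _ "s *\<^sub>R u"]) auto
        qed
        then show ?thesis by (simp add: algebra_simps)
      qed
      \<comment> \<open>The admissible shifts form the interval from \<open>t - \<beta>\<close> to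
        \<open>t - \<alpha>\<close>; the witness is the least nonnegative one.\<close>
      have 2: "(\<exists>s\<in>{0..e}. t - s \<in> {\<alpha>..\<beta>}) \<longleftrightarrow> t \<in> {\<alpha>..\<beta> + e}" for t
        using le e by (auto intro!: bexI[of _ "max 0 (t - \<beta>)"])
      show ?thesis using 1 2 unfolding ab by blast
    qed
    then show ?thesis
      using True le e unfolding ab by (simp add: ennreal_plus[symmetric] del: ennreal_plus)
  next
    case False
    then have "y + t *\<^sub>R u \<notin> K" for t using y mem_hyperplane_projection_iff[OF u] by auto
    moreover from this have "y + t *\<^sub>R u \<notin> K + ?S" for t
    proof -
      have "k = y + (t - s) *\<^sub>R u" if "y + t *\<^sub>R u = k + s *\<^sub>R u" for k s
        using that by (simp add: algebra_simps)
      then show ?thesis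
        using seg \<open>\<And>t. y + t *\<^sub>R u \<notin> K\<close> by (auto simp: set_plus_def) blast
    qed
    ultimately show ?thesis using False by simp
  qed
  have em: "emeasure lborel A = (\<integral>\<^sup>+y. emeasure lborel {t. y + t *\<^sub>R u \<in> A} \<partial>?m)"
    if [measurable]: "A \<in> sets borel" for A
  proof -
    have "emeasure lborel A = (\<integral>\<^sup>+x. indicator A x \<partial>lborel)" by simp
    also have "\<dots> = (\<integral>\<^sup>+y. \<integral>\<^sup>+t. indicator A (y + t *\<^sub>R u) \<partial>lborel \<partial>?m)"
      by (rule nn_integral_lborel_orth_hyperplane[OF u]) auto
    also have "\<dots> = (\<integral>\<^sup>+y. \<integral>\<^sup>+t. indicator {t. y + t *\<^sub>R u \<in> A} t \<partial>lborel \<partial>?m)"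
      by (simp add: indicator_def)
    also have "\<dots> = (\<integral>\<^sup>+y. emeasure lborel {t. y + t *\<^sub>R u \<in> A} \<partial>?m)"
      by (intro nn_integral_cong nn_integral_indicator) measurable
    finally show ?thesis .
  qed
  have [measurable]: "(\<lambda>y. emeasure lborel {t. y + t *\<^sub>R u \<in> K}) \<in> borel_measurable borel"
  proof -
    have "(\<lambda>y. \<integral>\<^sup>+t. indicator K (y + t *\<^sub>R u) \<partial>lborel) \<in> borel_measurable borel" by measurable
    moreover have "(\<integral>\<^sup>+t. indicator K (y + t *\<^sub>R u) \<partial>lborel) = emeasure lborel {t. y + t *\<^sub>R u \<in> K}" for y
    proof -
      have "(\<integral>\<^sup>+t. indicator K (y + t *\<^sub>R u) \<partial>lborel) = (\<integral>\<^sup>+t. indicator {t. y + t *\<^sub>R u \<in> K} t \<partial>lborel)"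
        by (simp add: indicator_def)
      also have "\<dots> = emeasure lborel {t. y + t *\<^sub>R u \<in> K}" by (rule nn_integral_indicator) measurable
      finally show ?thesis .
    qed
    ultimately show ?thesis by simp
  qed
  have "emeasure lborel (K + ?S)
      = (\<integral>\<^sup>+y. emeasure lborel {t. y + t *\<^sub>R u \<in> K} + ennreal e * indicator ?P y \<partial>?m)"
    unfolding em[OF \<open>K + ?S \<in> sets borel\<close>]
    by (intro nn_integral_cong_AE)
       (use AE_subspace_lborel_mem[OF u] line in \<open>auto elim: eventually_mono\<close>)
  also have "\<dots> = emeasure lborel K + ennreal e * emeasure ?m ?P"
    unfolding em[OF \<open>K \<in> sets borel\<close>]
    by (subst nn_integral_add) (auto simp: nn_integral_cmult_indicator)
  finally show ?thesis .
qed

lemma measure_plus_segment: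
  assumes u: "norm u = 1" and K: "compact K" "convex K" and e: "e \<ge> 0"
  shows "volume (K + closed_segment 0 (e *\<^sub>R u))
    = volume K + e * measure (hyperplane_lborel u) (hyperplane_projection u K)"
proof -
  have fin: "emeasure lborel K \<noteq> \<infinity>"
    "emeasure (hyperplane_lborel u) (hyperplane_projection u K) \<noteq> \<infinity>"
    using emeasure_bounded_finite[of K] compact_imp_bounded K(1)
      emeasure_subspace_lborel_bounded[OF u hyperplane_projection_subset[OF u]
        borel_compact[OF compact_hyperplane_projection[OF K(1)]]] compact_hyperplane_projection[OF K(1)]
    by fastforce+
  then show ?thesis
    using emeasure_plus_segment[OF assms] e
    by (simp add: measure_def enn2real_plus enn2real_mult ennreal_mult_less_top top.not_eq_extremum)
qed

section \<open>The Brunn--Minkowski inequality\<close>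

lemma fmeasurable_lborel_bounded:
  fixes S :: "'a::euclidean_space set"
  shows "S \<in> sets borel \<Longrightarrow> bounded S \<Longrightarrow> S \<in> fmeasurable lborel"
  using emeasure_bounded_finite[of S] by (simp add: fmeasurable_def)

lemma volume_mono:
  fixes S T :: "'a::euclidean_space set"
  shows "S \<subseteq> T \<Longrightarrow> S \<in> sets borel \<Longrightarrow> T \<in> sets borel \<Longrightarrow> bounded T \<Longrightarrow> volume S \<le> volume T"
  by (intro measure_mono_fmeasurable fmeasurable_lborel_bounded) auto

lemma open_set_plus:
  fixes S T :: "'a::real_normed_vector set"
  assumes "open S" shows "open (S + T)"
proof -
  have "S + T = (\<Union>x\<in>S. \<Union>y\<in>T. {x + y})" by (auto simp: set_plus_def)
  then show ?thesis using open_sums[of S T] assms by simp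
qed

lemma bounded_set_plus:
  fixes S T :: "'a::real_normed_vector set"
  assumes "bounded S" "bounded T" shows "bounded (S + T)"
  using bounded_plus[OF assms] by (simp add: set_plus_image)

abbreviation cut_volume :: "'a::euclidean_space \<Rightarrow> 'a set \<Rightarrow> real \<Rightarrow> real"
  where "cut_volume u A t \<equiv> volume (A \<inter> {x. u \<bullet> x \<le> t})"

lemma null_sets_hyperplane:
  fixes A :: "'a::euclidean_space set"
  assumes u: "norm u = 1" and A: "A \<in> sets borel"
  shows "A \<inter> {x. u \<bullet> x = t} \<in> null_sets lborel"
proof -
  have "u \<noteq> 0" using u by auto
  then have "negligible (A \<inter> {x. u \<bullet> x = t})"
    by (simp add: negligible_hyperplane negligible_Int)
  moreover have "A \<inter> {x. u \<bullet> x = t} \<in> sets borel" using A by measurable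
  ultimately show ?thesis
    by (simp add: negligible_iff_null_sets null_sets_completion_iff)
qed

lemma measure_halfspace_less:
  fixes A :: "'a::euclidean_space set"
  assumes u: "norm u = 1" and A: "A \<in> sets borel" "bounded A"
  shows "volume (A \<inter> {x. u \<bullet> x < t}) = cut_volume u A t"
proof -
  have "A \<inter> {x. u \<bullet> x \<le> t} = (A \<inter> {x. u \<bullet> x < t}) \<union> (A \<inter> {x. u \<bullet> x = t})" by auto
  moreover have "A \<inter> {x. u \<bullet> x < t} \<in> sets lborel" using A(1) by measurable
  ultimately show ?thesis
    using null_sets_hyperplane[OF u A(1), of t] by (simp add: measure_Un_null_set)
qed

lemma measure_halfspace_split:
  fixes A :: "'a::euclidean_space set"
  assumes u: "norm u = 1" and A: "A \<in> sets borel" "bounded A"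
  shows "volume A = cut_volume u A t + volume (A \<inter> {x. u \<bullet> x > t})"
proof -
  let ?l = "A \<inter> {x. u \<bullet> x \<le> t}" and ?g = "A \<inter> {x. u \<bullet> x > t}"
  have "?l \<in> fmeasurable lborel" "?g \<in> fmeasurable lborel"
    using A(1) by (auto intro!: fmeasurable_lborel_bounded bounded_subset[OF A(2)])
  then have "volume (?l \<union> ?g) = volume ?l + volume ?g"
    by (intro measure_Union) (auto simp: fmeasurable_def)
  moreover have "?l \<union> ?g = A" by auto
  ultimately show ?thesis by simp
qed

text \<open>The two closed half-spaces overlap only in a null hyperplane. \<open>Y\<close> and
  \<open>Z\<close> will be Minkowski sums of matching pieces on the two sides of a cut, and
  \<open>X\<close> the sum of the uncut sets.\<close>

lemma measure_halfspace_superadditive: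
  fixes X :: "'a::euclidean_space set"
  assumes u: "norm u = 1" and X: "X \<in> sets borel" "bounded X"
    and "Y \<in> sets borel" "Y \<subseteq> X \<inter> {x. u \<bullet> x \<le> t}" and "Z \<in> sets borel" "Z \<subseteq> X \<inter> {x. u \<bullet> x \<ge> t}"
  shows "volume Y + volume Z \<le> volume X"
proof -
  have b: "X \<inter> {x. u \<bullet> x \<le> t} \<in> sets borel" "X \<inter> {x. u \<bullet> x \<ge> t} \<in> sets borel" "X \<inter> {x. u \<bullet> x > t} \<in> sets borel"
    using X(1) by measurable
  have f: "X \<inter> {x. u \<bullet> x \<le> t} \<in> fmeasurable lborel" "X \<inter> {x. u \<bullet> x \<ge> t} \<in> fmeasurable lborel"
    using b bounded_subset[OF X(2)] by (auto intro!: fmeasurable_lborel_bounded)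
  have "X \<inter> {x. u \<bullet> x \<ge> t} = (X \<inter> {x. u \<bullet> x > t}) \<union> (X \<inter> {x. u \<bullet> x = t})" by auto
  then have "volume (X \<inter> {x. u \<bullet> x \<ge> t}) = volume (X \<inter> {x. u \<bullet> x > t})"
    using null_sets_hyperplane[OF u X(1), of t] b by (simp add: measure_Un_null_set)
  moreover have "volume Y \<le> cut_volume u X t"
    using assms f by (intro measure_mono_fmeasurable) auto
  moreover have "volume Z \<le> volume (X \<inter> {x. u \<bullet> x \<ge> t})"
    using assms f by (intro measure_mono_fmeasurable) auto
  ultimately show ?thesis
    using measure_halfspace_split[OF u X, of t] by simp
qed

text \<open>Dominated convergence: off the null hyperplane at height t the indicators are eventually
  constant. This supplies the intermediate value argument that finds matching cuts.\<close>

lemma continuous_measure_halfspace: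
  fixes A :: "'a::euclidean_space set"
  assumes u: "norm u = 1" and A: "A \<in> sets borel" "bounded A"
  shows "continuous_on S (cut_volume u A)"
proof (rule continuous_on_sequentiallyI)
  fix s :: "nat \<Rightarrow> real" and t assume "s \<longlonglongrightarrow> t"
  have [measurable]: "A \<in> sets borel" by fact
  have "(\<lambda>n. LINT x|lborel. indicator (A \<inter> {x. u \<bullet> x \<le> s n}) x :: real)
      \<longlonglongrightarrow> (LINT x|lborel. indicator (A \<inter> {x. u \<bullet> x \<le> t}) x)"
  proof (rule integral_dominated_convergence[where w = "indicator A"])
    show "integrable lborel (indicator A :: 'a \<Rightarrow> real)"
      using fmeasurable_lborel_bounded[OF A] by (simp add: fmeasurable_def)
    have "AE x in lborel. x \<notin> UNIV \<inter> {x. u \<bullet> x = t}"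
      by (intro AE_not_in null_sets_hyperplane u) simp
    then show "AE x in lborel. (\<lambda>n. indicator (A \<inter> {x. u \<bullet> x \<le> s n}) x :: real)
        \<longlonglongrightarrow> indicator (A \<inter> {x. u \<bullet> x \<le> t}) x"
    proof eventually_elim
      case (elim x)
      then consider "u \<bullet> x < t" | "t < u \<bullet> x" by fastforce
      then have "\<forall>\<^sub>F n in sequentially. u \<bullet> x \<le> s n \<longleftrightarrow> u \<bullet> x \<le> t"
      proof cases
        case 1
        then show ?thesis using order_tendstoD(1)[OF \<open>s \<longlonglongrightarrow> t\<close> 1] by (auto elim: eventually_mono)
      next
        case 2
        then show ?thesis using order_tendstoD(2)[OF \<open>s \<longlonglongrightarrow> t\<close> 2] by (auto elim: eventually_mono)
      qed
      then show ?case by (intro tendsto_eventually) (auto simp: indicator_def elim: eventually_mono)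
    qed
  qed (auto simp: indicator_def)
  then show "(\<lambda>n. cut_volume u A (s n)) \<longlonglongrightarrow> cut_volume u A t" by simp
qed

lemma obtain_halfspace_fraction:
  fixes A :: "'a::euclidean_space set"
  assumes u: "norm u = 1" and A: "A \<in> sets borel" "bounded A" and r: "0 \<le> r" "r \<le> volume A"
  obtains t where "cut_volume u A t = r"
proof -
  obtain R where R: "R > 0" "A \<subseteq> ball 0 R" using A(2) bounded_subset_ballD by blast
  have in_R: "\<bar>u \<bullet> x\<bar> < R" if "x \<in> A" for x
    using that R Cauchy_Schwarz_ineq2[of u x] u by auto
  have "A \<inter> {x. u \<bullet> x \<le> R} = A" using in_R by fastforce
  moreover have "A \<inter> {x. u \<bullet> x \<le> -R} = {}" using in_R by fastforce
  ultimately have "\<exists>t\<ge>-R. t \<le> R \<and> cut_volume u A t = r"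
    using R r by (intro IVT' continuous_measure_halfspace[OF u A]) auto
  then show thesis using that by blast
qed

section \<open>Brunn--Minkowski for finite unions of boxes\<close>

definition disjoint_boxes :: "'a::euclidean_space set set \<Rightarrow> bool"
  where "disjoint_boxes \<A> \<longleftrightarrow> finite \<A> \<and> disjoint \<A> \<and> (\<forall>C\<in>\<A>. C \<noteq> {} \<and> (\<exists>a b. C = box a b))"

lemma disjoint_boxes_open: "disjoint_boxes \<A> \<Longrightarrow> open (\<Union>\<A>)"
  unfolding disjoint_boxes_def by (metis open_Union open_box)

lemma disjoint_boxes_bounded: "disjoint_boxes \<A> \<Longrightarrow> bounded (\<Union>\<A>)"
  unfolding disjoint_boxes_def by (metis bounded_Union bounded_box)

text \<open>Each box leaves at most one box on a given side, so the count cannot grow, and a box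
  lying on the other side makes it drop. Empty pieces are discarded to keep the count honest as an
  induction measure.\<close>

lemma disjoint_boxes_cut:
  fixes \<A> :: "'a::euclidean_space set set"
  assumes \<A>: "disjoint_boxes \<A>" and H: "\<And>a b. \<exists>c d. box a b \<inter> H = box c d"
  defines "\<B> \<equiv> (\<lambda>C. C \<inter> H) ` \<A> - {{}}"
  shows "disjoint_boxes \<B>" "\<Union>\<B> = \<Union>\<A> \<inter> H" "card \<B> \<le> card \<A>"
    "\<And>C. C \<in> \<A> \<Longrightarrow> C \<inter> H = {} \<Longrightarrow> card \<B> < card \<A>"
proof -
  have fin: "finite \<A>" using \<A> by (simp add: disjoint_boxes_def)
  show "\<Union>\<B> = \<Union>\<A> \<inter> H" unfolding \<B>_def by auto
  have "card \<B> \<le> card ((\<lambda>C. C \<inter> H) ` \<A>)" unfolding \<B>_def using fin by (intro card_mono) auto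
  then show "card \<B> \<le> card \<A>" using card_image_le[OF fin, of "\<lambda>C. C \<inter> H"] by simp
  show "card \<B> < card \<A>" if "C \<in> \<A>" "C \<inter> H = {}" for C
  proof -
    have "\<B> \<subseteq> (\<lambda>C. C \<inter> H) ` (\<A> - {C})" unfolding \<B>_def using that by auto
    then have "card \<B> \<le> card (\<A> - {C})"
      using fin by (meson card_image_le card_mono finite_Diff finite_imageI le_trans)
    also have "\<dots> < card \<A>" using that fin by (metis card_Diff1_less)
    finally show ?thesis .
  qed
  have "disjoint \<B>"
    using \<A> unfolding disjoint_boxes_def \<B>_def pairwise_def disjnt_def by blast
  moreover have "\<exists>a b. C = box a b" if "C \<in> \<B>" for C
    using that \<A> H unfolding disjoint_boxes_def \<B>_def by fastforce
  ultimately show "disjoint_boxes \<B>"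
    using fin unfolding disjoint_boxes_def by (auto simp: \<B>_def)
qed

lemma box_Int_halfspaces:
  fixes i :: "'a::euclidean_space"
  assumes i: "i \<in> Basis"
  shows "\<exists>c d. box a b \<inter> {x. i \<bullet> x < t} = box c d" "\<exists>c d. box a b \<inter> {x. i \<bullet> x > t} = box c d"
proof -
  have "box a b \<inter> {x. i \<bullet> x < t} = box a (\<Sum>k\<in>Basis. (if k = i then min (b \<bullet> i) t else b \<bullet> k) *\<^sub>R k)"
    using i by (auto simp: mem_box inner_commute[of i] split: if_splits)
  then show "\<exists>c d. box a b \<inter> {x. i \<bullet> x < t} = box c d" by blast
  have "box a b \<inter> {x. i \<bullet> x > t} = box (\<Sum>k\<in>Basis. (if k = i then max (a \<bullet> i) t else a \<bullet> k) *\<^sub>R k) b"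
    using i by (auto simp: mem_box inner_commute[of i] split: if_splits)
  then show "\<exists>c d. box a b \<inter> {x. i \<bullet> x > t} = box c d" by blast
qed

lemma powr_inverse_power:
  fixes x :: real
  assumes "x \<ge> 0" "n > 0"
  shows "(x powr (1 / real n)) ^ n = x"
proof (cases "x = 0")
  case False
  then have "(x powr (1 / real n)) ^ n = (x powr (1 / real n)) powr real n"
    using assms by (subst powr_realpow) auto
  then show ?thesis using assms False by (simp add: powr_powr)
qed (use assms in simp)

lemma powr_sum_scale:
  fixes x y l :: real
  assumes "l \<ge> 0" "x \<ge> 0" "y \<ge> 0" "n > 0"
  shows "((l * x) powr (1 / real n) + (l * y) powr (1 / real n)) ^ n
    = l * (x powr (1 / real n) + y powr (1 / real n)) ^ n"
proof -
  have "(l * x) powr (1 / real n) + (l * y) powr (1 / real n)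
      = l powr (1 / real n) * (x powr (1 / real n) + y powr (1 / real n))"
    using assms by (simp add: powr_mult algebra_simps)
  then show ?thesis using assms by (simp add: power_mult_distrib powr_inverse_power)
qed

text \<open>The Brunn--Minkowski inequality for side lengths of boxes. The arithmetic-geometric mean
  inequality is applied to the ratios x/(x + y) and to the ratios y/(x + y), whose arithmetic means
  add up to 1.\<close>

lemma powr_prod_add_le:
  fixes x y :: "'i \<Rightarrow> real"
  assumes I: "finite I" "I \<noteq> {}" and pos: "\<And>i. i \<in> I \<Longrightarrow> x i > 0" "\<And>i. i \<in> I \<Longrightarrow> y i > 0"
  shows "((\<Prod>i\<in>I. x i) powr (1 / card I) + (\<Prod>i\<in>I. y i) powr (1 / card I)) ^ card I \<le> (\<Prod>i\<in>I. x i + y i)"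
proof -
  let ?p = "1 / real (card I)"
  have card: "card I > 0" using I by (simp add: card_gt_0_iff)
  have s: "x i + y i > 0" if "i \<in> I" for i using pos that by (simp add: add_pos_pos)
  have nn: "0 \<le> x i / (x i + y i)" "0 \<le> y i / (x i + y i)" if "i \<in> I" for i
    using pos[OF that] s[OF that] by simp_all
  have P: "(\<Prod>i\<in>I. x i + y i) > 0" using s by (intro prod_pos) auto
  have "(\<Prod>i\<in>I. x i / (x i + y i)) powr ?p + (\<Prod>i\<in>I. y i / (x i + y i)) powr ?p
     \<le> (\<Sum>i\<in>I. x i / (x i + y i) / card I) + (\<Sum>i\<in>I. y i / (x i + y i) / card I)"
    by (intro add_mono arith_geom_mean I) (simp_all add: nn)
  also have "\<dots> = (\<Sum>i\<in>I. 1 / card I)"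
    unfolding sum.distrib[symmetric]
  proof (rule sum.cong)
    fix i assume "i \<in> I"
    have "x i / (x i + y i) / card I + y i / (x i + y i) / card I = (x i + y i) / (x i + y i) / card I"
      by (simp only: add_divide_distrib)
    then show "x i / (x i + y i) / card I + y i / (x i + y i) / card I = 1 / card I"
      using s[OF \<open>i \<in> I\<close>] by simp
  qed simp
  also have "\<dots> = 1" using card by simp
  finally have "(\<Prod>i\<in>I. x i) powr ?p / (\<Prod>i\<in>I. x i + y i) powr ?p + (\<Prod>i\<in>I. y i) powr ?p / (\<Prod>i\<in>I. x i + y i) powr ?p \<le> 1"
    using P pos by (simp add: prod_dividef powr_divide prod_nonneg less_imp_le)
  then have "(\<Prod>i\<in>I. x i) powr ?p + (\<Prod>i\<in>I. y i) powr ?p \<le> (\<Prod>i\<in>I. x i + y i) powr ?p"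
    using P by (simp add: add_divide_distrib[symmetric] pos_divide_le_eq)
  then have "((\<Prod>i\<in>I. x i) powr ?p + (\<Prod>i\<in>I. y i) powr ?p) ^ card I \<le> ((\<Prod>i\<in>I. x i + y i) powr ?p) ^ card I"
    by (intro power_mono) auto
  then show ?thesis using P card by (simp add: powr_inverse_power)
qed

text \<open>Stated after raising to the n-th power: pieces holding the fractions l and 1 - l of both
  volumes then contribute exactly l and 1 - l times the left-hand side, so the two halves of a cut
  simply add.\<close>

definition brunn_minkowski_pair :: "'a::euclidean_space set \<Rightarrow> 'a set \<Rightarrow> bool"
  where "brunn_minkowski_pair A B \<longleftrightarrow>
    (volume A powr (1 / DIM('a)) + volume B powr (1 / DIM('a))) ^ DIM('a) \<le> volume (A + B)"

lemma brunn_minkowski_pair_commute: "brunn_minkowski_pair A B \<longleftrightarrow> brunn_minkowski_pair B A"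
  by (simp add: brunn_minkowski_pair_def add.commute)

lemma brunn_minkowski_box:
  fixes a b c d :: "'a::euclidean_space"
  assumes "box a b \<noteq> {}" "box c d \<noteq> {}"
  shows "brunn_minkowski_pair (box a b) (box c d)"
proof -
  have ab: "a \<bullet> i < b \<bullet> i" and cd: "c \<bullet> i < d \<bullet> i" if "i \<in> Basis" for i
    using assms that by (auto simp: box_ne_empty)
  have sub: "box (a + c) (b + d) \<subseteq> box a b + box c d"
  proof
    fix x assume x: "x \<in> box (a + c) (b + d)"
    \<comment> \<open>The relative position of x in the i-th side of the sum box. The summands y and
      x - y are given the same relative position in their own boxes.\<close>
    define r where "r i = ((x - (a + c)) \<bullet> i) / (((b - a) + (d - c)) \<bullet> i)" for i
    have den: "((b - a) + (d - c)) \<bullet> i > 0" if "i \<in> Basis" for i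
      using ab[OF that] cd[OF that] by (simp add: inner_simps)
    have r: "0 < r i" "r i < 1" if "i \<in> Basis" for i
      using x den[OF that] that by (auto simp: r_def mem_box inner_simps)
    define y where "y = (\<Sum>i\<in>Basis. (a \<bullet> i + r i * (b \<bullet> i - a \<bullet> i)) *\<^sub>R i)"
    have yi: "y \<bullet> i = a \<bullet> i + r i * (b \<bullet> i - a \<bullet> i)" if "i \<in> Basis" for i
      using that by (simp add: y_def)
    have zi: "(x - y) \<bullet> i = c \<bullet> i + r i * (d \<bullet> i - c \<bullet> i)" if "i \<in> Basis" for i
    proof -
      have "r i * (((b - a) + (d - c)) \<bullet> i) = (x - (a + c)) \<bullet> i"
        using den[OF that] by (simp add: r_def)
      then show ?thesis using yi[OF that] by (simp add: inner_simps algebra_simps)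
    qed
    have mid: "p < p + t * (q - p) \<and> p + t * (q - p) < q" if "p < q" "0 < t" "t < 1" for p q t :: real
    proof -
      have "0 < t * (q - p)" "t * (q - p) < 1 * (q - p)"
        using that by (auto intro!: mult_strict_right_mono)
      then show ?thesis by simp
    qed
    have "y \<in> box a b" using mid[OF ab r] by (auto simp: mem_box yi)
    moreover have "x - y \<in> box c d" using mid[OF cd r] by (auto simp only: mem_box zi)
    moreover have "x = y + (x - y)" by simp
    ultimately show "x \<in> box a b + box c d" unfolding set_plus_def by blast
  qed
  have le: "\<forall>i\<in>Basis. a \<bullet> i \<le> b \<bullet> i" "\<forall>i\<in>Basis. c \<bullet> i \<le> d \<bullet> i" "\<forall>i\<in>Basis. (a + c) \<bullet> i \<le> (b + d) \<bullet> i"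
    using ab cd by (force simp: inner_simps less_imp_le add_mono)+
  have "(volume (box a b) powr (1 / DIM('a)) + volume (box c d) powr (1 / DIM('a))) ^ DIM('a)
    \<le> (\<Prod>i\<in>Basis. (b - a) \<bullet> i + (d - c) \<bullet> i)"
    using le(1,2) ab cd powr_prod_add_le[of "Basis :: 'a set" "\<lambda>i. (b - a) \<bullet> i" "\<lambda>i. (d - c) \<bullet> i"]
    by (simp add: inner_diff_left)
  also have "\<dots> = volume (box (a + c) (b + d))"
    using le(3) by (simp add: inner_simps algebra_simps)
  also have "\<dots> \<le> volume (box a b + box c d)"
    using sub by (intro volume_mono bounded_set_plus borel_open open_set_plus) auto
  finally show ?thesis unfolding brunn_minkowski_pair_def .
qed

lemma measure_pos_open:
  fixes S :: "'a::euclidean_space set"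
  assumes "open S" "bounded S" "S \<noteq> {}"
  shows "volume S > 0"
proof -
  have "\<not> negligible S" using open_not_negligible assms by blast
  then have "emeasure lborel S \<noteq> 0"
    using assms(1) by (simp add: negligible_iff_emeasure0 emeasure_completion)
  then show ?thesis
    using emeasure_bounded_finite[OF assms(2)] by (simp add: measure_def enn2real_positive_iff zero_less_iff_neq_zero)
qed

text \<open>The Hadwiger--Ohmann cut: a hyperplane separating two boxes of one family is matched by a
  parallel hyperplane dividing the other set in the same ratio.\<close>

lemma brunn_minkowski_cut:
  fixes A B :: "'a::euclidean_space set"
  assumes u: "norm u = 1" and A: "open A" "bounded A" and B: "open B" "bounded B"
    and pos: "volume A > 0"
    and ratio: "cut_volume u B t * volume A
             = cut_volume u A s * volume B"
    and le: "brunn_minkowski_pair (A \<inter> {x. u \<bullet> x < s}) (B \<inter> {x. u \<bullet> x < t})"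
    and gt: "brunn_minkowski_pair (A \<inter> {x. u \<bullet> x > s}) (B \<inter> {x. u \<bullet> x > t})"
  shows "brunn_minkowski_pair A B"
proof -
  have half: "open {x. u \<bullet> x < r}" "open {x. u \<bullet> x > r}" for r
    by (simp_all add: open_halfspace_lt open_halfspace_gt)
  define l where "l = cut_volume u A s / volume A"
  note bA = borel_open[OF A(1)] A(2) and bB = borel_open[OF B(1)] B(2)
  have l: "volume (A \<inter> {x. u \<bullet> x < s}) = l * volume A"
    "volume (B \<inter> {x. u \<bullet> x < t}) = l * volume B"
    using pos ratio by (simp_all add: measure_halfspace_less[OF u bA] measure_halfspace_less[OF u bB] l_def field_simps)
  have l': "volume (A \<inter> {x. u \<bullet> x > s}) = (1 - l) * volume A"
    "volume (B \<inter> {x. u \<bullet> x > t}) = (1 - l) * volume B"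
    using l measure_halfspace_split[OF u bA, of s] measure_halfspace_split[OF u bB, of t]
    by (simp_all add: measure_halfspace_less[OF u bA] measure_halfspace_less[OF u bB] algebra_simps)
  have "l \<ge> 0" by (simp add: l_def)
  have "l \<le> 1" using l'(1) pos measure_nonneg[of lborel "A \<inter> {x. u \<bullet> x > s}"]
    by (simp add: zero_le_mult_iff)
  let ?X = "volume A powr (1 / DIM('a)) + volume B powr (1 / DIM('a))"
  have "l * ?X ^ DIM('a) \<le> volume ((A \<inter> {x. u \<bullet> x < s}) + (B \<inter> {x. u \<bullet> x < t}))"
    using le \<open>l \<ge> 0\<close> unfolding brunn_minkowski_pair_def l by (simp add: powr_sum_scale)
  moreover have "(1 - l) * ?X ^ DIM('a) \<le> volume ((A \<inter> {x. u \<bullet> x > s}) + (B \<inter> {x. u \<bullet> x > t}))"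
    using gt \<open>l \<le> 1\<close> unfolding brunn_minkowski_pair_def l' by (simp add: powr_sum_scale)
  moreover have "volume ((A \<inter> {x. u \<bullet> x < s}) + (B \<inter> {x. u \<bullet> x < t}))
     + volume ((A \<inter> {x. u \<bullet> x > s}) + (B \<inter> {x. u \<bullet> x > t})) \<le> volume (A + B)"
  proof (rule measure_halfspace_superadditive[OF u])
    show "A + B \<in> sets borel" "bounded (A + B)"
      using A B by (auto intro!: borel_open open_set_plus bounded_set_plus)
    show "(A \<inter> {x. u \<bullet> x < s}) + (B \<inter> {x. u \<bullet> x < t}) \<in> sets borel"
      "(A \<inter> {x. u \<bullet> x > s}) + (B \<inter> {x. u \<bullet> x > t}) \<in> sets borel"
      using A half by (auto intro!: borel_open open_set_plus)
    show "(A \<inter> {x. u \<bullet> x < s}) + (B \<inter> {x. u \<bullet> x < t}) \<subseteq> (A + B) \<inter> {x. u \<bullet> x \<le> s + t}"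
      "(A \<inter> {x. u \<bullet> x > s}) + (B \<inter> {x. u \<bullet> x > t}) \<subseteq> (A + B) \<inter> {x. u \<bullet> x \<ge> s + t}"
      by (force simp: set_plus_def inner_add_right)+
  qed
  ultimately show ?thesis unfolding brunn_minkowski_pair_def by (simp add: algebra_simps)
qed

text \<open>Induction on the total number of boxes. A coordinate hyperplane between two boxes of one
  family removes a box from that family on either side, while the matching cut of the other family
  does not increase its count.\<close>

lemma brunn_minkowski_disjoint_boxes:
  fixes \<A> \<B> :: "'a::euclidean_space set set"
  assumes "disjoint_boxes \<A>" "disjoint_boxes \<B>" "\<A> \<noteq> {}" "\<B> \<noteq> {}"
  shows "brunn_minkowski_pair (\<Union>\<A>) (\<Union>\<B>)"
  using assms
proof (induction "card \<A> + card \<B>" arbitrary: \<A> \<B> rule: less_induct)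
  case less
  \<comment> \<open>Stated for any two families with the same total, so that it also applies with
    the roles exchanged when only the second family has two boxes.\<close>
  have step: "brunn_minkowski_pair (\<Union>\<A>') (\<Union>\<B>')"
    if sum: "card \<A>' + card \<B>' = card \<A> + card \<B>" and ne: "\<A>' \<noteq> {}" "\<B>' \<noteq> {}"
      and \<A>': "disjoint_boxes \<A>'" and \<B>': "disjoint_boxes \<B>'" and two: "card \<A>' \<ge> 2" for \<A>' \<B>' :: "'a set set"
  proof -
    obtain C D where CD: "C \<in> \<A>'" "D \<in> \<A>'" "C \<noteq> D"
      using two by (metis One_nat_def card_le_Suc0_iff_eq card.infinite le_SucE not_less_eq_eq numeral_2_eq_2 zero_le)
    obtain a b c d where box: "C = box a b" "D = box c d"
      using \<A>' CD unfolding disjoint_boxes_def by metis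
    have "C \<inter> D = {}" using \<A>' CD by (auto simp: disjoint_boxes_def pairwise_def disjnt_def)
    moreover have "C \<noteq> {}" "D \<noteq> {}" using \<A>' CD by (auto simp: disjoint_boxes_def)
    ultimately obtain i where i: "i \<in> Basis" "b \<bullet> i \<le> c \<bullet> i \<or> d \<bullet> i \<le> a \<bullet> i"
      unfolding box disjoint_interval(4) by (auto simp: box_ne_empty not_le[symmetric])
    obtain C D s where CD: "C \<in> \<A>'" "D \<in> \<A>'" "C \<subseteq> {x. i \<bullet> x < s}" "D \<subseteq> {x. i \<bullet> x > s}"
      using i(2)
    proof
      assume "b \<bullet> i \<le> c \<bullet> i"
      then show thesis using i(1) CD box
        by (intro that[of C D "b \<bullet> i"]) (force simp: mem_box inner_commute)+
    next
      assume "d \<bullet> i \<le> a \<bullet> i"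
      then show thesis using i(1) CD box
        by (intro that[of D C "d \<bullet> i"]) (force simp: mem_box inner_commute)+
    qed
    have u: "norm i = 1" using i(1) by simp
    let ?A = "\<Union>\<A>'" and ?B = "\<Union>\<B>'"
    note oA = disjoint_boxes_open[OF \<A>'] disjoint_boxes_bounded[OF \<A>']
      and oB = disjoint_boxes_open[OF \<B>'] disjoint_boxes_bounded[OF \<B>']
    have half: "open {x. i \<bullet> x < r}" "open {x. i \<bullet> x > r}" for r
      by (simp_all add: open_halfspace_lt open_halfspace_gt)
    have neA: "?A \<noteq> {}" "?B \<noteq> {}" using ne \<A>' \<B>' by (auto simp: disjoint_boxes_def)
    have VA: "volume ?A > 0" "volume ?B > 0"
      using neA oA oB by (auto intro: measure_pos_open)
    have "C \<noteq> {}" "D \<noteq> {}" using CD \<A>' by (auto simp: disjoint_boxes_def)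
    then have neAm: "?A \<inter> {x. i \<bullet> x < s} \<noteq> {}" "?A \<inter> {x. i \<bullet> x > s} \<noteq> {}"
      using CD by blast+
    have dis: "C \<inter> {x. i \<bullet> x > s} = {}" "D \<inter> {x. i \<bullet> x < s} = {}"
      using CD(3,4) by fastforce+
    have VAm: "volume (?A \<inter> {x. i \<bullet> x < s}) > 0" "volume (?A \<inter> {x. i \<bullet> x > s}) > 0"
      using neAm oA half by (auto intro!: measure_pos_open open_Int bounded_Int)
    note bA = borel_open[OF oA(1)] oA(2) and bB = borel_open[OF oB(1)] oB(2)
    have splitA: "volume ?A = cut_volume i ?A s + volume (?A \<inter> {x. i \<bullet> x > s})"
      by (rule measure_halfspace_split[OF u bA])
    have lessA: "volume (?A \<inter> {x. i \<bullet> x < s}) = cut_volume i ?A s"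
      by (rule measure_halfspace_less[OF u bA])
    let ?l = "cut_volume i ?A s / volume ?A"
    \<comment> \<open>The fraction is strictly between 0 and 1, hence both halves of
      \<open>?B\<close> have positive volume and are nonempty, as the induction hypothesis
      demands.\<close>
    have l: "0 < ?l" "?l < 1" using VA VAm splitA lessA by auto
    have "?l * volume ?B \<le> volume ?B"
      using l VA by (intro mult_left_le_one_le) auto
    then obtain t where t: "cut_volume i ?B t = ?l * volume ?B"
      using obtain_halfspace_fraction[OF u bB, of "?l * volume ?B"] l VA by auto
    have VBm: "volume (?B \<inter> {x. i \<bullet> x < t}) > 0" "volume (?B \<inter> {x. i \<bullet> x > t}) > 0"
    proof -
      show "volume (?B \<inter> {x. i \<bullet> x < t}) > 0"
        using mult_pos_pos[OF l(1) VA(2)] by (simp only: measure_halfspace_less[OF u bB] t)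
      have "?l * volume ?B < 1 * volume ?B"
        using l VA by (intro mult_strict_right_mono) auto
      then show "volume (?B \<inter> {x. i \<bullet> x > t}) > 0"
        using measure_halfspace_split[OF u bB, of t] unfolding t by linarith
    qed
    have neB: "?B \<inter> {x. i \<bullet> x < t} \<noteq> {}" "?B \<inter> {x. i \<bullet> x > t} \<noteq> {}"
      using VBm by (metis less_irrefl measure_empty)+
    show ?thesis
    proof (rule brunn_minkowski_cut[OF u oA oB VA(1), of t s])
      show "cut_volume i ?B t * volume ?A
         = cut_volume i ?A s * volume ?B"
        using t VA by simp
      note cuts = disjoint_boxes_cut[where H = "{x. i \<bullet> x < s}", OF \<A>' box_Int_halfspaces(1)[OF i(1)]]
        disjoint_boxes_cut[where H = "{x. i \<bullet> x < t}", OF \<B>' box_Int_halfspaces(1)[OF i(1)]]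
      show "brunn_minkowski_pair (?A \<inter> {x. i \<bullet> x < s}) (?B \<inter> {x. i \<bullet> x < t})"
        unfolding cuts(2,6)[symmetric]
        by (rule less(1)[OF _ cuts(1,5)])
          (use cuts(4)[OF CD(2) dis(2)] cuts(7) sum neAm(1) neB(1) in \<open>auto simp: cuts(2,6)[symmetric]\<close>)
      note cuts = disjoint_boxes_cut[where H = "{x. i \<bullet> x > s}", OF \<A>' box_Int_halfspaces(2)[OF i(1)]]
        disjoint_boxes_cut[where H = "{x. i \<bullet> x > t}", OF \<B>' box_Int_halfspaces(2)[OF i(1)]]
      show "brunn_minkowski_pair (?A \<inter> {x. i \<bullet> x > s}) (?B \<inter> {x. i \<bullet> x > t})"
        unfolding cuts(2,6)[symmetric]
        by (rule less(1)[OF _ cuts(1,5)])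
          (use cuts(4)[OF CD(1) dis(1)] cuts(7) sum neAm(2) neB(2) in \<open>auto simp: cuts(2,6)[symmetric]\<close>)
    qed
  qed
  show ?case
  proof (cases "card \<A> \<ge> 2 \<or> card \<B> \<ge> 2")
    case True
    then show ?thesis
    proof
      assume "card \<A> \<ge> 2" then show ?thesis using less.prems by (intro step) auto
    next
      assume "card \<B> \<ge> 2" then show ?thesis
        unfolding brunn_minkowski_pair_commute[of "\<Union>\<A>"] using less.prems by (intro step) auto
    qed
  next
    case False
    have "finite \<A>" "finite \<B>" using less.prems by (auto simp: disjoint_boxes_def)
    then have "card \<A> = 1" "card \<B> = 1" using False less.prems by (auto simp: not_le less_2_cases_iff)
    then obtain C D where CD: "\<A> = {C}" "\<B> = {D}" by (meson card_1_singletonE)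
    then obtain a b c d where "C = box a b" "D = box c d" "C \<noteq> {}" "D \<noteq> {}"
      using less.prems unfolding disjoint_boxes_def by auto
    then show ?thesis using brunn_minkowski_box CD by simp
  qed
qed

text \<open>A countable covering of S by non-overlapping closed boxes inside S is cut down to a
  finite part that captures the volume up to e; passing to interiors makes the boxes disjoint and
  costs no volume.\<close>

lemma inner_approximation_disjoint_boxes:
  fixes S :: "'a::euclidean_space set"
  assumes S: "open S" "bounded S" "S \<noteq> {}" and e: "e > 0"
  obtains \<A> where "disjoint_boxes \<A>" "\<A> \<noteq> {}" "\<Union>\<A> \<subseteq> S" "volume S \<le> volume (\<Union>\<A>) + e"
proof -
  obtain a where a: "S \<subseteq> box (-a) a" using S(2) bounded_subset_box_symmetric by blast
  \<comment> \<open>This gauge forces every box of the covering to lie inside S, since each box is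
    controlled at one of its points in S.\<close>
  define g where "g x = (if x \<in> S then S else UNIV)" for x
  have "gauge g" using S(1) by (auto simp: gauge_def g_def)
  moreover have "S \<subseteq> cbox (-a) a" "box (-a) a \<noteq> {}" using a box_subset_cbox S(3) by blast+
  ultimately obtain \<D> where \<D>: "countable \<D>" 
    "\<And>K. K \<in> \<D> \<Longrightarrow> interior K \<noteq> {} \<and> (\<exists>c d. K = cbox c d)"
    "pairwise (\<lambda>A B. interior A \<inter> interior B = {}) \<D>"
    "\<And>K. K \<in> \<D> \<Longrightarrow> \<exists>x \<in> S \<inter> K. K \<subseteq> g x" "S \<subseteq> \<Union>\<D>"
    by (elim covering_lemma[of S "-a" a g]) blast+
  have sub: "K \<subseteq> S" if K: "K \<in> \<D>" for K
  proof -
    obtain x where "x \<in> S" "K \<subseteq> g x" using \<D>(4)[OF K] by blast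
    then show ?thesis by (simp add: g_def)
  qed
  have un: "\<Union>\<D> = S"
  proof
    show "\<Union>\<D> \<subseteq> S" by (rule Union_least) (rule sub)
    show "S \<subseteq> \<Union>\<D>" by (rule \<D>(5))
  qed
  have "\<D> \<noteq> {}" using \<D>(5) S(3) by auto
  then obtain f :: "nat \<Rightarrow> 'a set" where f: "range f = \<D>" using range_from_nat_into[OF _ \<D>(1)] by blast
  define U where "U n = (\<Union>k\<le>n. f k)" for n :: nat
  have fD: "f k \<in> \<D>" for k unfolding f[symmetric] by (rule rangeI)
  have fb: "f k \<in> sets borel" for k
  proof -
    obtain c d where "f k = cbox c d" using \<D>(2)[OF fD] by blast
    then show ?thesis by simp
  qed
  have UN: "(\<Union>n. U n) = S" unfolding U_def un[symmetric] f[symmetric] by blast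
  have "(\<lambda>n. volume (U n)) \<longlonglongrightarrow> volume (\<Union>n. U n)"
  proof (rule Lim_measure_incseq)
    show "range U \<subseteq> sets lborel" unfolding U_def using fb by auto
    show "incseq U" unfolding U_def incseq_def by force
    show "emeasure lborel (\<Union>n. U n) \<noteq> \<infinity>" unfolding UN using emeasure_bounded_finite[OF S(2)] by simp
  qed
  then have "eventually (\<lambda>n. volume (U n) > volume S - e) sequentially"
    unfolding UN using e by (intro order_tendstoD) auto
  then obtain n where n: "volume (U n) > volume S - e"
    using eventually_happens'[OF sequentially_bot] by blast
  define \<F> where "\<F> = f ` {..n}"
  have \<F>: "finite \<F>" "\<F> \<subseteq> \<D>" "\<Union>\<F> = U n" "\<F> \<noteq> {}" using fD by (auto simp: \<F>_def U_def)
  let ?A = "interior ` \<F>"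
  have db: "disjoint_boxes ?A"
    unfolding disjoint_boxes_def
  proof (intro conjI ballI)
    show "finite ?A" using \<F> by simp
    show "disjoint ?A"
    proof (rule pairwise_imageI)
      fix K L assume "K \<in> \<F>" "L \<in> \<F>" "K \<noteq> L" "interior K \<noteq> interior L"
      then show "disjnt (interior K) (interior L)"
        using \<D>(3) \<F>(2) unfolding pairwise_def disjnt_def by blast
    qed
    fix C assume "C \<in> ?A"
    then obtain K where K: "K \<in> \<D>" "C = interior K" using \<F>(2) by auto
    obtain c d where "K = cbox c d" "interior K \<noteq> {}" using \<D>(2)[OF K(1)] by blast
    with K show "C \<noteq> {}" "\<exists>a b. C = box a b" by (auto simp: interior_cbox)
  qed
  have inj: "inj_on interior \<F>"
  proof (rule inj_onI, rule ccontr)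
    fix K L assume KL: "K \<in> \<F>" "L \<in> \<F>" "interior K = interior L" "K \<noteq> L"
    then have "interior K \<inter> interior L = {}" using \<D>(3) \<F>(2) unfolding pairwise_def by blast
    then show False using KL \<D>(2)[of K] \<F>(2) by auto
  qed
  have "volume (U n) \<le> (\<Sum>K\<in>\<F>. volume K)"
    unfolding \<F>(3)[symmetric]
    using \<F>(1) fb by (intro measure_Union_le) (auto simp: \<F>_def)
  also have "\<dots> = (\<Sum>K\<in>\<F>. volume (interior K))"
  proof (intro sum.cong refl)
    fix K assume "K \<in> \<F>"
    then obtain c d where "K = cbox c d" using \<D>(2) \<F>(2) by blast
    then show "volume K = volume (interior K)"
      by (simp add: interior_cbox measure_def emeasure_lborel_cbox_eq emeasure_lborel_box_eq)
  qed
  also have "\<dots> = (\<Sum>C\<in>?A. volume C)" using inj by (simp add: sum.reindex)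
  also have "\<dots> = volume (\<Union>?A)"
  proof (rule measure_Union'[symmetric])
    show "finite ?A" using \<F> by simp
    show "pairwise disjnt ?A" using db by (simp add: disjoint_boxes_def)
    show "C \<in> fmeasurable lborel" if "C \<in> ?A" for C
      using that db by (auto simp: disjoint_boxes_def)
  qed
  finally have "volume S \<le> volume (\<Union>?A) + e" using n by simp
  moreover have "\<Union>?A \<subseteq> S" using sub \<F>(2) interior_subset by blast
  ultimately show thesis using that[of ?A] db \<F>(4) by simp
qed

theorem brunn_minkowski_open:
  fixes A B :: "'a::euclidean_space set"
  assumes A: "open A" "bounded A" "A \<noteq> {}" and B: "open B" "bounded B" "B \<noteq> {}"
  shows "brunn_minkowski_pair A B"
proof -
  let ?n = "DIM('a)"
  let ?V = "volume :: 'a set \<Rightarrow> real"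
  \<comment> \<open>Truncation at 0 keeps the bases nonnegative for every e > 0, so that the powers
    are monotone; it disappears in the limit.\<close>
  let ?X = "\<lambda>e. (max 0 (?V A - e) powr (1 / ?n) + max 0 (?V B - e) powr (1 / ?n)) ^ ?n"
  have "?X e \<le> ?V (A + B)" if e: "e > 0" for e
  proof -
    obtain \<A> where \<A>: "disjoint_boxes \<A>" "\<A> \<noteq> {}" "\<Union>\<A> \<subseteq> A" "?V A \<le> ?V (\<Union>\<A>) + e"
      using inner_approximation_disjoint_boxes[OF A e] by blast
    obtain \<B> where \<B>: "disjoint_boxes \<B>" "\<B> \<noteq> {}" "\<Union>\<B> \<subseteq> B" "?V B \<le> ?V (\<Union>\<B>) + e"
      using inner_approximation_disjoint_boxes[OF B e] by blast
    have "?X e \<le> (?V (\<Union>\<A>) powr (1 / ?n) + ?V (\<Union>\<B>) powr (1 / ?n)) ^ ?n"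
      using \<A>(4) \<B>(4) by (intro power_mono add_mono powr_mono2) auto
    also have "\<dots> \<le> ?V (\<Union>\<A> + \<Union>\<B>)"
      using brunn_minkowski_disjoint_boxes[OF \<A>(1) \<B>(1) \<A>(2) \<B>(2)] by (simp add: brunn_minkowski_pair_def)
    also have "\<dots> \<le> ?V (A + B)"
      using \<A>(3) \<B>(3) A B disjoint_boxes_open[OF \<A>(1)]
      by (intro volume_mono set_plus_mono2)
         (auto intro: borel_open open_set_plus bounded_set_plus)
    finally show ?thesis .
  qed
  moreover have "(?X \<longlongrightarrow> ?X 0) (at_right 0)"
    using measure_pos_open[OF A] measure_pos_open[OF B] by (auto intro!: tendsto_eq_intros)
  ultimately have "?X 0 \<le> ?V (A + B)"
    by (intro tendsto_upperbound[of ?X _ "at_right 0"]) (auto simp: eventually_at_right_less intro: eventually_at_rightI[of 0 1])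
  then show ?thesis unfolding brunn_minkowski_pair_def by simp
qed

lemma measure_interior_convex:
  fixes K :: "'a::euclidean_space set"
  assumes "convex K" "bounded K" "K \<in> sets borel"
  shows "volume (interior K) = volume K"
proof -
  have "negligible (K - interior K)"
    using negligible_convex_frontier[OF assms(1)] closure_subset
    by (auto simp: frontier_def intro: negligible_subset)
  then have "measure lebesgue (interior K) = measure lebesgue K"
    using assms interior_subset[of K] bounded_set_imp_lmeasurable[of K]
    by (intro measure_negligible_symdiff) (auto simp: Un_absorb1 Diff_eq_empty_iff Un_commute)
  then show ?thesis using assms(3) by (simp add: measure_completion)
qed

theorem brunn_minkowski:
  fixes K L :: "'a::euclidean_space set"
  assumes "convex_body K" "convex_body L"
  shows "brunn_minkowski_pair K L"
proof -
  have *: "convex K" "bounded K" "K \<in> sets borel" "convex L" "bounded L" "L \<in> sets borel"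
    "interior K \<noteq> {}" "interior L \<noteq> {}" "compact K" "compact L"
    using assms by (auto simp: convex_body_def compact_imp_bounded borel_compact)
  have "brunn_minkowski_pair (interior K) (interior L)"
    using * by (intro brunn_minkowski_open) (auto intro: bounded_interior)
  moreover have "volume (interior K + interior L) \<le> volume (K + L)"
    using borel_open[OF open_set_plus[OF open_interior, of K "interior L"]]
      borel_compact[OF compact_plus[OF *(9,10)]] bounded_set_plus[OF *(2,5)]
    by (intro volume_mono set_plus_mono2 interior_subset) auto
  ultimately show ?thesis
    by (simp add: brunn_minkowski_pair_def measure_interior_convex[OF *(1-3)] measure_interior_convex[OF *(4-6)])
qed

section \<open>Hyperplanes and slices\<close>

abbreviation hvol :: "'a::euclidean_space \<Rightarrow> 'a set \<Rightarrow> real"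
  where "hvol u S \<equiv> measure (hyperplane_lborel u) S"

section \<open>Convex bodies and Brunn--Minkowski inside a hyperplane\<close>

lemma convex_bodyD:
  assumes "convex_body K"
  shows "compact K" "convex K"
  using assms by (auto simp: convex_body_def)

lemma convex_body_props:
  assumes "convex_body K"
  shows "K \<noteq> {}" "bounded K" "K \<in> sets borel"
  using assms interior_subset by (auto simp: convex_body_def compact_imp_bounded borel_compact)

lemma convex_body_measure_pos:
  assumes "convex_body K" shows "volume K > 0"
proof -
  have "0 < volume (interior K)"
    using assms by (intro measure_pos_open) (auto simp: convex_body_def compact_imp_bounded bounded_interior)
  also have "\<dots> = volume K"
    using assms by (intro measure_interior_convex) (auto simp: convex_body_def compact_imp_bounded borel_compact)
  finally show ?thesis .
qed

text \<open>The boundary of a convex set is null, so positive volume forces interior points.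
  Cylinders, dilates and the two halves of a cut body are recognised as convex bodies in this
  way.\<close>

lemma convex_body_if_measure_pos:
  assumes K: "compact K" "convex K" "volume K > 0"
  shows "convex_body K"
proof -
  have "interior K \<noteq> {}"
    using measure_interior_convex[OF K(2) compact_imp_bounded[OF K(1)] borel_compact[OF K(1)]] K(3) by auto
  then show ?thesis using K by (simp add: convex_body_def)
qed

lemma convex_set_plus:
  fixes S T :: "'a::real_vector set"
  assumes "convex S" "convex T" shows "convex (S + T)"
proof -
  have "S + T = (\<Union>x\<in>S. \<Union>y\<in>T. {x + y})" by (auto simp: set_plus_def)
  then show ?thesis using convex_sums[OF assms] by simp
qed

lemma interior_set_plus_subset:
  fixes S T :: "'a::real_normed_vector set"
  shows "interior S + interior T \<subseteq> interior (S + T)"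
  by (intro interior_maximal set_plus_mono2 interior_subset open_set_plus open_interior)

lemma convex_body_plus:
  assumes "convex_body K" "convex_body L" shows "convex_body (K + L)"
  unfolding convex_body_def
proof (intro conjI)
  obtain x y where "x \<in> interior K" "y \<in> interior L"
    using assms by (auto simp: convex_body_def)
  then have "x + y \<in> interior K + interior L" by (rule set_plus_intro)
  then show "interior (K + L) \<noteq> {}" using interior_set_plus_subset by blast
qed (use assms in \<open>auto simp: convex_body_def intro: compact_plus convex_set_plus\<close>)

lemma cylinder_image: "cylinder u a S = S + (\<lambda>t. t *\<^sub>R u) ` {0..a}"
  by (auto simp: cylinder_def set_plus_def)

lemma compact_cylinder: "compact S \<Longrightarrow> compact (cylinder u a S)"
  unfolding cylinder_image by (intro compact_plus compact_continuous_image continuous_intros) auto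

lemma convex_cylinder: "convex S \<Longrightarrow> convex (cylinder u a S)"
  unfolding cylinder_image
  by (intro convex_set_plus convex_linear_image) (auto intro: linear_scale_left linearI simp: algebra_simps)

lemma cylinder_plus:
  assumes "a \<ge> 0" "b \<ge> 0"
  shows "cylinder u a P + cylinder u b Q = cylinder u (a + b) (P + Q)"
proof -
  have "(\<lambda>t. t *\<^sub>R u) ` {0..a} + (\<lambda>t. t *\<^sub>R u) ` {0..b} = (\<lambda>t. t *\<^sub>R u) ` {0..a + b}"
  proof
    show "(\<lambda>t. t *\<^sub>R u) ` {0..a} + (\<lambda>t. t *\<^sub>R u) ` {0..b} \<subseteq> (\<lambda>t. t *\<^sub>R u) ` {0..a + b}"
      by (auto simp: set_plus_def scaleR_add_left[symmetric])
    show "(\<lambda>t. t *\<^sub>R u) ` {0..a + b} \<subseteq> (\<lambda>t. t *\<^sub>R u) ` {0..a} + (\<lambda>t. t *\<^sub>R u) ` {0..b}"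
    proof
      fix x assume "x \<in> (\<lambda>t. t *\<^sub>R u) ` {0..a + b}"
      then obtain t where "t \<in> {0..a + b}" "x = t *\<^sub>R u" by auto
      then have "x = min t a *\<^sub>R u + (t - min t a) *\<^sub>R u" "min t a \<in> {0..a}" "t - min t a \<in> {0..b}"
        using assms by (auto simp: scaleR_add_left[symmetric] min_def)
      then show "x \<in> (\<lambda>t. t *\<^sub>R u) ` {0..a} + (\<lambda>t. t *\<^sub>R u) ` {0..b}" by blast
    qed
  qed
  then show ?thesis unfolding cylinder_image by (metis add.assoc add.left_commute)
qed

lemma orth_hyperplane_plus:
  "P \<subseteq> orth_hyperplane u \<Longrightarrow> Q \<subseteq> orth_hyperplane u \<Longrightarrow> P + Q \<subseteq> orth_hyperplane u"
  by (fastforce simp: orth_hyperplane_def set_plus_def inner_add_right)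

lemma measure_cylinder_compact:
  assumes "norm u = 1" "S \<subseteq> orth_hyperplane u" "compact S" "a \<ge> 0"
  shows "volume (cylinder u a S) = a * hvol u S"
  using assms by (intro measure_cylinder borel_compact)

text \<open>The heights of the cylinders are the \<open>(n - 1)\<close>-st roots of the volumes of their bases, so that
  nothing is lost when the \<open>n\<close>-dimensional inequality is applied to the cylinders.\<close>

lemma brunn_minkowski_hyperplane:
  fixes P Q :: "'a::euclidean_space set"
  assumes n: "DIM('a) \<ge> 2" and u: "norm u = 1"
    and P: "P \<subseteq> orth_hyperplane u" "compact P" "convex P" "hvol u P > 0"
    and Q: "Q \<subseteq> orth_hyperplane u" "compact Q" "convex Q" "hvol u Q > 0"
  shows "(hvol u P powr (1 / real (DIM('a) - 1)) + hvol u Q powr (1 / real (DIM('a) - 1))) ^ (DIM('a) - 1)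
    \<le> hvol u (P + Q)"
proof -
  define m where "m = DIM('a) - 1"
  then have m: "m > 0" "DIM('a) = Suc m" using n by auto
  define a b where "a = hvol u P powr (1 / real m)" and "b = hvol u Q powr (1 / real m)"
  have pos: "a > 0" "b > 0" using P Q by (auto simp: a_def b_def)
  have am: "a ^ m = hvol u P" "b ^ m = hvol u Q"
    using m by (auto simp: a_def b_def powr_inverse_power)
  let ?C = "cylinder u a P" and ?D = "cylinder u b Q"
  have V: "volume ?C = a ^ Suc m" "volume ?D = b ^ Suc m"
    using pos P Q u by (auto simp: measure_cylinder_compact am)
  have "convex_body ?C" "convex_body ?D"
    using pos P Q V by (auto intro!: convex_body_if_measure_pos compact_cylinder convex_cylinder)
  then have "brunn_minkowski_pair ?C ?D" by (rule brunn_minkowski)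
  moreover have "(x ^ Suc m) powr (1 / real (Suc m)) = x" if "x > 0" for x :: real
    using that by (simp add: powr_realpow[symmetric] powr_powr del: power_Suc of_nat_Suc)
  ultimately have "(a + b) ^ Suc m \<le> volume (?C + ?D)"
    unfolding brunn_minkowski_pair_def V m(2) using pos by (simp only:)
  \<comment> \<open>The heights add up, so one factor a + b is the height of the sum and
    cancels.\<close>
  also have "\<dots> = (a + b) * hvol u (P + Q)"
    using pos P Q u
    by (simp add: cylinder_plus measure_cylinder_compact orth_hyperplane_plus compact_plus)
  finally have "(a + b) ^ m \<le> hvol u (P + Q)" using pos by simp
  then show ?thesis unfolding a_def b_def m_def .
qed

lemma measure_lborel_affine_image:
  fixes S :: "'a::euclidean_space set"
  assumes "compact S"
  shows "volume ((\<lambda>y. c *\<^sub>R y + x) ` S) = \<bar>c\<bar> ^ DIM('a) * volume S"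
proof -
  have "measure lebesgue ((\<lambda>y. c *\<^sub>R y + x) ` S) = \<bar>c\<bar> ^ DIM('a) * measure lebesgue S"
    using measure_lebesgue_affine[of c x S] by simp
  moreover have "(\<lambda>y. c *\<^sub>R y + x) ` S \<in> sets borel"
    using assms by (intro borel_compact compact_continuous_image continuous_intros)
  ultimately show ?thesis using assms by (simp add: measure_completion borel_compact)
qed

lemma affine_image_eq:
  fixes A :: "'a::real_vector set"
  shows "(\<lambda>y. c *\<^sub>R y + x) ` A = {x} + (*\<^sub>R) c ` A"
  by (simp add: translation_eq_singleton_plus[symmetric] image_image add.commute[of x])

lemma affine_image_plus:
  fixes A B :: "'a::real_vector set"
  shows "(\<lambda>y. c *\<^sub>R y + x) ` (A + B) = (\<lambda>y. c *\<^sub>R y + x) ` A + (*\<^sub>R) c ` B"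
  unfolding affine_image_eq linear_image_plus[OF linear_scaleR] by (simp add: add.assoc)

lemma measure_lborel_scaleR_image:
  fixes S :: "'a::euclidean_space set"
  shows "compact S \<Longrightarrow> volume ((*\<^sub>R) c ` S) = \<bar>c\<bar> ^ DIM('a) * volume S"
  using measure_lborel_affine_image[of S c 0] by simp

text \<open>Dilating the cylinder of height 1 over S gives the cylinder of height c over the dilated
  base. Its volume is multiplied by c^n, and one factor c is the height.\<close>

lemma hvol_scaleR_image:
  fixes S :: "'a::euclidean_space set"
  assumes u: "norm u = 1" and S: "S \<subseteq> orth_hyperplane u" "compact S" and c: "c > 0"
  shows "hvol u ((*\<^sub>R) c ` S) = c ^ (DIM('a) - 1) * hvol u S"
proof -
  have "(\<lambda>t. t *\<^sub>R u) ` {0..c} = (*\<^sub>R) c ` (\<lambda>t. t *\<^sub>R u) ` {0..1}"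
  proof -
    have "{0..c} = (*) c ` {0..1}" using c by (simp add: image_mult_atLeastAtMost)
    then show ?thesis by (simp add: image_image)
  qed
  then have "cylinder u c ((*\<^sub>R) c ` S) = (*\<^sub>R) c ` cylinder u 1 S"
    unfolding cylinder_image by (simp add: linear_image_plus[OF linear_scaleR])
  moreover have "(*\<^sub>R) c ` S \<subseteq> orth_hyperplane u" using S by (auto simp: orth_hyperplane_def)
  ultimately have "c * hvol u ((*\<^sub>R) c ` S) = c ^ DIM('a) * hvol u S"
    using measure_cylinder_compact[of u "(*\<^sub>R) c ` S" c] measure_cylinder_compact[of u S 1]
      measure_lborel_scaleR_image[OF compact_cylinder[OF S(2)], of c u 1] u S c
    by (simp add: compact_scaling)
  moreover have "c ^ DIM('a) = c * c ^ (DIM('a) - 1)"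
    by (metis DIM_positive power_eq_if less_irrefl)
  ultimately show ?thesis using c by simp
qed

section \<open>Slice volumes as a function of the height\<close>

lemma slice_subset: "slice u t K \<subseteq> orth_hyperplane u"
  by (auto simp: slice_def)

lemma slice_eq: "slice u t K = orth_hyperplane u \<inter> (\<lambda>x. x - t *\<^sub>R u) ` K"
  by (auto simp: slice_def image_iff) (metis add_diff_cancel_right')

lemma compact_slice: "compact K \<Longrightarrow> compact (slice u t K)"
  unfolding slice_eq by (intro closed_Int_compact compact_continuous_image continuous_intros) auto

lemma convex_slice: "convex K \<Longrightarrow> convex (slice u t K)"
  unfolding slice_eq
  by (intro convex_Int convex_translation_subtract subspace_imp_convex[OF subspace_orth_hyperplane])

lemma emeasure_slice:
  assumes "norm u = 1" "compact K"
  shows "emeasure (hyperplane_lborel u) (slice u t K) = ennreal (hvol u (slice u t K))"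
  using emeasure_subspace_lborel_bounded[OF assms(1) slice_subset, of t K] compact_slice[OF assms(2), of u t]
  by (intro emeasure_eq_ennreal_measure) (auto simp: borel_compact compact_imp_bounded)

lemma slice_plus_subset: "slice u s K + slice u t L \<subseteq> slice u (s + t) (K + L)"
proof
  fix z assume "z \<in> slice u s K + slice u t L"
  then obtain x y where xy: "x \<in> slice u s K" "y \<in> slice u t L" "z = x + y" by (auto simp: set_plus_def)
  have "(x + s *\<^sub>R u) + (y + t *\<^sub>R u) \<in> K + L"
    using xy by (intro set_plus_intro) (auto simp: slice_def)
  moreover have "z + (s + t) *\<^sub>R u = (x + s *\<^sub>R u) + (y + t *\<^sub>R u)"
    using xy by (simp add: algebra_simps)
  ultimately have "z + (s + t) *\<^sub>R u \<in> K + L" by (simp only:)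
  then show "z \<in> slice u (s + t) (K + L)"
    using xy by (auto simp: slice_def orth_hyperplane_def inner_add_right)
qed

lemma hvol_mono:
  assumes "norm u = 1" "S \<subseteq> T" "T \<subseteq> orth_hyperplane u" "compact S" "compact T"
  shows "hvol u S \<le> hvol u T"
proof -
  have "emeasure (hyperplane_lborel u) T < \<infinity>"
    using assms by (intro emeasure_subspace_lborel_bounded) (auto intro: borel_compact compact_imp_bounded)
  then show ?thesis
    using assms by (intro measure_mono_fmeasurable) (auto simp: fmeasurable_def borel_compact)
qed

text \<open>The interior is used so that, for a convex body, the heights form an open interval on
  which slices have positive volume. At the two end heights the slice volume may vanish or
  jump.\<close>

definition shadow :: "'a::euclidean_space \<Rightarrow> 'a set \<Rightarrow> real set"
  where "shadow u K = (\<lambda>x. u \<bullet> x) ` interior K"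

lemma open_shadow:
  fixes u :: "'a::euclidean_space"
  assumes "norm u = 1" shows "open (shadow u K)"
proof -
  have "\<exists>e>0. ball (u \<bullet> x) e \<subseteq> shadow u K" if x: "x \<in> interior K" for x
  proof -
    obtain e where e: "e > 0" "ball x e \<subseteq> interior K"
      using x open_contains_ball[of "interior K"] by auto
    have "t \<in> shadow u K" if "t \<in> ball (u \<bullet> x) e" for t
    proof -
      have "x + (t - u \<bullet> x) *\<^sub>R u \<in> ball x e"
        using that assms by (simp add: dist_norm abs_minus_commute)
      moreover have "u \<bullet> (x + (t - u \<bullet> x) *\<^sub>R u) = t"
        using norm_one_inner[OF assms] by (simp add: inner_add_right)
      ultimately show ?thesis using e unfolding shadow_def by (metis imageI subsetD)
    qed
    then show ?thesis using e(1) by blast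
  qed
  then show ?thesis unfolding open_contains_ball shadow_def by blast
qed

lemma convex_shadow: "convex K \<Longrightarrow> convex (shadow u K)"
  unfolding shadow_def
  by (intro convex_linear_image convex_interior) (auto intro!: linearI simp: inner_add_right)

lemma shadow_nonempty: "convex_body K \<Longrightarrow> shadow u K \<noteq> {}"
  by (simp add: shadow_def convex_body_def)

lemma shadow_plus: "s \<in> shadow u K \<Longrightarrow> t \<in> shadow u L \<Longrightarrow> s + t \<in> shadow u (K + L)"
  unfolding shadow_def
proof (elim imageE)
  fix x y assume xy: "s = u \<bullet> x" "x \<in> interior K" "t = u \<bullet> y" "y \<in> interior L"
  then have "x + y \<in> interior (K + L)"
    using set_plus_intro[OF xy(2,4)] interior_set_plus_subset by blast
  then show "s + t \<in> (\<lambda>x. u \<bullet> x) ` interior (K + L)"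
    using xy by (intro image_eqI[of _ _ "x + y"]) (auto simp: inner_add_right)
qed

lemma inner_image_subset_closure_shadow:
  assumes "convex_body K" shows "(\<lambda>x. u \<bullet> x) ` K \<subseteq> closure (shadow u K)"
proof -
  have "closure (interior K) = K"
    using assms by (simp add: convex_body_def convex_closure_interior closure_closed compact_imp_closed)
  then show ?thesis
    unfolding shadow_def
    using closure_bounded_linear_image_subset[OF bounded_linear_inner_right, of u "interior K"] by simp
qed

text \<open>A convex body is the closure of its interior, so the open interval of heights has the
  same supremum. Translations of shadows thereby become statements about support functions.\<close>

lemma support_function_shadow:
  assumes "convex_body K" shows "support_function K u = Sup (shadow u K)"
proof -
  have ne: "shadow u K \<noteq> {}" and K: "K \<noteq> {}" using assms interior_subset by (auto simp: shadow_def convex_body_def)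
  have bd: "bounded ((\<lambda>x. u \<bullet> x) ` K)"
    using bounded_linear_image[OF convex_body_props(2)[OF assms] bounded_linear_inner_right] .
  then have bda: "bdd_above ((\<lambda>x. u \<bullet> x) ` K)" by (rule bounded_imp_bdd_above)
  have sub: "shadow u K \<subseteq> (\<lambda>x. u \<bullet> x) ` K" unfolding shadow_def using interior_subset by blast
  show ?thesis unfolding support_function_def
  proof (rule antisym)
    have bds: "bdd_above (shadow u K)" by (rule bdd_above_mono[OF bda sub])
    show "(SUP x\<in>K. u \<bullet> x) \<le> Sup (shadow u K)"
    proof (rule cSUP_least)
      fix x assume "x \<in> K"
      then have "u \<bullet> x \<in> closure (shadow u K)" using inner_image_subset_closure_shadow[OF assms] by blast
      moreover have "closure (shadow u K) \<subseteq> {..Sup (shadow u K)}"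
        using bds by (intro closure_minimal) (auto intro: cSup_upper)
      ultimately show "u \<bullet> x \<le> Sup (shadow u K)" by auto
    qed (use K in auto)
    show "Sup (shadow u K) \<le> (SUP x\<in>K. u \<bullet> x)"
      using ne bda sub by (rule cSup_subset_mono)
  qed
qed

lemma hvol_slice_pos:
  fixes K :: "'a::euclidean_space set"
  assumes u: "norm u = 1" and K: "compact K" and t: "t \<in> shadow u K"
  shows "hvol u (slice u t K) > 0"
proof -
  note uu = norm_one_inner[OF u]
  obtain p where p: "p \<in> interior K" "u \<bullet> p = t" using t by (auto simp: shadow_def)
  obtain e where e: "e > 0" "ball p e \<subseteq> K" using p(1) mem_interior by blast
  \<comment> \<open>The centre \<open>?c\<close> sits at half the height of the cylinder, so radius
    at most 1/2 keeps the ball between the two ends, and radius at most e keeps its projection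
    inside the slice, as projecting does not increase the norm.\<close>
  define d where "d = min e (1/2)"
  let ?c = "p - t *\<^sub>R u + (1/2) *\<^sub>R u"
  have "ball ?c d \<subseteq> cylinder u 1 (slice u t K)"
  proof
    fix z assume "z \<in> ball ?c d"
    define w where "w = z - ?c"
    have w: "norm w < d" using \<open>z \<in> ball ?c d\<close> by (simp add: w_def dist_norm norm_minus_commute)
    have uw: "\<bar>u \<bullet> w\<bar> \<le> norm w" using Cauchy_Schwarz_ineq2[of u w] u by simp
    have z: "z = ?c + w" by (simp add: w_def)
    have uz: "u \<bullet> z = 1/2 + u \<bullet> w" unfolding z using p(2) uu by (simp add: inner_add_right inner_diff_right)
    have "norm (w - (u \<bullet> w) *\<^sub>R u) \<le> norm w"
    proof -
      have "(norm (w - (u \<bullet> w) *\<^sub>R u))\<^sup>2 = (norm w)\<^sup>2 - (u \<bullet> w)\<^sup>2"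
        unfolding power2_norm_eq_inner by (simp add: algebra_simps inner_commute uu power2_eq_square)
      then have "(norm (w - (u \<bullet> w) *\<^sub>R u))\<^sup>2 \<le> (norm w)\<^sup>2" by simp
      then show ?thesis by (rule power2_le_imp_le) simp
    qed
    then have "p + (w - (u \<bullet> w) *\<^sub>R u) \<in> ball p e" using w by (simp only: mem_ball dist_norm d_def) (simp add: norm_minus_commute)
    then have in_K: "p + (w - (u \<bullet> w) *\<^sub>R u) \<in> K" using e by blast
    have proj: "z - (u \<bullet> z) *\<^sub>R u = (p + (w - (u \<bullet> w) *\<^sub>R u)) - t *\<^sub>R u"
      unfolding uz by (simp add: z algebra_simps)
    have "z - (u \<bullet> z) *\<^sub>R u \<in> slice u t K"
      unfolding slice_def mem_Collect_eq
    proof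
      show "z - (u \<bullet> z) *\<^sub>R u \<in> orth_hyperplane u"
        by (simp add: orth_hyperplane_def inner_diff_right uu)
      show "z - (u \<bullet> z) *\<^sub>R u + t *\<^sub>R u \<in> K" unfolding proj using in_K by simp
    qed
    moreover have "u \<bullet> z \<in> {0..1}" using uz uw w by (auto simp: d_def abs_le_iff)
    ultimately show "z \<in> cylinder u 1 (slice u t K)"
      unfolding cylinder_conv[OF u slice_subset] by simp
  qed
  then have "ball ?c d \<subseteq> interior (cylinder u 1 (slice u t K))" by (simp add: interior_maximal)
  moreover have "?c \<in> ball ?c d" using e by (simp add: d_def)
  ultimately have ne: "interior (cylinder u 1 (slice u t K)) \<noteq> {}" by blast
  have c: "compact (cylinder u 1 (slice u t K))"
    by (intro compact_cylinder compact_slice K)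
  have "0 < volume (interior (cylinder u 1 (slice u t K)))"
    using ne c by (intro measure_pos_open) (auto simp: compact_imp_bounded bounded_interior)
  also have "\<dots> \<le> volume (cylinder u 1 (slice u t K))"
    using c by (intro volume_mono interior_subset) (auto intro: borel_compact compact_imp_bounded)
  also have "\<dots> = hvol u (slice u t K)"
    using u by (simp add: measure_cylinder_compact slice_subset compact_slice[OF K])
  finally show ?thesis .
qed

lemma brunn_minkowski_slices:
  fixes K L :: "'a::euclidean_space set"
  assumes n: "DIM('a) \<ge> 2" and u: "norm u = 1" and KL: "convex_body K" "convex_body L"
    and s: "s \<in> shadow u K" and t: "t \<in> shadow u L"
  shows "(hvol u (slice u s K) powr (1 / real (DIM('a) - 1)) + hvol u (slice u t L) powr (1 / real (DIM('a) - 1))) ^ (DIM('a) - 1)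
    \<le> hvol u (slice u (s + t) (K + L))"
proof -
  have c: "compact K" "compact L" "convex K" "convex L" using KL by (auto simp: convex_body_def)
  have "(hvol u (slice u s K) powr (1 / real (DIM('a) - 1)) + hvol u (slice u t L) powr (1 / real (DIM('a) - 1))) ^ (DIM('a) - 1)
    \<le> hvol u (slice u s K + slice u t L)"
    using c s t u
    by (intro brunn_minkowski_hyperplane[OF n u] slice_subset compact_slice convex_slice hvol_slice_pos)
  also have "\<dots> \<le> hvol u (slice u (s + t) (K + L))"
    using c by (intro hvol_mono[OF u slice_plus_subset slice_subset] compact_plus compact_slice)
  finally show ?thesis .
qed

lemma convex_scaleR_plus:
  fixes K :: "'a::real_vector set"
  assumes "convex K" "a \<ge> 0" "b \<ge> 0"
  shows "(*\<^sub>R) a ` K + (*\<^sub>R) b ` K = (*\<^sub>R) (a + b) ` K"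
proof
  show "(*\<^sub>R) (a + b) ` K \<subseteq> (*\<^sub>R) a ` K + (*\<^sub>R) b ` K"
    by (auto simp: scaleR_add_left intro!: set_plus_intro)
  show "(*\<^sub>R) a ` K + (*\<^sub>R) b ` K \<subseteq> (*\<^sub>R) (a + b) ` K"
  proof (cases "a + b = 0")
    case True
    then have "a = 0" "b = 0" using assms by auto
    then show ?thesis by (auto elim!: set_plus_elim intro!: image_eqI)
  next
    case False
    then have pos: "a + b > 0" using assms by simp
    show ?thesis
    proof
      fix z assume "z \<in> (*\<^sub>R) a ` K + (*\<^sub>R) b ` K"
      then obtain x y where xy: "x \<in> K" "y \<in> K" "z = a *\<^sub>R x + b *\<^sub>R y" by (auto elim!: set_plus_elim)
      have "(a / (a + b)) *\<^sub>R x + (b / (a + b)) *\<^sub>R y \<in> K"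
        using assms xy pos by (intro convexD) (auto simp: add_divide_distrib[symmetric])
      moreover have "z = (a + b) *\<^sub>R ((a / (a + b)) *\<^sub>R x + (b / (a + b)) *\<^sub>R y)"
        using pos xy(3) by (simp add: scaleR_add_right)
      ultimately show "z \<in> (*\<^sub>R) (a + b) ` K" by blast
    qed
  qed
qed

text \<open>Brunn's theorem: by the hyperplane inequality the \<open>(n - 1)\<close>-st root of the slice
  volume is concave, hence slices vary continuously.\<close>

lemma continuous_on_hvol_slice:
  fixes K :: "'a::euclidean_space set"
  assumes n: "DIM('a) \<ge> 2" and u: "norm u = 1" and K: "convex_body K"
  shows "continuous_on (shadow u K) (\<lambda>t. hvol u (slice u t K))"
proof -
  define m where "m = DIM('a) - 1"
  have m: "m > 0" using n by (simp add: m_def)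
  let ?r = "\<lambda>t. hvol u (slice u t K) powr (1 / real m)"
  have c: "compact K" "convex K" using K by (auto simp: convex_body_def)
  have "convex_on (shadow u K) (\<lambda>t. - ?r t)"
  proof (rule convex_onI)
    fix l s t :: real assume l: "0 < l" "l < 1" and st: "s \<in> shadow u K" "t \<in> shadow u K"
    let ?S = "(*\<^sub>R) (1 - l) ` slice u s K" and ?T = "(*\<^sub>R) l ` slice u t K"
    have sub: "?S \<subseteq> orth_hyperplane u" "?T \<subseteq> orth_hyperplane u" by (auto simp: slice_def orth_hyperplane_def)
    have vol: "hvol u ?S = (1 - l) ^ m * hvol u (slice u s K)" "hvol u ?T = l ^ m * hvol u (slice u t K)"
      unfolding m_def
      by (rule hvol_scaleR_image[OF u slice_subset compact_slice[OF c(1)]]; use l in simp)+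
    have pos: "hvol u (slice u s K) > 0" "hvol u (slice u t K) > 0"
      using hvol_slice_pos[OF u c(1)] st by auto
    have root: "(x ^ m) powr (1 / real m) = x" if "x > 0" for x :: real
      using that m by (simp add: powr_realpow[symmetric] powr_powr)
    have "((1 - l) * ?r s + l * ?r t) ^ m = (hvol u ?S powr (1 / real m) + hvol u ?T powr (1 / real m)) ^ m"
      unfolding vol using l by (simp add: powr_mult root)
    also have "\<dots> \<le> hvol u (?S + ?T)"
      using vol pos l
      unfolding m_def
      by (intro brunn_minkowski_hyperplane[OF n u] sub compact_scaling convex_scaling compact_slice convex_slice c) auto
    also have "\<dots> \<le> hvol u (slice u ((1 - l) * s + l * t) K)"
    proof (rule hvol_mono[OF u _ slice_subset])
      show "?S + ?T \<subseteq> slice u ((1 - l) * s + l * t) K"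
      proof
        fix z assume "z \<in> ?S + ?T"
        then obtain x y where xy: "x \<in> slice u s K" "y \<in> slice u t K" "z = (1 - l) *\<^sub>R x + l *\<^sub>R y"
          by (auto elim!: set_plus_elim)
        have "(1 - l) *\<^sub>R (x + s *\<^sub>R u) + l *\<^sub>R (y + t *\<^sub>R u) \<in> K"
          using xy l by (intro convexD[OF c(2)]) (auto simp: slice_def)
        moreover have "(1 - l) *\<^sub>R (x + s *\<^sub>R u) + l *\<^sub>R (y + t *\<^sub>R u) = z + ((1 - l) * s + l * t) *\<^sub>R u"
          unfolding xy(3) by (simp only: scaleR_add_right scaleR_add_left scaleR_scaleR ac_simps)
        ultimately have "z + ((1 - l) * s + l * t) *\<^sub>R u \<in> K" by (simp only:)
        then show "z \<in> slice u ((1 - l) * s + l * t) K"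
          using xy by (simp add: slice_def orth_hyperplane_def inner_add_right)
      qed
    qed (auto intro!: compact_plus compact_scaling compact_slice c)
    finally have "(((1 - l) * ?r s + l * ?r t) ^ m) powr (1 / real m) \<le> ?r ((1 - l) * s + l * t)"
      using l by (intro powr_mono2) auto
    moreover have "(1 - l) * ?r s + l * ?r t > 0" using l pos by (intro add_pos_pos mult_pos_pos) auto
    ultimately have "(1 - l) * ?r s + l * ?r t \<le> ?r ((1 - l) * s + l * t)" by (simp only: root)
    then show "- ?r ((1 - l) *\<^sub>R s + l *\<^sub>R t) \<le> (1 - l) * - ?r s + l * - ?r t" by simp
  qed (rule convex_shadow[OF c(2)])
  then have "continuous_on (shadow u K) (\<lambda>t. - ?r t)"
    by (rule convex_on_continuous[OF open_shadow[OF u]])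
  then have "continuous_on (shadow u K) (\<lambda>t. (- (- ?r t)) ^ m)"
    by (rule continuous_on_power[OF continuous_on_minus])
  moreover have "(- (- ?r t)) ^ m = hvol u (slice u t K)" for t
    using m by (simp add: powr_inverse_power)
  ultimately show ?thesis by simp
qed

text \<open>The slab between the two heights is the integral of its slice volumes. With both bounds
  close to the slice volume at one end, this is the difference quotient estimate for the derivative
  of the cut volume.\<close>

lemma measure_halfspace_slab_bounds:
  fixes K :: "'a::euclidean_space set"
  assumes u: "norm u = 1" and K: "compact K" and st: "s \<le> t"
    and bd: "\<And>r. r \<in> {s..t} \<Longrightarrow> c \<le> hvol u (slice u r K) \<and> hvol u (slice u r K) \<le> C" and c: "0 \<le> c"
  shows "c * (t - s) \<le> cut_volume u K t - cut_volume u K s"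
    and "cut_volume u K t - cut_volume u K s \<le> C * (t - s)"
proof -
  let ?m = "hyperplane_lborel u"
  let ?S = "K \<inter> {x. u \<bullet> x \<le> t} \<inter> {x. u \<bullet> x > s}"
  have bK: "K \<in> sets borel" "bounded K" using K by (auto simp: borel_compact compact_imp_bounded)
  have bS: "?S \<in> sets borel" "bounded ?S" using bK by (auto intro: bounded_subset)
  have bT: "K \<inter> {x. u \<bullet> x \<le> t} \<in> sets borel" "bounded (K \<inter> {x. u \<bullet> x \<le> t})"
    using bK by (auto intro: bounded_subset)
  have "K \<inter> {x. u \<bullet> x \<le> t} \<inter> {x. u \<bullet> x \<le> s} = K \<inter> {x. u \<bullet> x \<le> s}" using st by auto
  then have diff: "cut_volume u K t - cut_volume u K s = volume ?S"
    using measure_halfspace_split[OF u bT, of s] by simp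
  have sl: "slice u r ?S = (if r \<in> {s<..t} then slice u r K else {})" for r
    using norm_one_inner[OF u] by (auto simp: slice_def orth_hyperplane_def inner_add_right)
  have eS: "emeasure lborel ?S = (\<integral>\<^sup>+r. ennreal (hvol u (slice u r K)) * indicator {s<..t} r \<partial>lborel)"
    unfolding emeasure_lborel_slices[OF u bS(1)] by (intro nn_integral_cong) (auto simp: sl emeasure_slice[OF u K])
  have fin: "emeasure lborel ?S = ennreal (volume ?S)"
    using emeasure_bounded_finite[OF bS(2)] by (intro emeasure_eq_ennreal_measure) auto
  have "ennreal (c * (t - s)) = (\<integral>\<^sup>+r. ennreal c * indicator {s<..t} r \<partial>lborel)"
    using st c by (subst nn_integral_cmult_indicator) (auto simp: ennreal_mult)
  also have "\<dots> \<le> emeasure lborel ?S"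
    unfolding eS using bd by (intro nn_integral_mono) (auto simp: indicator_def intro!: ennreal_leI)
  finally show "c * (t - s) \<le> cut_volume u K t - cut_volume u K s"
    unfolding diff fin by simp
  have C: "0 \<le> C" using bd[of s] st c by simp
  have "emeasure lborel ?S \<le> (\<integral>\<^sup>+r. ennreal C * indicator {s<..t} r \<partial>lborel)"
    unfolding eS using bd by (intro nn_integral_mono) (auto simp: indicator_def intro!: ennreal_leI)
  also have "\<dots> = ennreal (C * (t - s))"
    using st C by (subst nn_integral_cmult_indicator) (auto simp: ennreal_mult)
  finally show "cut_volume u K t - cut_volume u K s \<le> C * (t - s)"
    unfolding diff fin using C st by (simp add: ennreal_le_iff)
qed

lemma DERIV_measure_halfspace:
  fixes K :: "'a::euclidean_space set"
  assumes n: "DIM('a) \<ge> 2" and u: "norm u = 1" and K: "convex_body K" and t: "t \<in> shadow u K"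
  shows "((\<lambda>t. cut_volume u K t) has_real_derivative hvol u (slice u t K)) (at t)"
proof -
  let ?f = "\<lambda>t. hvol u (slice u t K)" and ?F = "\<lambda>t. cut_volume u K t"
  have cK: "compact K" using K by (simp add: convex_body_def)
  have "isCont ?f t"
    using continuous_on_hvol_slice[OF n u K] open_shadow[OF u] t by (simp add: continuous_on_eq_continuous_at)
  then have lim: "(?f \<longlongrightarrow> ?f t) (at t)" by (simp add: isCont_def)
  have pos: "?f t > 0" by (rule hvol_slice_pos[OF u cK t])
  have "\<exists>d>0. \<forall>h. h \<noteq> 0 \<and> \<bar>h\<bar> < d \<longrightarrow> \<bar>(?F (t + h) - ?F t) / h - ?f t\<bar> < e" if "e > 0" for e
  proof -
    \<comment> \<open>The cap \<open>?f t\<close> keeps the lower bound \<open>?f t - e'\<close>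
      nonnegative, as the slab estimate requires; halving e gives the strict inequality at the
      end.\<close>
    define e' where "e' = min (e / 2) (?f t)"
    have e': "e' > 0" "e' \<le> ?f t" "e' < e" using that pos by (auto simp: e'_def)
    obtain d where d: "d > 0" "\<And>r. r \<noteq> t \<Longrightarrow> \<bar>r - t\<bar> < d \<Longrightarrow> \<bar>?f r - ?f t\<bar> < e'"
      using LIM_D[OF lim e'(1)] by auto
    have bd: "?f t - e' \<le> ?f r \<and> ?f r \<le> ?f t + e'" if "\<bar>r - t\<bar> < d" for r
      using d(2)[of r] that e'(1) by (cases "r = t") (auto simp: abs_less_iff)
    show ?thesis
    proof (intro exI[of _ d] conjI allI impI d(1))
      fix h assume h: "h \<noteq> 0 \<and> \<bar>h\<bar> < d"
      have "\<bar>(?F (t + h) - ?F t) / h - ?f t\<bar> \<le> e'"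
      proof (cases "h > 0")
        case True
        have "(?f t - e') * (t + h - t) \<le> ?F (t + h) - ?F t \<and> ?F (t + h) - ?F t \<le> (?f t + e') * (t + h - t)"
          using measure_halfspace_slab_bounds[OF u cK, of t "t + h" "?f t - e'" "?f t + e'"] bd True h e'(2) by auto
        then have "?f t - e' \<le> (?F (t + h) - ?F t) / h" "(?F (t + h) - ?F t) / h \<le> ?f t + e'"
          using True by (simp_all add: pos_le_divide_eq pos_divide_le_eq)
        then show ?thesis by (simp add: abs_le_iff)
      next
        case False
        then have h': "h < 0" using h by simp
        have "(?f t - e') * (t - (t + h)) \<le> ?F t - ?F (t + h) \<and> ?F t - ?F (t + h) \<le> (?f t + e') * (t - (t + h))"
          using measure_halfspace_slab_bounds[OF u cK, of "t + h" t "?f t - e'" "?f t + e'"] bd h' h e'(2) by auto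
        then have "?f t - e' \<le> (?F (t + h) - ?F t) / h" "(?F (t + h) - ?F t) / h \<le> ?f t + e'"
          by (subst neg_le_divide_eq[OF h'] neg_divide_le_eq[OF h'], simp add: algebra_simps)+
        then show ?thesis by (simp add: abs_le_iff)
      qed
      then show "\<bar>(?F (t + h) - ?F t) / h - ?f t\<bar> < e" using e'(3) by simp
    qed
  qed
  then show ?thesis unfolding DERIV_def LIM_eq by auto
qed

section \<open>Equality in the Brunn--Minkowski inequality\<close>

lemma convex_body_halfspaces:
  fixes K :: "'a::euclidean_space set"
  assumes u: "norm u = 1" and K: "convex_body K" and s: "0 < cut_volume u K t" "cut_volume u K t < volume K"
  shows "convex_body (K \<inter> {x. u \<bullet> x \<le> t})" "convex_body (K \<inter> {x. u \<bullet> x \<ge> t})"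
    and "volume (K \<inter> {x. u \<bullet> x \<ge> t}) \<ge> volume K - cut_volume u K t"
proof -
  note cK = convex_bodyD[OF K]
  have c: "compact (K \<inter> {x. u \<bullet> x \<le> t})" "convex (K \<inter> {x. u \<bullet> x \<le> t})"
    "compact (K \<inter> {x. u \<bullet> x \<ge> t})" "convex (K \<inter> {x. u \<bullet> x \<ge> t})"
    using cK by (auto intro!: compact_Int_closed closed_halfspace_le closed_halfspace_ge convex_Int
        convex_halfspace_le convex_halfspace_ge)
  show "convex_body (K \<inter> {x. u \<bullet> x \<le> t})"
    using c s by (intro convex_body_if_measure_pos)
  have "volume (K \<inter> {x. u \<bullet> x > t}) \<le> volume (K \<inter> {x. u \<bullet> x \<ge> t})"
    using c(3) convex_body_props(3)[OF K]
    by (intro volume_mono) (auto intro: borel_compact compact_imp_bounded)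
  then show 1: "volume (K \<inter> {x. u \<bullet> x \<ge> t}) \<ge> volume K - cut_volume u K t"
    using measure_halfspace_split[OF u convex_body_props(3)[OF K] convex_body_props(2)[OF K], of t] by simp
  show "convex_body (K \<inter> {x. u \<bullet> x \<ge> t})"
    using c s 1 by (intro convex_body_if_measure_pos) auto
qed

text \<open>Both halves of the body have interior points, one at height at most t and one at height
  at least t, and the shadow is an interval.\<close>

lemma mem_shadow_if_cut_volume:
  fixes K :: "'a::euclidean_space set"
  assumes u: "norm u = 1" and K: "convex_body K" and s: "0 < cut_volume u K t" "cut_volume u K t < volume K"
  shows "t \<in> shadow u K"
proof -
  have "u \<noteq> 0" using u by auto
  obtain x y where "x \<in> interior (K \<inter> {x. u \<bullet> x \<le> t})" "y \<in> interior (K \<inter> {x. u \<bullet> x \<ge> t})"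
    using convex_body_halfspaces(1,2)[OF assms] by (auto simp: convex_body_def simp del: interior_Int)
  then have xy: "x \<in> interior K" "u \<bullet> x \<le> t" "y \<in> interior K" "t \<le> u \<bullet> y"
    using \<open>u \<noteq> 0\<close> by (auto simp: interior_halfspace_le interior_halfspace_ge)
  then have "u \<bullet> x \<in> shadow u K" "u \<bullet> y \<in> shadow u K" by (auto simp: shadow_def)
  moreover have "is_interval (shadow u K)"
    using convex_shadow[of K u] K by (simp add: is_interval_convex_1 convex_body_def)
  ultimately show ?thesis using xy(2,4) by (metis mem_is_interval_1_I)
qed

lemma cut_volume_strict_mono:
  fixes K :: "'a::euclidean_space set"
  assumes n: "DIM('a) \<ge> 2" and u: "norm u = 1" and K: "convex_body K"
    and st: "s \<in> shadow u K" "t \<in> shadow u K" "s < t"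
  shows "cut_volume u K s < cut_volume u K t"
proof (rule DERIV_pos_imp_increasing[OF st(3)])
  fix r assume r: "s \<le> r" "r \<le> t"
  have "is_interval (shadow u K)"
    using convex_shadow[of K u] K by (simp add: is_interval_convex_1 convex_body_def)
  then have "r \<in> shadow u K" using st r by (metis mem_is_interval_1_I)
  then show "\<exists>y. (cut_volume u K has_real_derivative y) (at r) \<and> 0 < y"
    using DERIV_measure_halfspace[OF n u K] hvol_slice_pos[OF u] K by (auto simp: convex_body_def)
qed

lemma cut_volume_bounds:
  fixes K :: "'a::euclidean_space set"
  assumes n: "DIM('a) \<ge> 2" and u: "norm u = 1" and K: "convex_body K" and t: "t \<in> shadow u K"
  shows "0 < cut_volume u K t" "cut_volume u K t < volume K"
proof -
  obtain e where e: "e > 0" "cball t e \<subseteq> shadow u K"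
    using open_shadow[OF u] t open_contains_cball by blast
  then have m: "t - e \<in> shadow u K" "t + e \<in> shadow u K" by (auto simp: subset_iff dist_norm)
  have "0 \<le> cut_volume u K (t - e)" by simp
  also have "\<dots> < cut_volume u K t" using m t e by (intro cut_volume_strict_mono[OF n u K]) auto
  finally show "0 < cut_volume u K t" .
  have "cut_volume u K t < cut_volume u K (t + e)" using m t e by (intro cut_volume_strict_mono[OF n u K]) auto
  also have "\<dots> \<le> volume K"
    using convex_body_props[OF K] by (intro volume_mono) auto
  finally show "cut_volume u K t < volume K" .
qed

text \<open>The inverse of the distribution function of the height. It is meaningful for 0 < s <
  \<open>volume K\<close>, where such a height exists and is unique.\<close>

definition quantile :: "'a::euclidean_space \<Rightarrow> 'a set \<Rightarrow> real \<Rightarrow> real"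
  where "quantile u K s = (THE t. t \<in> shadow u K \<and> cut_volume u K t = s)"

lemma quantile_cut_volume:
  fixes K :: "'a::euclidean_space set"
  assumes n: "DIM('a) \<ge> 2" and u: "norm u = 1" and K: "convex_body K" and t: "t \<in> shadow u K"
  shows "quantile u K (cut_volume u K t) = t"
  unfolding quantile_def
proof (rule the_equality)
  fix r assume "r \<in> shadow u K \<and> cut_volume u K r = cut_volume u K t"
  then show "r = t"
    using cut_volume_strict_mono[OF n u K] t by (metis less_irrefl linorder_neqE_linordered_idom)
qed (use t in simp)

lemma quantile:
  fixes K :: "'a::euclidean_space set"
  assumes n: "DIM('a) \<ge> 2" and u: "norm u = 1" and K: "convex_body K" and s: "0 < s" "s < volume K"
  shows "quantile u K s \<in> shadow u K" "cut_volume u K (quantile u K s) = s"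
proof -
  obtain t where t: "cut_volume u K t = s"
    using obtain_halfspace_fraction[OF u convex_body_props(3)[OF K] convex_body_props(2)[OF K], of s] s by auto
  then have "t \<in> shadow u K" using mem_shadow_if_cut_volume[OF u K] s by simp
  then show "quantile u K s \<in> shadow u K" "cut_volume u K (quantile u K s) = s"
    using quantile_cut_volume[OF n u K] t by auto
qed

lemma DERIV_quantile:
  fixes K :: "'a::euclidean_space set"
  assumes n: "DIM('a) \<ge> 2" and u: "norm u = 1" and K: "convex_body K" and s: "0 < s" "s < volume K"
  shows "(quantile u K has_real_derivative inverse (hvol u (slice u (quantile u K s) K))) (at s)"
proof (rule DERIV_inverse_function[where a = 0 and b = "volume K"])
  let ?t = "quantile u K s"
  note q = quantile[OF n u K s]
  show "(cut_volume u K has_real_derivative hvol u (slice u ?t K)) (at ?t)"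
    by (rule DERIV_measure_halfspace[OF n u K q(1)])
  show "hvol u (slice u ?t K) \<noteq> 0" using hvol_slice_pos[OF u _ q(1)] K by (auto simp: convex_body_def)
  show "0 < s" "s < volume K" by (fact s)+
  show "cut_volume u K (quantile u K y) = y" if "0 < y" "y < volume K" for y
    using quantile[OF n u K that] by simp
  obtain e where e: "e > 0" "cball ?t e \<subseteq> shadow u K"
    using open_shadow[OF u] q(1) open_contains_cball by blast
  have sub: "z \<in> shadow u K" if "?t - e \<le> z" "z \<le> ?t + e" for z
    using e that by (auto simp: subset_iff dist_norm abs_le_iff)
  have "isCont (quantile u K) (cut_volume u K ?t)"
  proof (rule isCont_inverse_function2[where f = "cut_volume u K" and x = ?t and a = "?t - e" and b = "?t + e"])
    show "?t - e < ?t" "?t < ?t + e" using e by auto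
    fix z assume z: "?t - e \<le> z" "z \<le> ?t + e"
    show "quantile u K (cut_volume u K z) = z" using quantile_cut_volume[OF n u K sub[OF z]] .
    show "isCont (cut_volume u K) z" using DERIV_isCont[OF DERIV_measure_halfspace[OF n u K sub[OF z]]] .
  qed
  then show "isCont (quantile u K) s" by (simp add: q)
qed

text \<open>Here p, q, h are slice volumes of K, L and K + L. The power mean is at least the
  geometric one, so h \<ge> 2^m sqrt(pq). Inserting this into \<open>harm\<close> gives p + q \<le>
  2 sqrt(pq), the reverse of the arithmetic-geometric mean inequality.\<close>

lemma power_mean_harmonic_equality:
  fixes p q h :: real
  assumes pq: "p > 0" "q > 0" and m: "m > 0"
    and mean: "(p powr (1 / real m) + q powr (1 / real m)) ^ m \<le> h"
    and harm: "h * (inverse p + inverse q) = 2 ^ Suc m"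
  shows "p = q"
proof -
  define x y where "x = p powr (1 / real m)" and "y = q powr (1 / real m)"
  have xy: "x > 0" "y > 0" "x ^ m = p" "y ^ m = q"
    using pq m by (auto simp: x_def y_def powr_inverse_power)
  have "2 * sqrt (x * y) \<le> x + y"
    using arith_geo_mean_sqrt[of x y] xy by simp
  then have "(2 * sqrt (x * y)) ^ m \<le> (x + y) ^ m" using xy by (intro power_mono) auto
  moreover have "(2 * sqrt (x * y)) ^ m = 2 ^ m * sqrt (p * q)"
  proof -
    have "sqrt (x * y) ^ m = sqrt (p * q)"
      unfolding real_sqrt_power[symmetric] power_mult_distrib xy(3,4) ..
    then show ?thesis by (simp add: power_mult_distrib)
  qed
  ultimately have 1: "2 ^ m * sqrt (p * q) \<le> h" using mean by (simp add: x_def y_def)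
  have "2 ^ m * sqrt (p * q) * (inverse p + inverse q) \<le> 2 ^ Suc m"
    unfolding harm[symmetric] using pq by (intro mult_right_mono 1) auto
  then have "sqrt (p * q) * (inverse p + inverse q) \<le> 2" by simp
  moreover have "sqrt (p * q) * (inverse p + inverse q) = (p + q) / sqrt (p * q)"
  proof -
    have "inverse p + inverse q = (p + q) / (sqrt (p * q) * sqrt (p * q))"
      using pq by (simp add: field_simps)
    moreover have "r * ((p + q) / (r * r)) = (p + q) / r" for r :: real by simp
    ultimately show ?thesis by (simp only:)
  qed
  ultimately have "(p + q) / sqrt (p * q) \<le> 2" by simp
  then have "p + q \<le> 2 * sqrt (p * q)" using pq by (simp add: pos_divide_le_eq)
  moreover have "(sqrt p - sqrt q)\<^sup>2 = p + q - 2 * sqrt (p * q)"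
    using pq by (simp add: power2_diff real_sqrt_mult)
  ultimately have "(sqrt p - sqrt q)\<^sup>2 \<le> 0" by simp
  then show ?thesis using pq by simp
qed

text \<open>Brunn--Minkowski for the lower and for the upper halves gives at least 2^n s and 2^n (V
  - s), where V is the volume of K. The total 2^n V is all that K + L has, so neither bound has any
  slack.\<close>

lemma quantile_plus:
  fixes K L :: "'a::euclidean_space set"
  assumes n: "DIM('a) \<ge> 2" and u: "norm u = 1" and K: "convex_body K" and L: "convex_body L"
    and eq: "volume L = volume K" "volume (K + L) = 2 ^ DIM('a) * volume K"
    and s: "0 < s" "s < volume K"
  shows "cut_volume u (K + L) (quantile u K s + quantile u L s) = 2 ^ DIM('a) * s"
proof -
  let ?n = "DIM('a)"
  define a b where "a = quantile u K s" and "b = quantile u L s"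
  have ab: "cut_volume u K a = s" "cut_volume u L b = s"
    using quantile(2)[OF n u K s] quantile(2)[OF n u L] s eq by (auto simp: a_def b_def)
  note M = convex_body_plus[OF K L]
  have two: "(x powr (1 / real ?n) + x powr (1 / real ?n)) ^ ?n = 2 ^ ?n * x" if "x \<ge> 0" for x :: real
    using that by (simp add: mult_2[symmetric] power_mult_distrib powr_inverse_power)
  let ?Km = "K \<inter> {x. u \<bullet> x \<le> a}" and ?Lm = "L \<inter> {x. u \<bullet> x \<le> b}"
  let ?Kp = "K \<inter> {x. u \<bullet> x \<ge> a}" and ?Lp = "L \<inter> {x. u \<bullet> x \<ge> b}"
  have KK: "convex_body ?Km" "convex_body ?Kp" "volume ?Kp \<ge> volume K - s"
    using convex_body_halfspaces[OF u K, of a] s ab by auto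
  have LL: "convex_body ?Lm" "convex_body ?Lp" "volume ?Lp \<ge> volume K - s"
    using convex_body_halfspaces[OF u L, of b] s ab eq by auto
  have lo: "2 ^ ?n * s \<le> volume (?Km + ?Lm)"
    using brunn_minkowski[OF KK(1) LL(1)] s unfolding brunn_minkowski_pair_def ab by (simp only: two)
  have "2 ^ ?n * (volume K - s)
      = ((volume K - s) powr (1 / real ?n) + (volume K - s) powr (1 / real ?n)) ^ ?n"
    using s by (subst two) auto
  also have "\<dots> \<le> (volume ?Kp powr (1 / real ?n) + volume ?Lp powr (1 / real ?n)) ^ ?n"
    using s KK(3) LL(3) by (intro power_mono add_mono powr_mono2) auto
  also have "\<dots> \<le> volume (?Kp + ?Lp)"
    using brunn_minkowski[OF KK(2) LL(2)] unfolding brunn_minkowski_pair_def .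
  finally have hi: "2 ^ ?n * (volume K - s) \<le> volume (?Kp + ?Lp)" .
  have bKL: "?Km + ?Lm \<in> sets borel" "?Kp + ?Lp \<in> sets borel"
    using convex_body_props(3) convex_body_plus KK LL by blast+
  have sub: "?Km + ?Lm \<subseteq> (K + L) \<inter> {x. u \<bullet> x \<le> a + b}" "?Kp + ?Lp \<subseteq> (K + L) \<inter> {x. u \<bullet> x \<ge> a + b}"
    by (auto elim!: set_plus_elim intro!: set_plus_intro simp: inner_add_right)
  have fm: "(K + L) \<inter> {x. u \<bullet> x \<le> a + b} \<in> fmeasurable lborel"
    using convex_body_props(3)[OF M] convex_body_props(2)[OF M]
    by (intro fmeasurable_lborel_bounded) (auto intro: bounded_subset)
  have "volume (?Km + ?Lm) \<le> cut_volume u (K + L) (a + b)"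
    using bKL sub fm by (intro measure_mono_fmeasurable) auto
  moreover have "cut_volume u (K + L) (a + b) + volume (?Kp + ?Lp) \<le> volume (K + L)"
    by (rule measure_halfspace_superadditive[OF u convex_body_props(3)[OF M] convex_body_props(2)[OF M] _ _ bKL(2) sub(2)])
       (use fm in \<open>auto simp: fmeasurable_def\<close>)
  ultimately show ?thesis using lo hi eq(2) unfolding a_def[symmetric] b_def[symmetric]
    by (simp add: right_diff_distrib)
qed

text \<open>If equality holds, comparing the derivatives of the quantile functions of \<open>K\<close>, \<open>L\<close> and
  \<open>K + L\<close> forces a harmonic mean to be at least a power mean, so the slices of \<open>K\<close> and \<open>L\<close> at equal
  quantiles have equal volume and the quantile functions differ by a constant.\<close>

lemma brunn_minkowski_equality_slices:
  fixes K L :: "'a::euclidean_space set"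
  assumes n: "DIM('a) \<ge> 2" and u: "norm u = 1" and K: "convex_body K" and L: "convex_body L"
    and eq: "volume L = volume K" "volume (K + L) = 2 ^ DIM('a) * volume K"
  obtains c where "shadow u K = (+) c ` shadow u L"
    "\<And>t. t \<in> shadow u L \<Longrightarrow> hvol u (slice u (c + t) K) = hvol u (slice u t L)"
proof -
  let ?V = "volume K"
  let ?z = "quantile u K" and ?w = "quantile u L"
  have V: "?V > 0" by (rule convex_body_measure_pos[OF K])
  note M = convex_body_plus[OF K L]
  have same: "hvol u (slice u (?z s) K) = hvol u (slice u (?w s) L)" if s: "0 < s" "s < ?V" for s
  proof -
    let ?p = "hvol u (slice u (?z s) K)" and ?q = "hvol u (slice u (?w s) L)"
      and ?h = "hvol u (slice u (?z s + ?w s) (K + L))"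
    have s': "s < volume L" using s eq by simp
    have zw: "?z s \<in> shadow u K" "?w s \<in> shadow u L"
      using quantile(1)[OF n u K s] quantile(1)[OF n u L s(1) s'] by auto
    have pq: "?p > 0" "?q > 0"
      using hvol_slice_pos[OF u _ zw(1)] hvol_slice_pos[OF u _ zw(2)] K L by (auto simp: convex_body_def)
    have "((\<lambda>s. cut_volume u (K + L) (?z s + ?w s)) has_real_derivative ?h * (inverse ?p + inverse ?q)) (at s)"
      by (rule DERIV_chain'[OF DERIV_add[OF DERIV_quantile[OF n u K s] DERIV_quantile[OF n u L s(1) s']]
            DERIV_measure_halfspace[OF n u M shadow_plus[OF zw]]])
    \<comment> \<open>Near s the same function is linear with slope 2^n, and n = (n - 1) + 1 gives
      the constant \<open>2 ^ Suc m\<close> of \<open>power_mean_harmonic_equality\<close>.\<close>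
    moreover have "\<forall>\<^sub>F s in nhds s. cut_volume u (K + L) (?z s + ?w s) = 2 ^ DIM('a) * s"
    proof -
      have "\<forall>\<^sub>F s in nhds s. s \<in> {0<..<?V}" using s by (intro eventually_nhds_in_open) auto
      then show ?thesis by eventually_elim (use quantile_plus[OF n u K L eq] in auto)
    qed
    ultimately have "((\<lambda>s. 2 ^ DIM('a) * s) has_real_derivative ?h * (inverse ?p + inverse ?q)) (at s)"
      by (subst (asm) DERIV_cong_ev[OF refl _ refl]) auto
    moreover have "((\<lambda>s. 2 ^ DIM('a) * s) has_real_derivative 2 ^ DIM('a)) (at s)"
      by (auto intro!: derivative_eq_intros)
    ultimately have "?h * (inverse ?p + inverse ?q) = 2 ^ DIM('a)" by (rule DERIV_unique)
    then have "?h * (inverse ?p + inverse ?q) = 2 ^ Suc (DIM('a) - 1)" using n by simp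
    then show ?thesis
      using n by (intro power_mean_harmonic_equality[OF pq _ brunn_minkowski_slices[OF n u K L zw]]) auto
  qed
  have const: "?z s - ?w s = ?z t - ?w t" if "s \<in> {0<..<?V}" "t \<in> {0<..<?V}" for s t
  proof (rule DERIV_isconst3[OF V that])
    fix r assume r: "r \<in> {0<..<?V}"
    have "((\<lambda>r. ?z r - ?w r) has_real_derivative
       inverse (hvol u (slice u (?z r) K)) - inverse (hvol u (slice u (?w r) L))) (at r)"
      using r eq by (intro DERIV_diff DERIV_quantile n u K L) auto
    then show "((\<lambda>r. ?z r - ?w r) has_real_derivative 0) (at r)" using same[of r] r by simp
  qed
  define c where "c = ?z (?V / 2) - ?w (?V / 2)"
  have c: "?z s = c + ?w s" if "0 < s" "s < ?V" for s
    using const[of s "?V / 2"] that V by (simp add: c_def)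
  have zK: "shadow u K = ?z ` {0<..<?V}"
  proof
    show "?z ` {0<..<?V} \<subseteq> shadow u K" using quantile(1)[OF n u K] by auto
    show "shadow u K \<subseteq> ?z ` {0<..<?V}"
    proof
      fix t assume t: "t \<in> shadow u K"
      show "t \<in> ?z ` {0<..<?V}"
        using quantile_cut_volume[OF n u K t] cut_volume_bounds[OF n u K t]
        by (intro image_eqI[of _ _ "cut_volume u K t"]) auto
    qed
  qed
  have wL: "\<exists>s. 0 < s \<and> s < ?V \<and> t = ?w s" if t: "t \<in> shadow u L" for t
    using quantile_cut_volume[OF n u L t] cut_volume_bounds[OF n u L t] eq
    by (intro exI[of _ "cut_volume u L t"]) auto
  show thesis
  proof
    show "shadow u K = (+) c ` shadow u L"
    proof
      show "shadow u K \<subseteq> (+) c ` shadow u L"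
        unfolding zK using c quantile(1)[OF n u L] eq by auto
      show "(+) c ` shadow u L \<subseteq> shadow u K"
        using wL c quantile(1)[OF n u K] by force
    qed
    show "hvol u (slice u (c + t) K) = hvol u (slice u t L)" if "t \<in> shadow u L" for t
      using wL[OF that] c same by metis
  qed
qed

text \<open>Only end heights are lost by restricting to the shadow, and they form a null set. The
  restriction makes the weight continuous on its open support, which yields its measurability when
  heights are translated.\<close>

lemma nn_integral_inner_convex_body:
  fixes K :: "'a::euclidean_space set"
  assumes u: "norm u = 1" and K: "convex_body K" and [measurable]: "g \<in> borel_measurable borel"
  shows "(\<integral>\<^sup>+x. g (u \<bullet> x) * indicator K x \<partial>lborel)
    = (\<integral>\<^sup>+t. g t * (ennreal (hvol u (slice u t K)) * indicator (shadow u K) t) \<partial>lborel)"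
proof -
  let ?m = "hyperplane_lborel u"
  note cK = convex_bodyD[OF K]
  have [measurable]: "K \<in> sets borel" by (rule convex_body_props(3)[OF K])
  have "(\<integral>\<^sup>+x. g (u \<bullet> x) * indicator K x \<partial>lborel)
      = (\<integral>\<^sup>+t. \<integral>\<^sup>+y. g (u \<bullet> (y + t *\<^sub>R u)) * indicator K (y + t *\<^sub>R u) \<partial>?m \<partial>lborel)"
    by (rule nn_integral_lborel_orth_hyperplane(1)[OF u]) measurable
  also have "\<dots> = (\<integral>\<^sup>+t. \<integral>\<^sup>+y. g t * indicator (slice u t K) y \<partial>?m \<partial>lborel)"
  proof (rule nn_integral_cong, rule nn_integral_cong_AE)
    fix t
    show "AE y in ?m. g (u \<bullet> (y + t *\<^sub>R u)) * indicator K (y + t *\<^sub>R u) = g t * indicator (slice u t K) y"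
      using AE_subspace_lborel_mem[OF u]
      by eventually_elim (auto simp: slice_def indicator_def orth_hyperplane_def inner_add_right norm_one_inner[OF u])
  qed
  also have "\<dots> = (\<integral>\<^sup>+t. g t * ennreal (hvol u (slice u t K)) \<partial>lborel)"
    by (intro nn_integral_cong) (subst nn_integral_cmult_indicator, auto simp: emeasure_slice[OF u cK(1)])
  also have "\<dots> = (\<integral>\<^sup>+t. g t * (ennreal (hvol u (slice u t K)) * indicator (shadow u K) t) \<partial>lborel)"
  proof (rule nn_integral_cong_AE)
    have "negligible (frontier (shadow u K))"
      by (intro negligible_convex_frontier convex_shadow cK)
    then have "AE t in lborel. t \<notin> frontier (shadow u K)"
      using AE_not_in[of "frontier (shadow u K)" "completion lborel"]
      by (simp add: negligible_iff_null_sets AE_completion_iff)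
    then show "AE t in lborel. g t * ennreal (hvol u (slice u t K))
        = g t * (ennreal (hvol u (slice u t K)) * indicator (shadow u K) t)"
    proof eventually_elim
      case (elim t)
      show ?case
      proof (cases "t \<in> shadow u K")
        case False
        then have t: "t \<notin> closure (shadow u K)"
          using elim open_shadow[OF u, of K] by (simp add: frontier_def interior_open)
        have "slice u t K = {}"
        proof (rule ccontr)
          assume "slice u t K \<noteq> {}"
          then obtain y where y: "u \<bullet> y = 0" "y + t *\<^sub>R u \<in> K" by (auto simp: slice_def orth_hyperplane_def)
          then have "u \<bullet> (y + t *\<^sub>R u) \<in> closure (shadow u K)"
            using inner_image_subset_closure_shadow[OF K, of u] by blast
          then show False using y t by (simp add: inner_add_right norm_one_inner[OF u])
        qed
        then show ?thesis by simp
      qed simp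
    qed
  qed
  finally show ?thesis .
qed

text \<open>The centroid multiplied by the volume.\<close>

definition moment :: "'a::euclidean_space set \<Rightarrow> 'a"
  where "moment K = (\<integral>x. indicator K x *\<^sub>R x \<partial>lborel)"

lemma integral_affine_convex_body:
  fixes K :: "'a::euclidean_space set"
  assumes K: "convex_body K"
  shows "(\<integral>x. indicator K x *\<^sub>R (u \<bullet> x + r) \<partial>lborel) = u \<bullet> moment K + r * volume K"
proof -
  have cK: "compact K" using K by (simp add: convex_body_def)
  have i: "integrable lborel (\<lambda>x. indicator K x *\<^sub>R x)"
    by (intro borel_integrable_compact cK continuous_intros)
  have "integrable lborel (indicator K :: 'a \<Rightarrow> real)"
    using fmeasurable_lborel_bounded[OF convex_body_props(3)[OF K] convex_body_props(2)[OF K]]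
    by (simp add: fmeasurable_def convex_body_props(3)[OF K])
  then have "(\<integral>x. u \<bullet> (indicator K x *\<^sub>R x) + indicator K x * r \<partial>lborel)
    = (\<integral>x. u \<bullet> (indicator K x *\<^sub>R x) \<partial>lborel) + (\<integral>x. indicator K x * r \<partial>lborel)"
    using i by (intro Bochner_Integration.integral_add integrable_inner_right integrable_mult_left)
  also have "\<dots> = u \<bullet> moment K + volume K * r"
    using i convex_body_props(3)[OF K] by (simp add: moment_def del: inner_scaleR_right)
  finally have "(\<integral>x. u \<bullet> (indicator K x *\<^sub>R x) + indicator K x * r \<partial>lborel)
    = u \<bullet> moment K + volume K * r" .
  moreover have "indicator K x *\<^sub>R (u \<bullet> x + r) = u \<bullet> (indicator K x *\<^sub>R x) + indicator K x * r" for x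
    by (simp add: algebra_simps)
  ultimately show ?thesis by (simp add: mult.commute)
qed

section \<open>Support functions and the translation theorem\<close>

lemma support_function_upper:
  assumes "compact K" "x \<in> K"
  shows "u \<bullet> x \<le> support_function K u"
  unfolding support_function_def
  using assms by (intro cSUP_upper bounded_imp_bdd_above bounded_linear_image[OF _ bounded_linear_inner_right] compact_imp_bounded)

lemma support_function_least:
  assumes "K \<noteq> {}" "\<And>x. x \<in> K \<Longrightarrow> u \<bullet> x \<le> b"
  shows "support_function K u \<le> b"
  unfolding support_function_def using assms by (intro cSUP_least)

lemma subset_if_support_function_le:
  fixes A B :: "'a::euclidean_space set"
  assumes A: "compact A" and B: "compact B" "convex B" "B \<noteq> {}"
    and le: "\<And>u. norm u = 1 \<Longrightarrow> support_function A u \<le> support_function B u"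
  shows "A \<subseteq> B"
proof (rule subsetI, rule ccontr)
  fix x assume x: "x \<in> A" "x \<notin> B"
  obtain a b where ab: "a \<bullet> x < b" "\<And>y. y \<in> B \<Longrightarrow> a \<bullet> y > b"
    using separating_hyperplane_closed_point[OF B(2) compact_imp_closed[OF B(1)] x(2)] by blast
  have "a \<noteq> 0" using ab B(3) by force
  define u where "u = (- 1 / norm a) *\<^sub>R a"
  have u: "norm u = 1" using \<open>a \<noteq> 0\<close> by (simp add: u_def)
  have "support_function B u \<le> - b / norm a"
    using \<open>a \<noteq> 0\<close> ab(2) B(3)
    by (intro support_function_least) (auto simp: u_def divide_right_mono less_imp_le)
  moreover have "- b / norm a < u \<bullet> x" using \<open>a \<noteq> 0\<close> ab(1) by (simp add: u_def divide_strict_right_mono)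
  ultimately show False using support_function_upper[OF A x(1), of u] le[OF u] by linarith
qed

lemma eq_if_support_function_eq:
  fixes A B :: "'a::euclidean_space set"
  assumes "compact A" "convex A" "A \<noteq> {}" "compact B" "convex B" "B \<noteq> {}"
    and "\<And>u. norm u = 1 \<Longrightarrow> support_function A u = support_function B u"
  shows "A = B"
  using assms by (intro antisym subset_if_support_function_le) auto

lemma support_function_translate:
  fixes L :: "'a::euclidean_space set"
  assumes "compact L" "L \<noteq> {}"
  shows "support_function ((+) x ` L) u = u \<bullet> x + support_function L u"
proof (rule antisym)
  show "support_function ((+) x ` L) u \<le> u \<bullet> x + support_function L u"
    using assms support_function_upper[OF assms(1)] by (intro support_function_least) (auto simp: inner_add_right)
  have "support_function L u \<le> support_function ((+) x ` L) u - u \<bullet> x"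
  proof (rule support_function_least[OF assms(2)])
    fix y assume "y \<in> L"
    then have "u \<bullet> (x + y) \<le> support_function ((+) x ` L) u"
      using assms by (intro support_function_upper compact_translation) auto
    then show "u \<bullet> y \<le> support_function ((+) x ` L) u - u \<bullet> x" by (simp add: inner_add_right)
  qed
  then show "u \<bullet> x + support_function L u \<le> support_function ((+) x ` L) u" by simp
qed

lemma cSup_translate:
  fixes S :: "real set"
  assumes "S \<noteq> {}" "bdd_above S"
  shows "Sup ((+) c ` S) = c + Sup S"
proof (rule cSup_eq_non_empty)
  show "x \<le> c + Sup S" if "x \<in> (+) c ` S" for x using that assms by (auto intro: cSup_upper)
  fix y assume "\<And>x. x \<in> (+) c ` S \<Longrightarrow> x \<le> y"
  then have "Sup S \<le> y - c" using assms by (intro cSup_least) (auto simp: le_diff_eq add.commute)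
  then show "c + Sup S \<le> y" by simp
qed (use assms in simp)

text \<open>For each direction u the slices of K and L agree in volume after a shift c, whose
  dependence on u is unknown at first. Comparing first moments in direction u shows c = u . x, where
  x is the difference of the centroids, so a single translation serves all directions.\<close>

theorem brunn_minkowski_equality:
  fixes K L :: "'a::euclidean_space set"
  assumes n: "DIM('a) \<ge> 2" and K: "convex_body K" and L: "convex_body L"
    and eq: "volume L = volume K" "volume (K + L) = 2 ^ DIM('a) * volume K"
  obtains x where "K = (+) x ` L"
proof -
  let ?V = "volume K"
  have V: "?V > 0" by (rule convex_body_measure_pos[OF K])
  define x where "x = (1 / ?V) *\<^sub>R (moment K - moment L)"
  note cK = convex_bodyD[OF K] convex_body_props(1)[OF K] and cL = convex_bodyD[OF L] convex_body_props(1)[OF L]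
  have "support_function K u = support_function ((+) x ` L) u" if u: "norm u = 1" for u
  proof -
    obtain c where c: "shadow u K = (+) c ` shadow u L"
      "\<And>t. t \<in> shadow u L \<Longrightarrow> hvol u (slice u (c + t) K) = hvol u (slice u t L)"
      using brunn_minkowski_equality_slices[OF n u K L eq] by blast
    obtain R where R: "\<And>y. y \<in> K \<union> L \<Longrightarrow> norm y \<le> R"
      using convex_body_props(2) K L by (metis bounded_Un bounded_iff)
    have bd: "\<bar>u \<bullet> y\<bar> \<le> R" if "y \<in> K \<union> L" for y
      using R[OF that] Cauchy_Schwarz_ineq2[of u y] u by simp
    \<comment> \<open>Large enough to make both integrands nonnegative on K and L, so that
      nonnegative integrals can be used. Since the volumes agree, r cancels in the end.\<close>
    define r where "r = R + \<bar>c\<bar>"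
    let ?f = "\<lambda>t. ennreal (t + r)"
    have mK: "(\<lambda>t. ennreal (hvol u (slice u t K)) * indicator (shadow u K) t) \<in> borel_measurable borel"
    proof -
      have "(\<lambda>t. indicator (shadow u K) t *\<^sub>R hvol u (slice u t K)) \<in> borel_measurable borel"
        using continuous_on_hvol_slice[OF n u K] open_shadow[OF u]
        by (intro borel_measurable_continuous_on_indicator) (auto simp: borel_open)
      then have "(\<lambda>t. ennreal (indicator (shadow u K) t *\<^sub>R hvol u (slice u t K))) \<in> borel_measurable borel"
        by measurable
      then show ?thesis
        by (rule measurable_cong[THEN iffD1, rotated]) (auto simp: indicator_def)
    qed
    have "(\<integral>\<^sup>+y. ?f (u \<bullet> y) * indicator K y \<partial>lborel)
        = (\<integral>\<^sup>+t. ?f t * (ennreal (hvol u (slice u t K)) * indicator (shadow u K) t) \<partial>lborel)"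
      by (rule nn_integral_inner_convex_body[OF u K]) measurable
    \<comment> \<open>Translating the height by c carries shadow and slice volumes of K to those of
      L.\<close>
    also have "\<dots> = (\<integral>\<^sup>+t. ?f t * (ennreal (hvol u (slice u t K)) * indicator (shadow u K) t) \<partial>distr lborel borel ((+) c))"
      by (simp only: lborel_distr_plus)
    also have "\<dots> = (\<integral>\<^sup>+t. ?f (c + t) * (ennreal (hvol u (slice u (c + t) K)) * indicator (shadow u K) (c + t)) \<partial>lborel)"
      using mK by (subst nn_integral_distr) auto
    also have "\<dots> = (\<integral>\<^sup>+t. ?f (c + t) * (ennreal (hvol u (slice u t L)) * indicator (shadow u L) t) \<partial>lborel)"
      by (intro nn_integral_cong) (auto simp: indicator_def c)
    also have "\<dots> = (\<integral>\<^sup>+y. ?f (c + u \<bullet> y) * indicator L y \<partial>lborel)"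
      by (rule nn_integral_inner_convex_body[OF u L, symmetric]) measurable
    finally have nn: "(\<integral>\<^sup>+y. ?f (u \<bullet> y) * indicator K y \<partial>lborel) = (\<integral>\<^sup>+y. ?f (c + u \<bullet> y) * indicator L y \<partial>lborel)" .
    have pos: "0 \<le> indicator K y *\<^sub>R (u \<bullet> y + r)" "0 \<le> indicator L y *\<^sub>R (u \<bullet> y + (c + r))" for y
      using bd[of y] by (auto simp: indicator_def r_def abs_le_iff)
    have "u \<bullet> moment K + r * ?V = enn2real (\<integral>\<^sup>+y. ennreal (indicator K y *\<^sub>R (u \<bullet> y + r)) \<partial>lborel)"
      unfolding integral_affine_convex_body[OF K, symmetric]
      using pos convex_body_props(3)[OF K] by (intro integral_eq_nn_integral) auto
    also have "(\<integral>\<^sup>+y. ennreal (indicator K y *\<^sub>R (u \<bullet> y + r)) \<partial>lborel) = (\<integral>\<^sup>+y. ?f (u \<bullet> y) * indicator K y \<partial>lborel)"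
      by (intro nn_integral_cong) (auto simp: indicator_def)
    also have "\<dots> = (\<integral>\<^sup>+y. ennreal (indicator L y *\<^sub>R (u \<bullet> y + (c + r))) \<partial>lborel)"
      unfolding nn by (intro nn_integral_cong) (auto simp: indicator_def ac_simps)
    also have "enn2real \<dots> = u \<bullet> moment L + (c + r) * volume L"
      unfolding integral_affine_convex_body[OF L, symmetric]
      using pos convex_body_props(3)[OF L] by (intro integral_eq_nn_integral[symmetric]) auto
    finally have "c * ?V = u \<bullet> (moment K - moment L)"
      using eq(1) by (simp add: algebra_simps inner_diff_right)
    moreover have "u \<bullet> x = (1 / ?V) * (u \<bullet> (moment K - moment L))" by (simp only: x_def inner_scaleR_right)
    ultimately have "c * ?V = (u \<bullet> x) * ?V" using V by simp
    then have "c = u \<bullet> x" using V by simp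
    moreover have "bdd_above (shadow u L)"
      using bounded_linear_image[OF bounded_interior[OF convex_body_props(2)[OF L]] bounded_linear_inner_right[of u]]
      unfolding shadow_def by (rule bounded_imp_bdd_above)
    ultimately show ?thesis
      by (simp add: support_function_translate[OF cL(1,3)] support_function_shadow K L c(1)
          cSup_translate shadow_nonempty)
  qed
  then have "K = (+) x ` L"
    using cK cL by (intro eq_if_support_function_eq) (auto intro: compact_translation convex_translation)
  then show thesis by (rule that)
qed

section \<open>The projection body\<close>

definition brightness :: "'a::euclidean_space set \<Rightarrow> 'a \<Rightarrow> real"
  where "brightness K x = volume (K + closed_segment 0 x) - volume K"

lemma brightness_scaled:
  assumes "norm u = 1" "compact K" "convex K" "e \<ge> 0"
  shows "brightness K (e *\<^sub>R u) = e * hvol u (hyperplane_projection u K)"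
  using measure_plus_segment[OF assms] by (simp add: brightness_def)

lemma brightness_unit:
  assumes "norm u = 1" "compact K" "convex K"
  shows "brightness K u = hvol u (hyperplane_projection u K)"
  using brightness_scaled[OF assms, of 1] by simp

lemma brightness_scaleR:
  fixes K :: "'a::euclidean_space set"
  assumes K: "compact K" "convex K" and c: "c \<ge> 0"
  shows "brightness K (c *\<^sub>R x) = c * brightness K x"
proof (cases "x = 0")
  case True
  then show ?thesis by (simp add: brightness_def set_plus_def)
next
  case False
  define u where "u = (1 / norm x) *\<^sub>R x"
  have u: "norm u = 1" "x = norm x *\<^sub>R u" "c *\<^sub>R x = (c * norm x) *\<^sub>R u" using False by (auto simp: u_def)
  show ?thesis
    unfolding u(3) using brightness_scaled[OF u(1) K, of "c * norm x"] brightness_scaled[OF u(1) K, of "norm x"] u(2) c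
    by simp
qed

lemma compact_convex_plus_segment:
  fixes K :: "'a::euclidean_space set"
  assumes "compact K" "convex K"
  shows "compact (K + closed_segment 0 x)" "convex (K + closed_segment 0 x)"
  using assms by (auto intro!: compact_plus convex_set_plus)

lemma measure_mono_compact:
  fixes S T :: "'a::euclidean_space set"
  shows "compact S \<Longrightarrow> compact T \<Longrightarrow> S \<subseteq> T \<Longrightarrow> volume S \<le> volume T"
  by (intro volume_mono) (auto intro: borel_compact compact_imp_bounded)

text \<open>Adding two short segments to \<open>K\<close> in either order expresses the volume of
  \<open>K + [0, e x] + [0, e y]\<close> in two ways; subadditivity is the first-order term in \<open>e\<close>.\<close>

lemma brightness_subadditive:
  fixes K :: "'a::euclidean_space set"
  assumes K: "compact K" "convex K"
  shows "brightness K (x + y) \<le> brightness K x + brightness K y"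
proof -
  note Kx = compact_convex_plus_segment[OF K]
  \<comment> \<open>The error for a given e is exactly e times a quantity independent of e, so it
    vanishes as e tends to 0.\<close>
  let ?d = "brightness (K + closed_segment 0 y) x - brightness K x"
  have "brightness K (x + y) \<le> brightness K x + brightness K y + e * ?d" if e: "e > 0" for e
  proof -
    let ?Kx = "K + closed_segment 0 (e *\<^sub>R x)"
    have sub: "closed_segment 0 (e *\<^sub>R (x + y)) \<subseteq> closed_segment 0 (e *\<^sub>R x) + closed_segment 0 (e *\<^sub>R y)"
    proof
      fix z assume "z \<in> closed_segment 0 (e *\<^sub>R (x + y))"
      then obtain r where "0 \<le> r" "r \<le> 1" "z = r *\<^sub>R e *\<^sub>R x + r *\<^sub>R e *\<^sub>R y"
        by (auto simp: in_segment scaleR_add_right)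
      then show "z \<in> closed_segment 0 (e *\<^sub>R x) + closed_segment 0 (e *\<^sub>R y)"
        by (auto simp: in_segment intro!: set_plus_intro)
    qed
    have "volume (K + closed_segment 0 (e *\<^sub>R (x + y))) \<le> volume (?Kx + closed_segment 0 (e *\<^sub>R y))"
      unfolding add.assoc
      using K Kx sub by (intro measure_mono_compact set_plus_mono2 compact_plus) auto
    then have "brightness K (e *\<^sub>R (x + y)) \<le> brightness K (e *\<^sub>R x) + brightness ?Kx (e *\<^sub>R y)"
      by (simp add: brightness_def)
    then have "e * brightness K (x + y) \<le> e * (brightness K x + brightness ?Kx y)"
      using e by (simp only: brightness_scaleR[OF K less_imp_le] brightness_scaleR[OF Kx less_imp_le] distrib_left)
    then have "brightness K (x + y) \<le> brightness K x + brightness ?Kx y" using e by simp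
    also have "brightness ?Kx y = brightness K y + e * ?d"
    proof -
      have "?Kx + closed_segment 0 y = (K + closed_segment 0 y) + closed_segment 0 (e *\<^sub>R x)"
        by (simp add: ac_simps)
      then have "brightness ?Kx y = brightness K y + brightness (K + closed_segment 0 y) (e *\<^sub>R x) - brightness K (e *\<^sub>R x)"
        by (simp add: brightness_def)
      then show ?thesis
        using e brightness_scaleR[OF K, of e x] brightness_scaleR[OF Kx, of e y x] by (simp add: algebra_simps)
    qed
    finally show ?thesis by simp
  qed
  moreover have "((\<lambda>e. brightness K x + brightness K y + e * ?d) \<longlongrightarrow> brightness K x + brightness K y + 0 * ?d) (at_right 0)"
    by (intro tendsto_intros)
  ultimately have "brightness K (x + y) \<le> brightness K x + brightness K y + 0 * ?d"
    by (intro tendsto_lowerbound[of _ _ "at_right 0"]) (auto intro: eventually_at_rightI[of 0 1])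
  then show ?thesis by simp
qed

text \<open>The projection contains every slice, and a slice at an interior height has positive
  volume.\<close>

lemma brightness_pos:
  fixes K :: "'a::euclidean_space set"
  assumes K: "convex_body K" and x: "x \<noteq> 0"
  shows "brightness K x > 0"
proof -
  note cK = convex_bodyD[OF K]
  define u where "u = (1 / norm x) *\<^sub>R x"
  have u: "norm u = 1" "x = norm x *\<^sub>R u" using x by (auto simp: u_def)
  obtain t where t: "t \<in> shadow u K" using shadow_nonempty[OF K] by blast
  have "0 < hvol u (slice u t K)" by (rule hvol_slice_pos[OF u(1) cK(1) t])
  also have "\<dots> \<le> hvol u (hyperplane_projection u K)"
    by (intro hvol_mono u hyperplane_projection_subset compact_slice compact_hyperplane_projection cK)
       (auto simp: slice_def mem_hyperplane_projection_iff[OF u(1)])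
  finally show ?thesis using brightness_scaled[OF u(1) cK, of "norm x"] u(2) x by simp
qed

text \<open>These are the support functions of convex bodies with the origin in the interior. The
  brightness of a convex body is one of them, and \<open>body\<close> below recovers the set it
  supports.\<close>

locale positive_sublinear =
  fixes h :: "'a::euclidean_space \<Rightarrow> real"
  assumes scaleR: "c \<ge> 0 \<Longrightarrow> h (c *\<^sub>R x) = c * h x"
    and add: "h (x + y) \<le> h x + h y"
    and pos: "x \<noteq> 0 \<Longrightarrow> h x > 0"
begin

lemma zero [simp]: "h 0 = 0"
  using scaleR[of 0 0] by simp

lemma nonneg: "h x \<ge> 0"
  using pos[of x] by (cases "x = 0") auto

lemma convex_on: "convex_on S h" if "convex S"
  using that
proof (intro convex_onI)
  fix t :: real and x y assume "0 < t" "t < 1"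
  then show "h ((1 - t) *\<^sub>R x + t *\<^sub>R y) \<le> (1 - t) * h x + t * h y"
    using add[of "(1 - t) *\<^sub>R x" "t *\<^sub>R y"] scaleR[of "1 - t" x] scaleR[of t y] by simp
qed

lemma continuous: "continuous_on S h"
proof -
  have "continuous_on UNIV h"
    by (rule convex_on_continuous) (auto intro: convex_on)
  then show ?thesis by (rule continuous_on_subset) simp
qed

lemma bounds: obtains a b where "a > 0" "b > 0" "\<And>x. a * norm x \<le> h x" "\<And>x. h x \<le> b * norm x"
proof -
  have "sphere (0::'a) 1 \<noteq> {}" by simp
  then obtain p q where p: "p \<in> sphere 0 1" "\<And>x. x \<in> sphere 0 1 \<Longrightarrow> h p \<le> h x"
    and q: "q \<in> sphere 0 1" "\<And>x. x \<in> sphere 0 1 \<Longrightarrow> h x \<le> h q"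
    using continuous_attains_inf[OF compact_sphere _ continuous] continuous_attains_sup[OF compact_sphere _ continuous]
    by metis
  have "p \<noteq> 0" "q \<noteq> 0" using p q by auto
  then have "h p > 0" "h q > 0" using pos by auto
  moreover have "h p * norm x \<le> h x \<and> h x \<le> h q * norm x" for x
  proof (cases "x = 0")
    case False
    have "h x = norm x * h ((1 / norm x) *\<^sub>R x)" using False scaleR[of "norm x" "(1 / norm x) *\<^sub>R x"] by simp
    moreover have sph: "(1 / norm x) *\<^sub>R x \<in> sphere 0 1" using False by simp
    ultimately show ?thesis
      using mult_left_mono[OF p(2)[OF sph] norm_ge_zero[of x]] mult_left_mono[OF q(2)[OF sph] norm_ge_zero[of x]]
      by (simp only: mult.commute)
  qed simp
  ultimately show thesis using that by blast
qed

definition body :: "'a set" where "body = {y. \<forall>x. x \<bullet> y \<le> h x}"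

text \<open>Hahn--Banach in finite dimension: separate the open sublevel set from the boundary point
  z on the ray of x and normalise the functional so that it is dominated by h with equality at
  x.\<close>

lemma supporting_point: obtains y where "y \<in> body" "x \<bullet> y = h x"
proof (cases "x = 0")
  case True
  then show thesis using that[of 0] nonneg by (simp add: body_def)
next
  case False
  define z where "z = (1 / h x) *\<^sub>R x"
  have hz: "h z = 1" using pos[OF False] scaleR[of "1 / h x" x] by (simp add: z_def)
  let ?U = "{x. h x < 1}"
  have "convex ?U"
  proof (rule convexI)
    fix x y and a b :: real assume "x \<in> ?U" "y \<in> ?U" and ab: "0 \<le> a" "0 \<le> b" "a + b = 1"
    then have "a * h x + b * h y < 1" by (intro convex_bound_lt) auto
    then show "a *\<^sub>R x + b *\<^sub>R y \<in> ?U"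
      using add[of "a *\<^sub>R x" "b *\<^sub>R y"] scaleR ab by simp
  qed
  moreover have "z \<notin> ?U" using hz by simp
  moreover have "0 \<in> ?U" by simp
  ultimately obtain a b where ab: "a \<noteq> 0" "\<And>x. h x < 1 \<Longrightarrow> a \<bullet> x \<le> b" "b \<le> a \<bullet> z"
    using separating_hyperplane_sets[of ?U "{z}"] by auto
  \<comment> \<open>Homogeneity extends the bound from the sublevel set to all vectors. The factor r
    < 1 keeps the rescaled vector inside the open set and is removed at the end.\<close>
  have ineq: "a \<bullet> x \<le> (a \<bullet> z) * h x" for x
  proof (cases "x = 0")
    case False
    show ?thesis
    proof (rule field_le_mult_one_interval)
      fix r :: real assume r: "0 < r" "r < 1"
      have "h ((r / h x) *\<^sub>R x) < 1" using r pos[OF False] scaleR[of "r / h x" x] by simp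
      then have "a \<bullet> ((r / h x) *\<^sub>R x) \<le> a \<bullet> z" using ab by fastforce
      then show "r * (a \<bullet> x) \<le> (a \<bullet> z) * h x" using pos[OF False] by (simp add: pos_divide_le_eq)
    qed
  qed simp
  have "a \<bullet> a > 0" using ab(1) by simp
  \<comment> \<open>At x = a the inequality reads 0 < a . a \<le> (a . z) h(a) with h(a) >
    0.\<close>
  then have az: "a \<bullet> z > 0" using ineq[of a] pos[OF ab(1)] by (smt (verit) mult_nonneg_nonneg mult_nonpos_nonneg)
  show thesis
  proof (rule that[of "(1 / (a \<bullet> z)) *\<^sub>R a"])
    show "(1 / (a \<bullet> z)) *\<^sub>R a \<in> body"
      using ineq az by (simp add: body_def inner_commute pos_divide_le_eq mult.commute)
    have "a \<bullet> z = (a \<bullet> x) / h x" by (simp add: z_def)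
    then show "x \<bullet> (1 / (a \<bullet> z)) *\<^sub>R a = h x" using az pos[OF False] by (simp add: inner_commute field_simps)
  qed
qed

lemma convex_body_body: "convex_body body"
  unfolding convex_body_def
proof (intro conjI)
  obtain a b where ab: "a > 0" "b > 0" "\<And>x. a * norm x \<le> h x" "\<And>x. h x \<le> b * norm x"
    using bounds by blast
  have eq: "body = (\<Inter>x. {y. x \<bullet> y \<le> h x})" by (auto simp: body_def)
  have "closed body" unfolding eq by (intro closed_INT ballI closed_halfspace_le)
  moreover have "norm y \<le> b" if "y \<in> body" for y
  proof (cases "y = 0")
    case False
    have "norm y * norm y \<le> b * norm y"
      using that ab(4)[of y] by (auto simp: body_def power2_norm_eq_inner[symmetric] power2_eq_square dest!: spec[of _ y])
    then show ?thesis using False by simp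
  qed (use ab in simp)
  ultimately show "compact body" by (auto simp: compact_eq_bounded_closed bounded_iff)
  show "convex body" unfolding eq by (intro convex_INT convex_halfspace_le)
  have "ball (0::'a) a \<subseteq> body"
  proof
    fix y assume "y \<in> ball (0::'a) a"
    then have "x \<bullet> y \<le> h x" for x
      using norm_cauchy_schwarz[of x y] ab(3)[of x] mult_left_mono[of "norm y" a "norm x"]
      by (simp add: mult.commute)
    then show "y \<in> body" by (simp add: body_def)
  qed
  then have "ball (0::'a) a \<subseteq> interior body" by (simp add: interior_maximal)
  then show "interior body \<noteq> {}" using ab(1) by auto
qed

lemma support_function_body: "support_function body x = h x"
proof (rule antisym)
  have "body \<noteq> {}" using nonneg by (auto simp: body_def intro!: exI[of _ 0])
  then show "support_function body x \<le> h x"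
    by (rule support_function_least) (simp add: body_def)
  obtain y where "y \<in> body" "x \<bullet> y = h x" using supporting_point .
  then show "h x \<le> support_function body x"
    using support_function_upper[of body y x] convex_body_body by (simp add: convex_body_def)
qed

lemma polar_body_body: "polar_body body = {x. h x \<le> 1}"
proof (intro set_eqI iffI)
  fix x assume x: "x \<in> polar_body body"
  obtain y where "y \<in> body" "x \<bullet> y = h x" using supporting_point .
  with x show "x \<in> {x. h x \<le> 1}" by (auto simp: polar_body_def)
next
  fix x assume "x \<in> {x. h x \<le> 1}"
  then have "x \<bullet> y \<le> 1" if "y \<in> body" for y
    using that by (auto simp: body_def dest!: spec[of _ x])
  then show "x \<in> polar_body body" by (simp add: polar_body_def)
qed

end

lemma positive_sublinear_brightness:
  assumes K: "convex_body K" shows "positive_sublinear (brightness K)"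
proof
  note cK = convex_bodyD[OF K]
  show "brightness K (c *\<^sub>R x) = c * brightness K x" if "c \<ge> 0" for c x
    by (rule brightness_scaleR[OF cK that])
  show "brightness K (x + y) \<le> brightness K x + brightness K y" for x y
    by (rule brightness_subadditive[OF cK])
qed (rule brightness_pos[OF K])

text \<open>The definite description is resolved by \<open>body\<close> of the brightness function:
  it has the prescribed support function on the sphere, and a compact convex set is determined by
  those values.\<close>

theorem polar_projection_body_eq:
  fixes K :: "'a::euclidean_space set"
  assumes K: "convex_body K"
  shows "polar_body (projection_body K) = {x. brightness K x \<le> 1}"
proof -
  note cK = convex_bodyD[OF K]
  interpret positive_sublinear "brightness K" by (rule positive_sublinear_brightness[OF K])
  have "projection_body K = body"
    unfolding projection_body_def
  proof (rule the_equality)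
    show "convex_body body \<and> (\<forall>u. norm u = 1 \<longrightarrow> support_function body u = hvol u (hyperplane_projection u K))"
      using convex_body_body support_function_body brightness_unit[OF _ cK] by auto
    fix P assume P: "convex_body P \<and> (\<forall>u. norm u = 1 \<longrightarrow> support_function P u = hvol u (hyperplane_projection u K))"
    then have "P \<noteq> {}" "body \<noteq> {}" using convex_body_body interior_subset by (auto simp: convex_body_def)
    then show "P = body"
      using P convex_body_body support_function_body brightness_unit[OF _ cK]
      by (intro eq_if_support_function_eq) (auto simp: convex_body_def)
  qed
  then show ?thesis by (simp add: polar_body_body)
qed

section \<open>Minkowski's inequality for sublevel sets\<close>

definition annulus :: "'a::euclidean_space set"
  where "annulus = {y. 1 \<le> norm y \<and> norm y \<le> 2}"

lemma annulus_eq: "annulus = cball 0 2 - ball 0 1"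
  by (auto simp: annulus_def)

lemma compact_annulus: "compact annulus"
  unfolding annulus_eq by (intro compact_diff) auto

lemma borel_annulus [measurable, simp]: "annulus \<in> sets borel"
  by (intro borel_compact compact_annulus)

text \<open>A substitute for polar coordinates: weighting every nonzero \<open>x\<close> by
  \<open>norm x\<close> times the length of \<open>{s. s x \<in> annulus}\<close>, which is 1, and rescaling, turns the
  volume of a star-shaped set into an integral over the annulus.\<close>

lemma (in positive_sublinear) emeasure_sublevel:
  "emeasure lborel {x. h x \<le> 1}
    = (\<integral>\<^sup>+y. ennreal (norm y / (DIM('a) * h y ^ DIM('a))) * indicator annulus y \<partial>lborel)"
proof -
  let ?n = "DIM('a)"
  have n: "?n > 0" by simp
  have [measurable]: "h \<in> borel_measurable borel"
    using continuous by (rule borel_measurable_continuous_onI)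
  \<comment> \<open>\<open>q\<close> is the weighted integrand in (x, s), and \<open>r\<close> is
    the result of substituting y = s x. The Jacobian s^(-n) together with norm x = norm y / s gives
    the power n + 1.\<close>
  define q where "q x s = (if h x \<le> 1 \<and> 1 \<le> s * norm x \<and> s * norm x \<le> 2 then ennreal (norm x) else 0)"
    for x :: 'a and s :: real
  define r where "r y s = (if 0 < s \<and> h y \<le> s \<and> y \<in> annulus then ennreal (norm y * (1 / s) ^ Suc ?n) else 0)"
    for y :: 'a and s :: real
  have [measurable]: "(\<lambda>(x, s). q x s) \<in> borel_measurable (lborel \<Otimes>\<^sub>M lborel)"
    unfolding q_def by measurable
  have [measurable]: "(\<lambda>(x, s). r x s) \<in> borel_measurable (lborel \<Otimes>\<^sub>M lborel)"
    unfolding r_def by measurable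
  have sets [measurable]: "{x. h x \<le> 1} \<in> sets borel" by measurable
  have "emeasure lborel {x. h x \<le> 1} = (\<integral>\<^sup>+x. indicator {x. h x \<le> 1} x \<partial>lborel)" by simp
  also have "\<dots> = (\<integral>\<^sup>+x. \<integral>\<^sup>+s. q x s \<partial>lborel \<partial>lborel)"
  proof (rule nn_integral_cong_AE)
    have "AE x in lborel. x \<noteq> (0::'a)" by (rule AE_lborel_singleton)
    then show "AE x in lborel. indicator {x. h x \<le> 1} x = (\<integral>\<^sup>+s. q x s \<partial>lborel)"
    proof eventually_elim
      case (elim x)
      have "(\<integral>\<^sup>+s. q x s \<partial>lborel)
          = (\<integral>\<^sup>+s. (indicator {x. h x \<le> 1} x * ennreal (norm x)) * indicator {1 / norm x..2 / norm x} s \<partial>lborel)"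
        using elim by (intro nn_integral_cong) (auto simp: q_def indicator_def pos_divide_le_eq pos_le_divide_eq)
      also have "\<dots> = indicator {x. h x \<le> 1} x * ennreal (norm x) * ennreal (2 / norm x - 1 / norm x)"
        using elim by (subst nn_integral_cmult_indicator) (auto simp: divide_right_mono)
      also have "\<dots> = indicator {x. h x \<le> 1} x * ennreal (norm x * (2 / norm x - 1 / norm x))"
        by (simp only: mult.assoc ennreal_mult' norm_ge_zero)
      also have "norm x * (2 / norm x - 1 / norm x) = 1" using elim by (simp add: field_simps)
      finally show ?case by simp
    qed
  qed
  also have "\<dots> = (\<integral>\<^sup>+s. \<integral>\<^sup>+x. q x s \<partial>lborel \<partial>lborel)"
    by (rule lborel_pair.Fubini'[symmetric]) measurable
  also have "\<dots> = (\<integral>\<^sup>+s. \<integral>\<^sup>+y. r y s \<partial>lborel \<partial>lborel)"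
  proof (rule nn_integral_cong)
    fix s :: real
    show "(\<integral>\<^sup>+x. q x s \<partial>lborel) = (\<integral>\<^sup>+y. r y s \<partial>lborel)"
    proof (cases "s > 0")
      case False
      then have "s * norm x \<le> 0" for x :: 'a by (simp add: mult_nonpos_nonneg)
      then have "q x s = 0" for x
        unfolding q_def by (metis not_one_le_zero order_trans)
      then show ?thesis using False by (simp add: r_def)
    next
      case True
      have [measurable]: "(\<lambda>x. q x s) \<in> borel_measurable borel" unfolding q_def by measurable
      have "(\<integral>\<^sup>+x. q x s \<partial>lborel)
          = (\<integral>\<^sup>+x. q x s \<partial>density (distr lborel borel (\<lambda>x. 0 + (1 / s) *\<^sub>R x)) (\<lambda>_. ennreal (\<bar>1 / s\<bar> ^ ?n)))"
        using True by (subst lborel_affine[of "1 / s" 0]) auto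
      also have "\<dots> = (\<integral>\<^sup>+x. ennreal (\<bar>1 / s\<bar> ^ ?n) * q ((1 / s) *\<^sub>R x) s \<partial>lborel)"
        by (simp add: nn_integral_density nn_integral_distr)
      also have "\<dots> = (\<integral>\<^sup>+y. r y s \<partial>lborel)"
      proof (rule nn_integral_cong)
        fix y :: 'a
        have "h ((1 / s) *\<^sub>R y) \<le> 1 \<longleftrightarrow> h y \<le> s" using scaleR[of "1 / s" y] True by (simp add: pos_divide_le_eq)
        moreover have "s * norm ((1 / s) *\<^sub>R y) = norm y" using True by simp
        moreover have "ennreal (\<bar>1 / s\<bar> ^ ?n) * ennreal (norm ((1 / s) *\<^sub>R y)) = ennreal (norm y * (1 / s) ^ Suc ?n)"
          using True by (simp add: ennreal_mult'[symmetric] power_divide)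
        ultimately show "ennreal (\<bar>1 / s\<bar> ^ ?n) * q ((1 / s) *\<^sub>R y) s = r y s"
          using True unfolding q_def r_def annulus_def by simp
      qed
      finally show ?thesis .
    qed
  qed
  also have "\<dots> = (\<integral>\<^sup>+y. \<integral>\<^sup>+s. r y s \<partial>lborel \<partial>lborel)"
    by (rule lborel_pair.Fubini') measurable
  \<comment> \<open>For fixed y the condition on s is s \<ge> h y, and the integral of s^(-n-1) from
    h y to infinity is 1/(n h(y)^n).\<close>
  also have "\<dots> = (\<integral>\<^sup>+y. ennreal (norm y / (?n * h y ^ ?n)) * indicator annulus y \<partial>lborel)"
  proof (rule nn_integral_cong)
    fix y :: 'a
    show "(\<integral>\<^sup>+s. r y s \<partial>lborel) = ennreal (norm y / (?n * h y ^ ?n)) * indicator annulus y"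
    proof (cases "y \<in> annulus")
      case True
      then have "y \<noteq> 0" by (auto simp: annulus_def)
      then have hy: "h y > 0" by (rule pos)
      have "(\<integral>\<^sup>+s. r y s \<partial>lborel) = (\<integral>\<^sup>+s. ennreal (norm y * (1 / s) ^ Suc ?n) * indicator {h y..} s \<partial>lborel)"
        using True hy by (intro nn_integral_cong) (auto simp: r_def indicator_def)
      also have "\<dots> = ennreal (0 - (- (norm y / ?n) * (1 / h y) ^ ?n))"
      proof (rule nn_integral_FTC_atLeast)
        show "(\<lambda>s. norm y * (1 / s) ^ Suc ?n) \<in> borel_measurable borel" by measurable
        fix s assume "h y \<le> s"
        then have s: "s > 0" using hy by simp
        show "0 \<le> norm y * (1 / s) ^ Suc ?n" using s by simp
        have "((\<lambda>s. - (norm y / ?n) * (1 / s) ^ ?n) has_real_derivative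
           - (norm y / ?n) * (real ?n * (- (1 / s\<^sup>2) * (1 / s) ^ (?n - 1)))) (at s)"
          using s by (auto intro!: derivative_eq_intros simp: power2_eq_square)
        moreover have "- (norm y / ?n) * (real ?n * (- (1 / s\<^sup>2) * (1 / s) ^ (?n - 1))) = norm y * (1 / s) ^ Suc ?n"
        proof -
          have "(1 / s\<^sup>2) * (1 / s) ^ (?n - 1) = (1 / s) ^ Suc ?n"
          proof -
            obtain k where k: "?n = Suc k" using n gr0_conv_Suc by blast
            then show ?thesis using s by (simp add: power2_eq_square power_divide)
          qed
          then show ?thesis using n by simp
        qed
        ultimately show "((\<lambda>s. - (norm y / ?n) * (1 / s) ^ ?n) has_real_derivative norm y * (1 / s) ^ Suc ?n) (at s)"
          by (simp only:)
      next
        have "((\<lambda>s::real. 1 / s) \<longlongrightarrow> 0) at_top"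
          using tendsto_inverse_0_at_top[OF filterlim_ident] by (simp add: inverse_eq_divide)
        then have "((\<lambda>s. - (norm y / ?n) * (1 / s) ^ ?n) \<longlongrightarrow> - (norm y / ?n) * 0 ^ ?n) at_top"
          by (intro tendsto_intros)
        moreover have "- (norm y / ?n) * 0 ^ ?n = 0" using n by (simp only: zero_power mult_zero_right)
        ultimately show "((\<lambda>s. - (norm y / ?n) * (1 / s) ^ ?n) \<longlongrightarrow> 0) at_top" by (simp only:)
      qed
      also have "\<dots> = ennreal (norm y / (?n * h y ^ ?n)) * indicator annulus y"
        using True by (simp add: power_divide)
      finally show ?thesis .
    next
      case False
      then show ?thesis by (simp add: r_def)
    qed
  qed
  finally show ?thesis .
qed

text \<open>The weight norm y / n is chosen so that the integral of h^(-n) is exactly the volume of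
  \<open>{x. h x \<le> 1}\<close>; it takes the place of the surface measure of the sphere.\<close>

definition annulus_integral :: "('a::euclidean_space \<Rightarrow> real) \<Rightarrow> real"
  where "annulus_integral g = (\<integral>y. indicator annulus y *\<^sub>R (norm y / DIM('a) * g y) \<partial>lborel)"

lemma integrable_annulus:
  fixes g :: "'a::euclidean_space \<Rightarrow> real"
  assumes "continuous_on annulus g"
  shows "integrable lborel (\<lambda>y. indicator annulus y *\<^sub>R (norm y / DIM('a) * g y))"
  using assms by (intro borel_integrable_compact compact_annulus continuous_intros) auto

lemma annulus_integral_add:
  fixes f g :: "'a::euclidean_space \<Rightarrow> real"
  assumes "continuous_on annulus f" "continuous_on annulus g"
  shows "annulus_integral (\<lambda>y. f y + g y) = annulus_integral f + annulus_integral g"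
proof -
  have "annulus_integral (\<lambda>y. f y + g y) = (\<integral>y. indicator annulus y *\<^sub>R (norm y / DIM('a) * f y)
      + indicator annulus y *\<^sub>R (norm y / DIM('a) * g y) \<partial>lborel)"
    unfolding annulus_integral_def
    by (intro Bochner_Integration.integral_cong refl) (simp add: distrib_left)
  then show ?thesis
    unfolding annulus_integral_def
    using integrable_annulus[OF assms(1)] integrable_annulus[OF assms(2)]
    by (simp only: Bochner_Integration.integral_add)
qed

lemma annulus_integral_mult:
  fixes f :: "'a::euclidean_space \<Rightarrow> real"
  shows "annulus_integral (\<lambda>y. c * f y) = c * annulus_integral f"
proof -
  have "annulus_integral (\<lambda>y. c * f y) = (\<integral>y. c * (indicator annulus y *\<^sub>R (norm y / DIM('a) * f y)) \<partial>lborel)"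
    unfolding annulus_integral_def by (intro Bochner_Integration.integral_cong) auto
  then show ?thesis unfolding annulus_integral_def by simp
qed

lemma annulus_integral_nonneg:
  assumes "\<And>y. y \<in> annulus \<Longrightarrow> f y \<ge> 0"
  shows "annulus_integral f \<ge> 0"
  unfolding annulus_integral_def using assms
  by (intro Bochner_Integration.integral_nonneg) (auto simp: indicator_def)

text \<open>A nonnegative function with zero integral vanishes almost everywhere, and by continuity
  everywhere on the open shell. That shell suffices because homogeneity carries every nonzero vector
  into it.\<close>

lemma annulus_integral_eq_0:
  fixes f :: "'a::euclidean_space \<Rightarrow> real"
  assumes f: "continuous_on annulus f" "\<And>y. y \<in> annulus \<Longrightarrow> f y \<ge> 0" "annulus_integral f = 0"
    and y: "1 < norm y" "norm y < 2"
  shows "f y = 0"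
proof -
  let ?C = "{y \<in> annulus. f y = 0}" and ?S = "ball 0 2 - cball (0::'a) 1"
  have "AE y in lborel. indicator annulus y *\<^sub>R (norm y / DIM('a) * f y) = 0"
    using f(3) integrable_annulus[OF f(1)] f(2) unfolding annulus_integral_def
    by (subst (asm) integral_nonneg_eq_0_iff_AE) (auto simp: indicator_def)
  then have "AE y in lborel. y \<in> ?S \<longrightarrow> y \<in> ?C"
    by eventually_elim (auto simp: annulus_def)
  then have "AE y \<in> ?S in lebesgue. y \<in> ?C" by (rule AE_completion)
  moreover have "closed ?C"
    using continuous_closed_preimage_constant[OF f(1) compact_imp_closed[OF compact_annulus]] by simp
  moreover have "y \<in> ?S" using y by simp
  ultimately show ?thesis
    using mem_closed_if_AE_lebesgue_open[of ?S ?C y] by auto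
qed

context positive_sublinear
begin

lemma measure_sublevel: "volume {x. h x \<le> 1} = annulus_integral (\<lambda>y. 1 / h y ^ DIM('a))"
proof -
  have [measurable]: "h \<in> borel_measurable borel"
    using continuous by (rule borel_measurable_continuous_onI)
  have "annulus_integral (\<lambda>y. 1 / h y ^ DIM('a))
     = enn2real (\<integral>\<^sup>+y. ennreal (indicator annulus y *\<^sub>R (norm y / DIM('a) * (1 / h y ^ DIM('a)))) \<partial>lborel)"
    unfolding annulus_integral_def
    using nonneg by (intro integral_eq_nn_integral) auto
  also have "(\<integral>\<^sup>+y. ennreal (indicator annulus y *\<^sub>R (norm y / DIM('a) * (1 / h y ^ DIM('a)))) \<partial>lborel)
    = emeasure lborel {x. h x \<le> 1}"
    unfolding emeasure_sublevel by (intro nn_integral_cong) (auto simp: indicator_def)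
  finally show ?thesis by (simp add: measure_def)
qed

lemma closed_sublevel: "closed {x. h x \<le> 1}"
  using continuous_closed_preimage[OF continuous closed_UNIV, of "{..1}"] by (simp add: vimage_def)

lemma measure_sublevel_pos: "volume {x. h x \<le> 1} > 0"
proof -
  obtain a b where ab: "a > 0" "b > 0" "\<And>x. a * norm x \<le> h x" "\<And>x. h x \<le> b * norm x"
    using bounds by blast
  have "bounded {x. h x \<le> 1}"
    unfolding bounded_iff
  proof (intro exI ballI)
    fix x assume "x \<in> {x. h x \<le> 1}"
    then have "a * norm x \<le> 1" using ab(3)[of x] by simp
    then show "norm x \<le> 1 / a" using ab(1) by (simp add: pos_le_divide_eq mult.commute)
  qed
  moreover have "ball 0 (1 / b) \<subseteq> {x. h x \<le> 1}"
  proof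
    fix x :: 'a assume "x \<in> ball 0 (1 / b)"
    then have "b * norm x \<le> 1" using ab(2) by (simp add: pos_less_divide_eq mult.commute)
    then show "x \<in> {x. h x \<le> 1}" using ab(4)[of x] by simp
  qed
  ultimately have "volume (ball (0::'a) (1 / b)) \<le> volume {x. h x \<le> 1}"
    by (intro volume_mono) (auto intro: borel_closed closed_sublevel)
  moreover have "volume (ball (0::'a) (1 / b)) > 0" using ab(2) by (intro measure_pos_open) auto
  ultimately show ?thesis by linarith
qed

lemma measure_lebesgue_sublevel: "measure lebesgue {x. h x \<le> 1} = volume {x. h x \<le> 1}"
  by (simp add: measure_completion borel_closed closed_sublevel)

end

text \<open>The pointwise form of Minkowski's inequality with exponent -N. With X = a/p and Y = b/q
  the number H = (a + b)/(p + q) is their harmonic mean with weights \<alpha> and \<beta>; it is at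
  most the arithmetic mean, whose N-th power is at most the mean of the N-th powers.\<close>

lemma power_harmonic_mean_le:
  fixes a b p q :: real
  assumes pos: "a > 0" "b > 0" "p > 0" "q > 0"
  defines "\<alpha> \<equiv> a / (a + b)" and "\<beta> \<equiv> b / (a + b)"
  shows "1 / (p + q) ^ N \<le> (1 / (a + b) ^ N) * (\<alpha> * (a ^ N * (1 / p ^ N)) + \<beta> * (b ^ N * (1 / q ^ N)))"
    and "N > 0 \<Longrightarrow> 1 / (p + q) ^ N = (1 / (a + b) ^ N) * (\<alpha> * (a ^ N * (1 / p ^ N)) + \<beta> * (b ^ N * (1 / q ^ N)))
      \<Longrightarrow> p = (a / b) * q"
proof -
  define X Y where "X = a / p" and "Y = b / q"
  have XY: "X > 0" "Y > 0" using pos by (auto simp: X_def Y_def)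
  have ab: "a + b > 0" "\<alpha> > 0" "\<beta> > 0" "\<alpha> + \<beta> = 1"
    using pos by (auto simp: \<alpha>_def \<beta>_def add_divide_distrib[symmetric])
  define H where "H = (a + b) / (p + q)"
  have H: "H > 0" using pos by (simp add: H_def)
  have XYrat: "\<alpha> / X + \<beta> / Y = 1 / H"
  proof -
    have "\<alpha> / X = p / (a + b)" "\<beta> / Y = q / (a + b)"
      using pos by (simp_all add: \<alpha>_def \<beta>_def X_def Y_def)
    then show ?thesis by (simp add: H_def add_divide_distrib[symmetric])
  qed
  \<comment> \<open>The arithmetic mean divided by the harmonic mean exceeds 1 by an explicit
    square, which settles both the inequality and its equality case X = Y.\<close>
  have prod: "(\<alpha> * X + \<beta> * Y) * (\<alpha> / X + \<beta> / Y) = 1 + \<alpha> * \<beta> * ((X - Y)\<^sup>2 / (X * Y))"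
  proof -
    have "(\<alpha> * X + \<beta> * Y) * (\<alpha> / X + \<beta> / Y) = \<alpha>\<^sup>2 + \<beta>\<^sup>2 + \<alpha> * \<beta> * (X / Y + Y / X)"
      using XY by (simp add: field_simps power2_eq_square)
    also have "X / Y + Y / X = 2 + (X - Y)\<^sup>2 / (X * Y)"
      using XY by (simp add: field_simps power2_eq_square)
    also have "\<alpha>\<^sup>2 + \<beta>\<^sup>2 + \<alpha> * \<beta> * (2 + (X - Y)\<^sup>2 / (X * Y)) = (\<alpha> + \<beta>)\<^sup>2 + \<alpha> * \<beta> * ((X - Y)\<^sup>2 / (X * Y))"
      by (simp add: power2_eq_square algebra_simps)
    finally show ?thesis using ab by simp
  qed
  have mean: "\<alpha> * X + \<beta> * Y = H * (1 + \<alpha> * \<beta> * ((X - Y)\<^sup>2 / (X * Y)))"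
    using prod H unfolding XYrat by (simp add: field_simps)
  have le1: "H \<le> \<alpha> * X + \<beta> * Y" unfolding mean using H XY ab by simp
  have le2: "(\<alpha> * X + \<beta> * Y) ^ N \<le> \<alpha> * X ^ N + \<beta> * Y ^ N"
  proof -
    have "convex_on {0..} (\<lambda>x::real. x ^ N)"
    proof (cases "even N")
      case True
      then show ?thesis using convex_power_even convex_on_subset by (metis convex_real_interval(1) subset_UNIV)
    qed (rule convex_power_odd)
    then have "((1 - \<beta>) *\<^sub>R X + \<beta> *\<^sub>R Y) ^ N \<le> (1 - \<beta>) * X ^ N + \<beta> * Y ^ N"
      using ab XY by (intro convex_onD) auto
    moreover have "1 - \<beta> = \<alpha>" using ab(4) by simp
    ultimately show ?thesis by (simp only: real_scaleR_def)
  qed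
  have lhs: "1 / (p + q) ^ N = (1 / (a + b) ^ N) * H ^ N"
    using ab pos by (simp add: H_def power_divide)
  have rhs: "\<alpha> * (a ^ N * (1 / p ^ N)) + \<beta> * (b ^ N * (1 / q ^ N)) = \<alpha> * X ^ N + \<beta> * Y ^ N"
    by (simp add: X_def Y_def power_divide)
  have le3: "H ^ N \<le> (\<alpha> * X + \<beta> * Y) ^ N" using le1 H by (intro power_mono) auto
  show "1 / (p + q) ^ N \<le> (1 / (a + b) ^ N) * (\<alpha> * (a ^ N * (1 / p ^ N)) + \<beta> * (b ^ N * (1 / q ^ N)))"
    unfolding lhs rhs using le2 le3 ab by (intro mult_left_mono) auto
  assume N: "N > 0" and "1 / (p + q) ^ N = (1 / (a + b) ^ N) * (\<alpha> * (a ^ N * (1 / p ^ N)) + \<beta> * (b ^ N * (1 / q ^ N)))"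
  then have "H ^ N = \<alpha> * X ^ N + \<beta> * Y ^ N" unfolding lhs rhs using ab by simp
  then have "(\<alpha> * X + \<beta> * Y) ^ N \<le> H ^ N" using le2 by simp
  then have "\<alpha> * X + \<beta> * Y \<le> H" using H N by (simp add: power_mono_iff XY ab less_imp_le)
  then have "\<alpha> * \<beta> * ((X - Y)\<^sup>2 / (X * Y)) \<le> 0"
    unfolding mean using H by simp
  then have "(X - Y)\<^sup>2 / (X * Y) \<le> 0"
    using mult_pos_pos[OF ab(2,3)] unfolding mult_le_0_iff[of "\<alpha> * \<beta>"] by linarith
  then have "(X - Y)\<^sup>2 \<le> 0" using mult_pos_pos[OF XY] unfolding divide_le_0_iff by linarith
  then have "X = Y" by simp
  then show "p = (a / b) * q" using pos by (simp add: X_def Y_def field_simps)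
qed

text \<open>The pointwise inequality is integrated with a and b equal to the norms of k^(1/m) and
  l^(1/m) for the exponent -N. With this normalisation the integral of the right-hand side is
  exactly 1/(a + b)^N.\<close>

theorem sublevel_minkowski:
  fixes k l j :: "'a::euclidean_space \<Rightarrow> real"
  assumes k: "positive_sublinear k" and l: "positive_sublinear l" and j: "positive_sublinear j"
    and n: "DIM('a) = Suc m" and m: "m > 0"
    and le: "\<And>x. x \<noteq> 0 \<Longrightarrow> (k x powr (1 / real m) + l x powr (1 / real m)) ^ m \<le> j x"
  defines "e \<equiv> - 1 / (real DIM('a) * real m)"
  defines "VK \<equiv> volume {x. k x \<le> 1}" and "VL \<equiv> volume {x. l x \<le> 1}"
    and "VJ \<equiv> volume {x. j x \<le> 1}"
  shows "VK powr e + VL powr e \<le> VJ powr e"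
    and "VJ powr e = VK powr e + VL powr e \<Longrightarrow> \<exists>c>0. \<forall>x. k x = c ^ m * l x \<and> j x = (1 + c) ^ m * l x"
proof -
  interpret K: positive_sublinear k by fact
  interpret L: positive_sublinear l by fact
  interpret J: positive_sublinear j by fact
  let ?n = "DIM('a)"
  \<comment> \<open>With this N, k^(-n) is the power -N of k^(1/m), and the exponent e is
    -1/N.\<close>
  define N where "N = m * ?n"
  have N: "N > 0" using m by (simp add: N_def)
  have V: "VK > 0" "VL > 0" "VJ > 0"
    unfolding VK_def VL_def VJ_def by (rule K.measure_sublevel_pos L.measure_sublevel_pos J.measure_sublevel_pos)+
  define a b c where "a = VK powr e" and "b = VL powr e" and "c = VJ powr e"
  have abc: "a > 0" "b > 0" "c > 0" using V by (auto simp: a_def b_def c_def)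
  have root: "(v powr e) ^ N = 1 / v" if "v > 0" for v :: real
  proof -
    have "(v powr e) ^ N = v powr (e * real N)"
      using that by (simp add: powr_realpow[symmetric] powr_powr)
    also have "e * real N = -1" using m by (simp add: e_def N_def)
    finally show ?thesis using that by (simp add: powr_minus_divide)
  qed
  have aN: "a ^ N * VK = 1" "b ^ N * VL = 1" "c ^ N = 1 / VJ"
    using V by (auto simp: a_def b_def c_def root)
  let ?p = "\<lambda>x. k x powr (1 / real m)" and ?q = "\<lambda>x. l x powr (1 / real m)"
  have pq: "?p x > 0" "?q x > 0" "?p x ^ m = k x" "?q x ^ m = l x" "?p x ^ N = k x ^ ?n" "?q x ^ N = l x ^ ?n"
    if "x \<noteq> 0" for x
    using K.pos[OF that] L.pos[OF that] m by (auto simp: powr_inverse_power N_def power_mult)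
  define g where "g x = (1 / (a + b) ^ N) * (a / (a + b) * (a ^ N * (1 / k x ^ ?n)) + b / (a + b) * (b ^ N * (1 / l x ^ ?n)))" for x
  have le1: "1 / (?p x + ?q x) ^ N \<le> g x" if "x \<noteq> 0" for x
    using power_harmonic_mean_le(1)[OF abc(1,2) pq(1)[OF that] pq(2)[OF that], of N]
    unfolding g_def pq(5,6)[OF that] .
  have le2: "1 / j x ^ ?n \<le> 1 / (?p x + ?q x) ^ N" if "x \<noteq> 0" for x
  proof -
    have "(?p x + ?q x) ^ N \<le> j x ^ ?n"
      unfolding N_def power_mult using le[OF that] pq(1,2)[OF that] by (intro power_mono) auto
    moreover have "0 < (?p x + ?q x) ^ N" using pq(1,2)[OF that] by (intro zero_less_power add_pos_pos)
    ultimately show ?thesis by (intro divide_left_mono mult_pos_pos) auto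
  qed
  have nz: "x \<noteq> 0" if "x \<in> annulus" for x :: 'a using that by (auto simp: annulus_def)
  have cont: "continuous_on annulus (\<lambda>x. 1 / k x ^ ?n)" "continuous_on annulus (\<lambda>x. 1 / l x ^ ?n)"
    "continuous_on annulus (\<lambda>x. 1 / j x ^ ?n)"
    using K.pos[OF nz] L.pos[OF nz] J.pos[OF nz]
    by (auto intro!: continuous_intros K.continuous L.continuous J.continuous simp: less_imp_neq[symmetric] dest: less_imp_neq)
  have contg: "continuous_on annulus g"
    unfolding g_def by (intro continuous_on_mult continuous_on_add continuous_on_const cont)
  \<comment> \<open>The total loss in the two pointwise estimates \<open>le1\<close> and
    \<open>le2\<close>. It is written as a sum so that additivity and scaling of the integral
    apply.\<close>
  let ?f = "\<lambda>x. g x + (-1) * (1 / j x ^ ?n)"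
  have contf: "continuous_on annulus ?f"
    by (intro continuous_on_mult continuous_on_add continuous_on_const cont contg)
  have f0: "?f x \<ge> 0" if "x \<in> annulus" for x using le1[OF nz[OF that]] le2[OF nz[OF that]] by simp
  have "annulus_integral g = (1 / (a + b) ^ N) * (a / (a + b) * (a ^ N * VK) + b / (a + b) * (b ^ N * VL))"
    unfolding g_def VK_def VL_def K.measure_sublevel L.measure_sublevel
    by (simp only: annulus_integral_mult annulus_integral_add[OF continuous_on_mult[OF continuous_on_const continuous_on_mult[OF continuous_on_const cont(1)]]
        continuous_on_mult[OF continuous_on_const continuous_on_mult[OF continuous_on_const cont(2)]]])
  also have "\<dots> = 1 / (a + b) ^ N" unfolding aN using abc by (simp add: add_divide_distrib[symmetric])
  finally have f: "annulus_integral ?f = 1 / (a + b) ^ N - VJ"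
    unfolding annulus_integral_add[OF contg continuous_on_mult[OF continuous_on_const cont(3)]] annulus_integral_mult
    by (simp add: VJ_def J.measure_sublevel)
  have "VJ \<le> 1 / (a + b) ^ N" using annulus_integral_nonneg[of ?f, OF f0] f by simp
  then have "(a + b) ^ N \<le> c ^ N" unfolding aN(3) using V abc by (simp add: field_simps)
  then show "VK powr e + VL powr e \<le> VJ powr e"
    unfolding a_def[symmetric] b_def[symmetric] c_def[symmetric]
    using abc N by (simp add: power_mono_iff)
  assume "VJ powr e = VK powr e + VL powr e"
  then have "c = a + b" by (simp add: a_def b_def c_def)
  then have "(a + b) ^ N = 1 / VJ" using aN(3) by simp
  then have "annulus_integral ?f = 0" unfolding f using V by simp
  then have f_zero: "?f y = 0" if "1 < norm y" "norm y < 2" for y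
    using annulus_integral_eq_0[OF contf f0 _ that] by simp
  show "\<exists>c>0. \<forall>x. k x = c ^ m * l x \<and> j x = (1 + c) ^ m * l x"
  proof (intro exI conjI allI)
    show "a / b > 0" using abc by simp
    fix x :: 'a
    show "k x = (a / b) ^ m * l x" "j x = (1 + a / b) ^ m * l x"
    proof (atomize (full), cases "x = 0")
      case False
      \<comment> \<open>Moves x to norm 3/2, inside the open shell where \<open>f_zero\<close>
        holds; homogeneity brings the identities back to x.\<close>
      define r where "r = 3 / (2 * norm x)"
      have r: "r > 0" using False by (simp add: r_def)
      define y where "y = r *\<^sub>R x"
      have y: "norm y = 3 / 2" using False by (simp add: y_def r_def)
      then have y0: "y \<noteq> 0" by auto
      have "g y = 1 / j y ^ ?n" using f_zero[of y] y by simp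
      \<comment> \<open>The chain 1/j^n \<le> 1/(p + q)^N \<le> g has equal ends, so both
        inequalities are equalities.\<close>
      then have 1: "1 / (?p y + ?q y) ^ N = g y" "1 / (?p y + ?q y) ^ N = 1 / j y ^ ?n"
        using le1[OF y0] le2[OF y0] by auto
      have p: "?p y = (a / b) * ?q y"
        using power_harmonic_mean_le(2)[OF abc(1,2) pq(1)[OF y0] pq(2)[OF y0] N] 1(1)
        unfolding g_def pq(5,6)[OF y0] by blast
      have "(?p y + ?q y) ^ N = j y ^ ?n"
        using 1(2) by simp
      then have "((?p y + ?q y) ^ m) ^ ?n = j y ^ ?n" by (simp add: N_def power_mult)
      then have "(?p y + ?q y) ^ m = j y"
        using pq(1,2)[OF y0] J.pos[OF y0] by (subst (asm) power_eq_iff_eq_base) (auto intro: less_imp_le add_pos_pos)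
      moreover have "?p y + ?q y = (1 + a / b) * ?q y" using p by (simp add: algebra_simps)
      ultimately have "j y = (1 + a / b) ^ m * l y" using pq(4)[OF y0] by (simp add: power_mult_distrib)
      moreover have "k y = (a / b) ^ m * l y"
        using pq(3,4)[OF y0] p by (metis power_mult_distrib)
      moreover have "k y = r * k x" "l y = r * l x" "j y = r * j x"
        using r by (simp_all add: y_def K.scaleR L.scaleR J.scaleR)
      ultimately show "k x = (a / b) ^ m * l x \<and> j x = (1 + a / b) ^ m * l x"
        using r by simp
    qed simp
  qed
qed

section \<open>The equality case\<close>

lemma brightness_brunn_minkowski:
  fixes K L :: "'a::euclidean_space set"
  assumes n: "DIM('a) = Suc m" and m: "m > 0" and K: "convex_body K" and L: "convex_body L" and x: "x \<noteq> 0"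
  shows "(brightness K x powr (1 / real m) + brightness L x powr (1 / real m)) ^ m \<le> brightness (K + L) x"
proof -
  note cK = convex_bodyD[OF K] and cL = convex_bodyD[OF L]
  note cKL = convex_bodyD[OF convex_body_plus[OF K L]]
  define u where "u = (1 / norm x) *\<^sub>R x"
  have u: "norm u = 1" "x = norm x *\<^sub>R u" "norm x > 0" using x by (auto simp: u_def)
  have u0: "u \<noteq> 0" using u(1) by auto
  have scale: "brightness S x = norm x * brightness S u" if "compact S" "convex S" for S
    using brightness_scaleR[OF that, of "norm x" u] u by simp
  have pos: "brightness K u > 0" "brightness L u > 0" using brightness_pos[OF _ u0] K L by auto
  have "DIM('a) - 1 = m" using n by simp
  then have "(brightness K u powr (1 / real m) + brightness L u powr (1 / real m)) ^ m \<le> brightness (K + L) u"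
    using brunn_minkowski_hyperplane[OF _ u(1), of "hyperplane_projection u K" "hyperplane_projection u L"] pos n m
    unfolding brightness_unit[OF u(1) cK] brightness_unit[OF u(1) cL] brightness_unit[OF u(1) cKL]
      hyperplane_projection_plus
    by (simp add: hyperplane_projection_subset[OF u(1)] compact_hyperplane_projection convex_hyperplane_projection cK cL)
  then have "norm x * (brightness K u powr (1 / real m) + brightness L u powr (1 / real m)) ^ m \<le> norm x * brightness (K + L) u"
    by (intro mult_left_mono) auto
  then show ?thesis
    unfolding scale[OF cK] scale[OF cL] scale[OF cKL]
    using m pos by (subst powr_sum_scale) auto
qed

text \<open>The segment from 0 to z is c times the segment from 0 to z/c. Volume contributes c^n,
  and homogeneity of the brightness in z takes back one factor.\<close>

lemma brightness_affine_image:
  fixes L :: "'a::euclidean_space set"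
  assumes n: "DIM('a) = Suc m" and L: "compact L" "convex L" and c: "c > 0"
  shows "brightness ((\<lambda>y. c *\<^sub>R y + x) ` L) z = c ^ m * brightness L z"
proof -
  have "closed_segment 0 z = (*\<^sub>R) c ` closed_segment 0 ((1 / c) *\<^sub>R z)"
    using closed_segment_linear_image[of "(*\<^sub>R) c" 0 "(1 / c) *\<^sub>R z"] c by simp
  then have "(\<lambda>y. c *\<^sub>R y + x) ` L + closed_segment 0 z = (\<lambda>y. c *\<^sub>R y + x) ` (L + closed_segment 0 ((1 / c) *\<^sub>R z))"
    by (simp only: affine_image_plus)
  then have "brightness ((\<lambda>y. c *\<^sub>R y + x) ` L) z = c ^ DIM('a) * brightness L ((1 / c) *\<^sub>R z)"
    using c by (simp add: brightness_def measure_lborel_affine_image L compact_convex_plus_segment right_diff_distrib)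
  then show ?thesis using c n by (simp add: brightness_scaleR[OF L])
qed

lemma brightness_scaleR_image:
  fixes L :: "'a::euclidean_space set"
  assumes "DIM('a) = Suc m" "compact L" "convex L" "c > 0"
  shows "brightness ((*\<^sub>R) c ` L) z = c ^ m * brightness L z"
  using brightness_affine_image[OF assms, of 0] by simp

lemma convex_body_scaleR_image:
  fixes K :: "'a::euclidean_space set"
  assumes K: "convex_body K" and c: "c > 0"
  shows "convex_body ((*\<^sub>R) c ` K)"
proof (rule convex_body_if_measure_pos)
  show "0 < volume ((*\<^sub>R) c ` K)"
    using convex_body_measure_pos[OF K] K c by (subst measure_lborel_scaleR_image) (auto simp: convex_body_def)
qed (use K in \<open>auto simp: convex_body_def intro: compact_scaling convex_scaling\<close>)

lemma plus_homothetic_image: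
  fixes L :: "'a::real_vector set"
  assumes "convex L" "c \<ge> 0"
  shows "(\<lambda>y. c *\<^sub>R y + x) ` L + L = (\<lambda>y. (c + 1) *\<^sub>R y + x) ` L"
  unfolding affine_image_eq
  using convex_scaleR_plus[OF assms, of 1] by (simp add: add.assoc)

text \<open>A direction orthogonal to u sees neither the component removed by the projection nor the
  height of the cylinder.\<close>

lemma support_function_cylinder_projection:
  assumes "u \<bullet> w = 0"
  shows "support_function (cylinder u 1 (hyperplane_projection u K)) w = support_function K w"
proof -
  have "w \<bullet> u = 0" using assms by (simp add: inner_commute)
  then have "(\<lambda>x. w \<bullet> x) ` cylinder u 1 (hyperplane_projection u K) = (\<lambda>x. w \<bullet> x) ` K"
    by (force simp: cylinder_image hyperplane_projection_def set_plus_def inner_add_right inner_diff_right image_iff)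
  then show ?thesis by (simp add: support_function_def)
qed

text \<open>In dimension at least 3 any two vectors lie in a common hyperplane. Additivity and
  homogeneity involve at most two vectors and their combinations, so each instance can be checked
  inside one hyperplane.\<close>

lemma linear_if_linear_on_hyperplanes:
  fixes \<phi> :: "'a::euclidean_space \<Rightarrow> real"
  assumes n: "DIM('a) \<ge> 3" and hyp: "\<And>u. norm u = 1 \<Longrightarrow> \<exists>a. \<forall>w. u \<bullet> w = 0 \<longrightarrow> \<phi> w = w \<bullet> a"
  obtains a where "\<And>w. \<phi> w = w \<bullet> a"
proof -
  have orth: "\<exists>a. \<phi> v = v \<bullet> a \<and> \<phi> w = w \<bullet> a \<and> \<phi> (v + w) = (v + w) \<bullet> a \<and> (\<forall>c. \<phi> (c *\<^sub>R v) = (c *\<^sub>R v) \<bullet> a)" for v w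
  proof -
    have "dim {v, w} \<le> card {v, w}" by (rule dim_le_card') simp
    also have "\<dots> \<le> 2" by (simp add: card_insert_if)
    finally have "dim {v, w} < DIM('a)" using n by simp
    then obtain x where x: "x \<noteq> 0" "\<And>y. y \<in> span {v, w} \<Longrightarrow> orthogonal x y"
      using orthogonal_to_subspace_exists by blast
    have "orthogonal x v" "orthogonal x w" by (auto intro!: x(2) span_base)
    then have "x \<bullet> v = 0" "x \<bullet> w = 0" by (auto simp: orthogonal_def)
    moreover have "norm ((1 / norm x) *\<^sub>R x) = 1" using x(1) by simp
    then obtain a where "\<forall>w. ((1 / norm x) *\<^sub>R x) \<bullet> w = 0 \<longrightarrow> \<phi> w = w \<bullet> a" using hyp by blast
    ultimately show ?thesis by (intro exI[of _ a]) (auto simp: inner_add_right)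
  qed
  have "linear \<phi>"
  proof (rule linearI)
    show "\<phi> (v + w) = \<phi> v + \<phi> w" for v w using orth[of v w] by (auto simp: inner_add_left)
    show "\<phi> (c *\<^sub>R v) = c *\<^sub>R \<phi> v" for c v using orth[of v v] by auto
  qed
  then have "\<phi> w = w \<bullet> adjoint \<phi> 1" for w using adjoint_works[of \<phi> w 1] by simp
  then show thesis by (rule that)
qed

text \<open>Cylinders of height 1 over the projections are translates of each other by the equality case of
  the Brunn--Minkowski inequality, so the support functions differ by a linear function on every hyperplane.\<close>

lemma translate_if_brightness_equality:
  fixes K L :: "'a::euclidean_space set"
  assumes n: "DIM('a) = Suc m" "m \<ge> 2" and K: "convex_body K" and L: "convex_body L"
    and eq: "\<And>x. x \<noteq> 0 \<Longrightarrow> brightness K x = brightness L x"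
      "\<And>x. x \<noteq> 0 \<Longrightarrow> brightness (K + L) x = 2 ^ m * brightness L x"
  obtains a where "K = (+) a ` L"
proof -
  note cK = convex_bodyD[OF K] and cL = convex_bodyD[OF L]
  note cKL = convex_bodyD[OF convex_body_plus[OF K L]]
  let ?\<phi> = "\<lambda>w. support_function K w - support_function L w"
  have "\<exists>a. \<forall>w. u \<bullet> w = 0 \<longrightarrow> ?\<phi> w = w \<bullet> a" if u: "norm u = 1" for u
  proof -
    have u0: "u \<noteq> 0" using u by auto
    let ?P = "hyperplane_projection u K" and ?Q = "hyperplane_projection u L"
    let ?C = "cylinder u 1 ?P" and ?D = "cylinder u 1 ?Q"
    note sub = hyperplane_projection_subset[OF u]
    have V: "volume ?C = brightness K u" "volume ?D = brightness L u"
      using u sub cK cL by (simp_all add: measure_cylinder_compact compact_hyperplane_projection brightness_unit)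
    have CD: "convex_body ?C" "convex_body ?D"
      using V cK cL brightness_pos[OF K u0] brightness_pos[OF L u0]
      by (auto intro!: convex_body_if_measure_pos compact_cylinder convex_cylinder
          compact_hyperplane_projection convex_hyperplane_projection)
    \<comment> \<open>The sum of two cylinders of height 1 has height 2. This factor raises the
      given 2^m to the 2^n of the equality theorem.\<close>
    have "volume (?C + ?D) = 2 * brightness (K + L) u"
      using u sub cKL
      by (simp add: cylinder_plus measure_cylinder_compact hyperplane_projection_plus[symmetric]
          compact_hyperplane_projection brightness_unit)
    then have "volume (?C + ?D) = 2 ^ DIM('a) * volume ?C"
      using eq[OF u0] V n by simp
    moreover have "volume ?D = volume ?C" using V eq(1)[OF u0] by simp
    moreover have "DIM('a) \<ge> 2" using n by simp
    ultimately obtain a where a: "?C = (+) a ` ?D"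
      using brunn_minkowski_equality[OF _ CD] by blast
    have "?\<phi> w = w \<bullet> a" if w: "u \<bullet> w = 0" for w
    proof -
      have "support_function ?C w = w \<bullet> a + support_function ?D w"
        unfolding a using CD(2) by (intro support_function_translate) (auto simp: convex_body_def dest: subsetD[OF interior_subset])
      then show ?thesis by (simp add: support_function_cylinder_projection[OF w])
    qed
    then show ?thesis by blast
  qed
  then obtain a where a: "\<And>w. ?\<phi> w = w \<bullet> a"
    using linear_if_linear_on_hyperplanes[of ?\<phi>] n by auto
  have "K = (+) a ` L"
  proof (rule eq_if_support_function_eq)
    show "support_function K u = support_function ((+) a ` L) u" for u
      using a[of u] by (simp add: support_function_translate cL convex_body_props(1)[OF L])
  qed (use cK cL convex_body_props(1)[OF K] convex_body_props(1)[OF L] in \<open>auto intro: compact_translation convex_translation\<close>)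
  then show thesis by (rule that)
qed

text \<open>The rescaled body K' = K/c has the brightness of L, but the hypothesis concerns cK' + L
  rather than K' + L. Brunn--Minkowski gives the lower bound for K' + L; the upper bound comes from
  applying it to a decomposition of K + L that contains a multiple of K' + L.\<close>

lemma homothetic_if_brightness_proportional:
  fixes K L :: "'a::euclidean_space set"
  assumes n: "DIM('a) = Suc m" "m \<ge> 2" and K: "convex_body K" and L: "convex_body L" and c: "c > 0"
    and eq: "\<And>x. brightness K x = c ^ m * brightness L x"
      "\<And>x. brightness (K + L) x = (1 + c) ^ m * brightness L x"
  shows "homothetic K L"
proof -
  note cK = convex_bodyD[OF K] and cL = convex_bodyD[OF L]
  have m: "m > 0" using n by simp
  define K' where "K' = (*\<^sub>R) (1 / c) ` K"
  have K': "convex_body K'" unfolding K'_def using c by (intro convex_body_scaleR_image K) simp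
  note cK' = convex_bodyD[OF K']
  have KK': "K = (*\<^sub>R) c ` K'" using c by (simp add: K'_def image_image)
  have bK': "brightness K' x = brightness L x" for x
    unfolding K'_def using c by (simp add: brightness_scaleR_image[OF n(1) cK] eq(1) power_divide)
  note M = convex_body_plus[OF K' L]
  note cM = convex_bodyD[OF M]
  have bM: "brightness (K' + L) x = 2 ^ m * brightness L x" if x: "x \<noteq> 0" for x
  proof -
    define l r where "l = brightness L x powr (1 / real m)" and "r = brightness (K' + L) x powr (1 / real m)"
    have pos: "l > 0" "r > 0" using brightness_pos[OF L x] brightness_pos[OF M x] by (auto simp: l_def r_def)
    have lm: "l ^ m = brightness L x" "r ^ m = brightness (K' + L) x"
      using m brightness_pos[OF L x] brightness_pos[OF M x] by (auto simp: l_def r_def powr_inverse_power)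
    have root: "(a ^ m * b) powr (1 / real m) = a * b powr (1 / real m)" if "a > 0" "b > 0" for a b :: real
    proof -
      have "(a ^ m) powr (1 / real m) = a"
        using that m by (simp add: powr_realpow[symmetric] powr_powr)
      then show ?thesis using that by (simp add: powr_mult)
    qed
    have root_mono: "a \<le> b" if "a ^ m \<le> b ^ m" "0 \<le> a" "0 \<le> b" for a b :: real
      using that m by (subst (asm) power_mono_iff) auto
    have "2 * l \<le> r"
    proof -
      have "(2 * l) ^ m \<le> r ^ m"
        using brightness_brunn_minkowski[OF n(1) m K' L x] unfolding lm(2) bK' l_def by simp
      then show ?thesis using pos by - (rule root_mono; simp)
    qed
    \<comment> \<open>For c > 1, K + L is (c - 1)K' + (K' + L); for c < 1 it is c(K' + L) + (1 -
      c)L. In both cases the known root (1 + c) l for K + L leaves at most 2 l for K' + L.\<close>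
    moreover have "r \<le> 2 * l"
    proof -
      consider "c = 1" | "c > 1" | "c < 1" by linarith
      then show ?thesis
      proof cases
        case 1
        then have "K' = K" by (simp add: K'_def)
        then have "r ^ m = (2 * l) ^ m" using eq(2)[of x] 1 lm by (simp add: power_mult_distrib)
        then show ?thesis using pos by - (rule root_mono; simp)
      next
        case 2
        have "(*\<^sub>R) (c - 1) ` K' + K' = (*\<^sub>R) c ` K'"
          using convex_scaleR_plus[OF cK'(2), of "c - 1" 1] 2 by simp
        then have KL: "K + L = (*\<^sub>R) (c - 1) ` K' + (K' + L)"
          by (simp only: KK'[symmetric] add.assoc[symmetric])
        have "((c - 1) * l + r) ^ m \<le> ((1 + c) * l) ^ m"
          using brightness_brunn_minkowski[OF n(1) m convex_body_scaleR_image[OF K', of "c - 1"] M x] 2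
          by (simp add: brightness_scaleR_image[OF n(1) cK'] bK' root brightness_pos[OF L x]
              l_def[symmetric] r_def[symmetric] eq(2)[of x, unfolded KL] power_mult_distrib lm(1))
        then have "(c - 1) * l + r \<le> (1 + c) * l" using pos 2 by - (rule root_mono; simp)
        then show ?thesis by (simp add: algebra_simps)
      next
        case 3
        have "(*\<^sub>R) c ` (K' + L) = (*\<^sub>R) c ` K' + (*\<^sub>R) c ` L"
          by (rule linear_image_plus[OF linear_scaleR])
        moreover have "(*\<^sub>R) c ` L + (*\<^sub>R) (1 - c) ` L = L"
          using convex_scaleR_plus[OF cL(2), of c "1 - c"] 3 c by simp
        ultimately have KL: "K + L = (*\<^sub>R) c ` (K' + L) + (*\<^sub>R) (1 - c) ` L"
          by (simp only: KK'[symmetric] add.assoc)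
        have "(c * r + (1 - c) * l) ^ m \<le> ((1 + c) * l) ^ m"
          using brightness_brunn_minkowski[OF n(1) m convex_body_scaleR_image[OF M c] convex_body_scaleR_image[OF L, of "1 - c"] x] 3 c
          by (simp add: brightness_scaleR_image[OF n(1) cM] brightness_scaleR_image[OF n(1) cL] root
              brightness_pos[OF L x] brightness_pos[OF M x]
              l_def[symmetric] r_def[symmetric] eq(2)[of x, unfolded KL] power_mult_distrib lm(1))
        then have "c * r + (1 - c) * l \<le> (1 + c) * l" using pos 3 c by - (rule root_mono; simp)
        then have "c * r \<le> c * (2 * l)" by (simp add: algebra_simps)
        then show ?thesis using c by simp
      qed
    qed
    ultimately have "r = 2 * l" by simp
    then show ?thesis using lm by (simp add: power_mult_distrib)
  qed
  obtain a where "K' = (+) a ` L"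
    using translate_if_brightness_equality[OF n K' L bK' bM] by blast
  then have "K = (\<lambda>y. c *\<^sub>R y + c *\<^sub>R a) ` L"
    unfolding KK' by (simp add: image_image scaleR_add_right add.commute)
  then show ?thesis unfolding homothetic_def using c by blast
qed

lemma brightness_if_homothetic:
  fixes K L :: "'a::euclidean_space set"
  assumes n: "DIM('a) = Suc m" and L: "convex_body L" and K: "K = (\<lambda>y. c *\<^sub>R y + x) ` L" and c: "c > 0"
  shows "brightness K z = c ^ m * brightness L z" "brightness (K + L) z = (1 + c) ^ m * brightness L z"
proof -
  note cL = convex_bodyD[OF L]
  show "brightness K z = c ^ m * brightness L z"
    unfolding K by (rule brightness_affine_image[OF n cL c])
  have "K + L = (\<lambda>y. (c + 1) *\<^sub>R y + x) ` L"
    unfolding K using c by (intro plus_homothetic_image cL) simp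
  then show "brightness (K + L) z = (1 + c) ^ m * brightness L z"
    using brightness_affine_image[OF n cL, of "c + 1" x z] c by (simp add: add.commute)
qed

text \<open>Passing from h to k multiplies h^(1/m) by c, and the exponent makes the expression
  homogeneous of degree 1 in that root.\<close>

lemma measure_sublevel_scaled:
  fixes h k :: "'a::euclidean_space \<Rightarrow> real"
  assumes n: "DIM('a) = Suc m" "m > 0" and h: "positive_sublinear h" and k: "positive_sublinear k"
    and c: "c > 0" "\<And>x. k x = c ^ m * h x"
  shows "volume {x. k x \<le> 1} powr (- 1 / (real DIM('a) * real m))
    = c * volume {x. h x \<le> 1} powr (- 1 / (real DIM('a) * real m))"
proof -
  interpret h: positive_sublinear h by fact
  interpret k: positive_sublinear k by fact
  let ?e = "- 1 / (real DIM('a) * real m)"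
  have "volume {x. k x \<le> 1} = annulus_integral (\<lambda>y. (1 / (c ^ m) ^ DIM('a)) * (1 / h y ^ DIM('a)))"
    using k.measure_sublevel by (simp add: c(2) power_mult_distrib)
  also have "\<dots> = (1 / (c ^ m) ^ DIM('a)) * volume {x. h x \<le> 1}"
    unfolding annulus_integral_mult h.measure_sublevel ..
  finally have eq: "volume {x. k x \<le> 1} = (1 / (c ^ m) ^ DIM('a)) * volume {x. h x \<le> 1}" .
  have "volume {x. k x \<le> 1} powr ?e
      = (1 / (c ^ m) ^ DIM('a)) powr ?e * volume {x. h x \<le> 1} powr ?e"
    unfolding eq by (rule powr_mult)
  also have "(1 / (c ^ m) ^ DIM('a)) powr ?e = c"
  proof -
    have "1 / (c ^ m) ^ DIM('a) = c powr (- (real DIM('a) * real m))"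
      using c(1) by (simp add: powr_minus_divide power_mult[symmetric] powr_realpow[symmetric] powr_powr mult.commute)
    moreover have "- (real DIM('a) * real m) * ?e = 1" using n(2) by simp
    ultimately show ?thesis using c(1) by (simp only: powr_powr powr_one)
  qed
  finally show ?thesis .
qed

theorem corollary1:
  fixes K L :: "(real ^ 'n) set" and n :: nat
  assumes "n = CARD('n)" and "n \<ge> 3"
    and "convex_body K" and "convex_body L"
  shows "measure lebesgue (polar_body (projection_body (K + L)))
           powr (- 1 / (real n * (real n - 1)))
         \<ge> measure lebesgue (polar_body (projection_body K))
             powr (- 1 / (real n * (real n - 1)))
           + measure lebesgue (polar_body (projection_body L))
             powr (- 1 / (real n * (real n - 1)))
       \<and> (measure lebesgue (polar_body (projection_body (K + L)))
           powr (- 1 / (real n * (real n - 1)))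
         = measure lebesgue (polar_body (projection_body K))
             powr (- 1 / (real n * (real n - 1)))
           + measure lebesgue (polar_body (projection_body L))
             powr (- 1 / (real n * (real n - 1)))
         \<longleftrightarrow> homothetic K L)"
proof -
  note K = assms(3) and L = assms(4)
  note M = convex_body_plus[OF K L]
  define m where "m = n - 1"
  have m: "m \<ge> 2" "m > 0" "real n - 1 = real m" using assms(2) by (auto simp: m_def)
  have n: "DIM(real ^ 'n) = Suc m" "real n = real DIM(real ^ 'n)" using assms(1,2) by (auto simp: m_def)
  note sK = positive_sublinear_brightness[OF K] and sL = positive_sublinear_brightness[OF L]
    and sM = positive_sublinear_brightness[OF M]
  note mink = sublevel_minkowski[OF sK sL sM n(1) m(2) brightness_brunn_minkowski[OF n(1) m(2) K L]]
  note scaled = measure_sublevel_scaled[OF n(1) m(2) sL]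
  show ?thesis
    unfolding polar_projection_body_eq[OF K] polar_projection_body_eq[OF L] polar_projection_body_eq[OF M]
      positive_sublinear.measure_lebesgue_sublevel[OF sK] positive_sublinear.measure_lebesgue_sublevel[OF sL]
      positive_sublinear.measure_lebesgue_sublevel[OF sM] m(3)
    unfolding n(2)
  proof (intro conjI iffI)
    assume "homothetic K L"
    then obtain c x where c: "c > 0" "K = (\<lambda>y. c *\<^sub>R y + x) ` L" by (auto simp: homothetic_def)
    \<comment> \<open>The terms for K + L and K are 1 + c and c times the term for L, so they add
      up.\<close>
    note b = brightness_if_homothetic[OF n(1) L c(2,1)]
    show "volume {x. brightness (K + L) x \<le> 1} powr (- 1 / (real DIM(real ^ 'n) * real m))
      = volume {x. brightness K x \<le> 1} powr (- 1 / (real DIM(real ^ 'n) * real m))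
      + volume {x. brightness L x \<le> 1} powr (- 1 / (real DIM(real ^ 'n) * real m))"
      using scaled[OF sK c(1) b(1)] scaled[OF sM _ b(2)] c(1) by (simp only: distrib_right)
  next
    assume "volume {x. brightness (K + L) x \<le> 1} powr (- 1 / (real DIM(real ^ 'n) * real m))
      = volume {x. brightness K x \<le> 1} powr (- 1 / (real DIM(real ^ 'n) * real m))
      + volume {x. brightness L x \<le> 1} powr (- 1 / (real DIM(real ^ 'n) * real m))"
    from mink(2)[OF _ this] obtain c where "c > 0"
      "\<forall>x. brightness K x = c ^ m * brightness L x \<and> brightness (K + L) x = (1 + c) ^ m * brightness L x"
      by blast
    then show "homothetic K L"
      using homothetic_if_brightness_proportional[OF n(1) m(1) K L] by blast
  qed (rule mink(1))
qed

end
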